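(* Let $h\ge1$ be an integer. Then there exists a constant $\alpha_h\in\mathbb Q$ such that $$a_h(n)\sim\alpha_h\,\frac{3^{1/4}}{2\pi n^{1/4}}\,e^{\pi\sqrt{n/3}}\qquad\text{as } n\to\infty.$$
   Context: A partition $\lambda=(\lambda_1\ge\lambda_2\ge\dots\ge\lambda_\ell>0)$ of $n$ is drawn as its Ferrers diagram: left-adjusted rows of boxes, with $\lambda_i$ boxes in row $i$. The hook number of the box in row $i$ and column $j$ is the number of boxes in the L-shape consisting of that box, all boxes to its right in the same row, and all boxes below it in the same column. $\mathcal H(\lambda)$ denotes the multiset of all hook numbers of $\lambda$. Let $\mathcal O(n)$ be the set of partitions of $n$ all of whose parts are odd. For integers $h\ge1$ and $n\ge0$, define $$a_h(n)=\sum_{\lambda\in\mathcal O(n)}\#\{x\in\mathcal H(\lambda):x=h\},$$ counted with multiplicity. Here $f(n)\sim g(n)$ means $f(n)/g(n)\to1$. *)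

theory Defs
  imports
    Complex_Main
    "HOL-Library.Multiset"
    "HOL-Library.Landau_Symbols"
begin

text \<open>
  A partition of \<open>n\<close> is the weakly decreasing list of its positive parts (the empty list for
  \<open>n = 0\<close>). Rows and columns of the Ferrers diagram are numbered from 0.
\<close>

definition partitions_of :: "nat \<Rightarrow> nat list set" where
  "partitions_of n = {p. sorted_wrt (\<ge>) p \<and> (\<forall>x\<in>set p. x > 0) \<and> sum_list p = n}"

definition odd_partitions :: "nat \<Rightarrow> nat list set" where
  "odd_partitions n = {p \<in> partitions_of n. \<forall>x\<in>set p. odd x}"

definition ferrers :: "nat list \<Rightarrow> (nat \<times> nat) set" where
  "ferrers p = {(i, j). i < length p \<and> j < p ! i}"

definition hook :: "nat list \<Rightarrow> nat \<times> nat \<Rightarrow> (nat \<times> nat) set" where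
  "hook p = (\<lambda>(i, j). {(i', j') \<in> ferrers p. (i' = i \<and> j' \<ge> j) \<or> (j' = j \<and> i' \<ge> i)})"

definition hook_numbers :: "nat list \<Rightarrow> nat multiset" where
  "hook_numbers p = image_mset (\<lambda>b. card (hook p b)) (mset_set (ferrers p))"

definition odd_hook_count :: "nat \<Rightarrow> nat \<Rightarrow> nat" where
  "odd_hook_count h n = (\<Sum>p\<in>odd_partitions n. count (hook_numbers p) h)"

text \<open>
  The following finiteness facts exclude the default values of \<^const>\<open>sum\<close>, \<^const>\<open>card\<close> and
  \<^const>\<open>mset_set\<close> on infinite sets.
\<close>

lemma finite_ferrers: "finite (ferrers p)"
proof -
  have "ferrers p = (SIGMA i:{..<length p}. {..<p ! i})"
    by (auto simp: ferrers_def)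
  then show ?thesis by simp
qed

lemma finite_hook: "finite (hook p b)"
  by (rule finite_subset[OF _ finite_ferrers[of p]]) (auto simp: hook_def split: prod.splits)

lemma length_le_sum_list: "\<forall>x\<in>set p. x > 0 \<Longrightarrow> length p \<le> sum_list p" for p :: "nat list"
  by (induction p) auto

lemma finite_partitions_of: "finite (partitions_of n)"
proof (rule finite_subset)
  show "partitions_of n \<subseteq> {p. set p \<subseteq> {..n} \<and> length p \<le> n}"
    by (auto simp: partitions_of_def member_le_sum_list length_le_sum_list)
  show "finite {p. set p \<subseteq> {..n} \<and> length p \<le> n}"
    by (rule finite_lists_length_le) simp
qed

lemma finite_odd_partitions: "finite (odd_partitions n)"
  by (rule finite_subset[OF _ finite_partitions_of[of n]]) (auto simp: odd_partitions_def)

end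

(*
  A box in a row of length k with a boxes to its right has hook number h iff its leg length is
  l = h - 1 - a, and for given (a, k) there is at most one such box. It exists iff the number W of
  parts in {k - a..<k} satisfies W <= l < W + (multiplicity of k). Removing parts one at a time
  expresses the number of partitions in O(n) with this property as a finite signed sum of terms
  o(n - c k + d) with c >= 1, where o(n) = card (O(n)).

  By Euler's theorem o(n) is the coefficient of x^n in the product of the 1 + x^k, and a local limit
  theorem for the sum of independent Bernoulli multiples of k at the saddle point
  t = pi / (2 sqrt (3 n)) gives o(n) ~ 3^(-1/4) / 4 * n^(-3/4) * exp (pi sqrt (n/3)). Summing
  o(n - c k + d) over odd k by Stolz-Cesaro contributes 1 / (2 c) times the asserted order of growth,
  so the constant is rational. It is positive because every a contributes a nonnegative amount
  and a = 0 contributes 1 / (2 h).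
*)
theory Submission
  imports
    Defs
    "HOL-Probability.Probability"
    "HOL-Real_Asymp.Real_Asymp"
    "HOL-Computational_Algebra.Computational_Algebra"
begin

section \<open>Hooks and partition counts\<close>

text \<open>Weights are integers and \<open>odd_count\<close> vanishes below 0, so each signed
  expression is an identity valid for all \<open>n\<close> and all odd \<open>k > a\<close>, with a
  list of terms independent of both. This uniformity allows the sum over \<open>k\<close> to be
  evaluated term by term. As the signs mix, nonnegativity of a contribution is read off its limit,
  not its formula.

  The saddle point minimises \<open>t n + pi^2 / (12 t)\<close>, with minimum
  \<open>pi sqrt (n/3)\<close>. There the tilted sum has mean \<open>n + o(t^(-3/2))\<close> and
  variance about \<open>(pi^2/6) t^(-3)\<close>, so \<open>x = t^(3/2) w\<close> is the scale for
  Fourier inversion. A pointwise Gaussian limit does not suffice: dominated convergence needs an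
  integrable bound on all of \<open>|x| <= pi\<close>. For it the Bernoulli variances are bounded
  below by \<open>exp (- k t) / 4\<close>, which makes the exponent a geometric series with a closed
  form; at worst this leaves decay like \<open>exp (- const |w|^(2/3))\<close>. Truncating the
  product at \<open>k <= n\<close> costs errors of size \<open>exp (- n t)\<close> times powers of
  \<open>1/t\<close> and \<open>n t\<close>, negligible because \<open>n t\<close> has order
  \<open>sqrt n\<close>.\<close>

definition window_size :: "nat set \<Rightarrow> nat multiset \<Rightarrow> nat" where
  "window_size S M = size (filter_mset (\<lambda>x. x \<in> S) M)"

lemma window_size_add: "window_size S (add_mset x M) = (if x \<in> S then 1 else 0) + window_size S M"
  by (simp add: window_size_def)

lemma window_size_insert: "s \<notin> S \<Longrightarrow> window_size (insert s S) M = window_size S M + count M s"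
  by (induction M) (auto simp: window_size_def)

lemma window_size_mset: "window_size S (mset p) = card {i. i < length p \<and> p ! i \<in> S}"
  by (simp add: window_size_def length_filter_conv_card flip: mset_filter)

text \<open>
  A box in a row of length \<open>k\<close> with \<open>a\<close> boxes to its right has leg length \<open>W + r\<close>, where \<open>W\<close> is the
  number of parts in \<open>{k - a..<k}\<close> and \<open>r\<close> the number of later rows of length \<open>k\<close>. Hence among the
  boxes given by \<open>a\<close> and \<open>k\<close> there is at most one of a prescribed leg length.
\<close>

definition hook_slots :: "nat \<Rightarrow> nat \<Rightarrow> nat multiset \<Rightarrow> nat set" where
  "hook_slots a l M = {k. a < k \<and> window_size {k - a..<k} M \<le> l \<and> l < window_size {k - a..<k} M + count M k}"

lemma finite_hook_slots: "finite (hook_slots a l M)"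
  by (rule finite_subset[of _ "set_mset M"])
    (auto simp: hook_slots_def simp flip: count_greater_zero_iff)

text \<open>For \<open>a < x\<close> the left side is the leg length of the box with arm
  \<open>a\<close> in the new top row. No later row exceeds \<open>x\<close>, so a row reaching that
  column either has length \<open>x\<close> or falls into the window.\<close>

lemma card_parts_ge:
  assumes "sorted_wrt (\<ge>) (x # p)"
  shows "card {i. i < length p \<and> p ! i \<ge> x - a} = window_size {x - a..<x} (mset p) + count (mset p) x"
proof -
  have "{i. i < length p \<and> p ! i \<ge> x - a} = {i. i < length p \<and> p ! i \<in> insert x {x - a..<x}}"
    using assms nth_mem by (fastforce simp: le_less)
  then have "card {i. i < length p \<and> p ! i \<ge> x - a} = window_size (insert x {x - a..<x}) (mset p)"
    by (simp only: window_size_mset)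
  then show ?thesis by (simp add: window_size_insert)
qed

text \<open>The windows for \<open>k \<le> x\<close> do not contain \<open>x\<close>, and no
  \<open>k > x\<close> is a part. Hence only the multiplicity of \<open>x\<close> matters; raising
  it by one admits exactly one further leg length, that of the box in the new row.\<close>

lemma hook_slots_Cons:
  assumes "sorted_wrt (\<ge>) (x # p)"
  shows "hook_slots a l (mset (x # p)) =
    hook_slots a l (mset p) \<union> {k. k = x \<and> a < x \<and> card {i. i < length p \<and> p ! i \<ge> x - a} = l}"
proof -
  have le: "y \<le> x" if "y \<in> set p" for y using assms that by auto
  have big: "window_size {k - a..<k} (mset (x # p)) = window_size {k - a..<k} (mset p)" if "k \<le> x" for k
    using that by (simp add: window_size_add)
  have cnt0: "count (mset (x # p)) k = 0 \<and> count (mset p) k = 0" if "k > x" for k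
    using le[of k] that by (auto simp flip: not_in_iff)
  note eq = card_parts_ge[OF assms]
  show ?thesis
  proof (intro set_eqI)
    fix k
    consider "k < x" | "k = x" | "k > x" by linarith
    then show "k \<in> hook_slots a l (mset (x # p)) \<longleftrightarrow> k \<in> hook_slots a l (mset p) \<union>
        {k. k = x \<and> a < x \<and> card {i. i < length p \<and> p ! i \<ge> x - a} = l}"
    proof cases
      case 1
      then show ?thesis using big[of k] by (auto simp: hook_slots_def)
    next
      case 2
      then show ?thesis using big[of k] unfolding eq by (auto simp: hook_slots_def)
    next
      case 3
      have "k \<notin> hook_slots a l M" if "count M k = 0" for M
        using that by (simp add: hook_slots_def)
      then show ?thesis using cnt0[OF 3] 3 by blast
    qed
  qed
qed

text \<open>Hooks extend only to the right and downwards, so a row placed on top merely renumbers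
  the old ones.\<close>

lemma hook_Cons_Suc: "hook (x # p) (Suc i, j) = (\<lambda>(i, j). (Suc i, j)) ` hook p (i, j)"
proof (intro equalityI subsetI)
  fix b assume "b \<in> hook (x # p) (Suc i, j)"
  then obtain i' j' where "b = (Suc i', j')" "(i', j') \<in> hook p (i, j)"
    by (cases b; cases "fst b") (auto simp: hook_def ferrers_def)
  then show "b \<in> (\<lambda>(i, j). (Suc i, j)) ` hook p (i, j)" by force
qed (auto simp: hook_def ferrers_def)

lemma card_hook_Cons_Suc: "card (hook (x # p) (Suc i, j)) = card (hook p (i, j))"
  unfolding hook_Cons_Suc by (rule card_image) (auto simp: inj_on_def)

lemma card_hook_Cons_0:
  assumes "j < x"
  shows "card (hook (x # p) (0, j)) = (x - j) + card {i. i < length p \<and> p ! i > j}"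
proof -
  have "hook (x # p) (0, j) = Pair 0 ` {j..<x} \<union> (\<lambda>i. (Suc i, j)) ` {i. i < length p \<and> p ! i > j}"
  proof (intro set_eqI)
    fix b
    show "b \<in> hook (x # p) (0, j) \<longleftrightarrow> b \<in> Pair 0 ` {j..<x} \<union> (\<lambda>i. (Suc i, j)) ` {i. i < length p \<and> p ! i > j}"
      using assms by (cases b; cases "fst b") (auto simp: hook_def ferrers_def)
  qed
  then show ?thesis
    by (simp, subst card_Un_disjoint) (auto simp: card_image inj_on_def)
qed

lemma count_hook_numbers: "count (hook_numbers p) h = card {b \<in> ferrers p. card (hook p b) = h}"
proof -
  have "count (hook_numbers p) h = sum (count (mset_set (ferrers p))) ((\<lambda>b. card (hook p b)) -` {h} \<inter> ferrers p)"
    by (simp add: hook_numbers_def count_image_mset finite_ferrers)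
  also have "\<dots> = (\<Sum>b\<in>((\<lambda>b. card (hook p b)) -` {h} \<inter> ferrers p). 1)"
    by (rule sum.cong) (auto simp: finite_ferrers)
  finally show ?thesis by (simp add: vimage_def Int_def conj_commute)
qed

lemma count_hook_numbers_Cons:
  "count (hook_numbers (x # p)) h = count (hook_numbers p) h +
     card {j. j < x \<and> (x - j) + card {i. i < length p \<and> p ! i > j} = h}"
proof -
  let ?J = "{j. j < x \<and> (x - j) + card {i. i < length p \<and> p ! i > j} = h}"
  let ?B = "{b \<in> ferrers p. card (hook p b) = h}"
  have "{b \<in> ferrers (x # p). card (hook (x # p) b) = h} = (\<lambda>(i, j). (Suc i, j)) ` ?B \<union> Pair 0 ` ?J"
    (is "?L = ?R")
  proof (intro set_eqI)
    fix b :: "nat \<times> nat"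
    obtain i j where b: "b = (i, j)" by force
    show "b \<in> ?L \<longleftrightarrow> b \<in> ?R"
    proof (cases i)
      case 0
      then show ?thesis unfolding b using card_hook_Cons_0[of j x p]
        by (auto simp: ferrers_def)
    next
      case (Suc i')
      then show ?thesis unfolding b using card_hook_Cons_Suc[of x p i' j]
        by (auto simp: ferrers_def image_iff)
    qed
  qed
  moreover have "card ((\<lambda>(i, j). (Suc i, j)) ` ?B \<union> Pair 0 ` ?J) = card ?B + card ?J"
    by (subst card_Un_disjoint) (auto simp: finite_ferrers card_image inj_on_def)
  ultimately show ?thesis by (simp add: count_hook_numbers)
qed

text \<open>Induction from the bottom row upwards. A box with arm \<open>a\<close> in the new row
  has hook number \<open>h\<close> iff its leg is \<open>h - 1 - a\<close>, an exact subtraction for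
  \<open>a < h\<close>; \<open>hook_slots_Cons\<close> records precisely this box.\<close>

lemma count_hook_numbers_eq_sum:
  assumes "sorted_wrt (\<ge>) p"
  shows "count (hook_numbers p) h = (\<Sum>a<h. card (hook_slots a (h - 1 - a) (mset p)))"
  using assms
proof (induction p)
  case Nil
  show ?case by (simp add: hook_slots_def hook_numbers_def ferrers_def window_size_def)
next
  case (Cons x p)
  let ?N = "\<lambda>a. card {i. i < length p \<and> p ! i \<ge> x - a}"
  let ?A = "{a. a < h \<and> a < x \<and> ?N a = h - 1 - a}"
  have new: "card (hook_slots a l (mset (x # p))) =
      card (hook_slots a l (mset p)) + (if a < x \<and> ?N a = l then 1 else 0)" for a l
  proof (cases "a < x \<and> ?N a = l")
    case True
    \<comment> \<open>The new leg equals window size plus old multiplicity, just outside the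
      half-open range of old legs, so \<open>x\<close> was not a slot before.\<close>
    note card_parts_ge[OF Cons.prems, of a]
    with True have "x \<notin> hook_slots a l (mset p)" by (auto simp: hook_slots_def)
    moreover have "hook_slots a l (mset (x # p)) = insert x (hook_slots a l (mset p))"
      unfolding hook_slots_Cons[OF Cons.prems] using True by auto
    ultimately show ?thesis using True by (simp add: finite_hook_slots)
  next
    case False
    then have "hook_slots a l (mset (x # p)) = hook_slots a l (mset p)"
      unfolding hook_slots_Cons[OF Cons.prems] by auto
    then show ?thesis using False by simp
  qed
  \<comment> \<open>Column \<open>j\<close> of the new row has arm \<open>x - 1 - j\<close>, and
    this map is its own inverse.\<close>
  have "card {j. j < x \<and> (x - j) + card {i. i < length p \<and> p ! i > j} = h} = card ?A"
  proof (rule bij_betw_same_card[of "\<lambda>j. x - 1 - j"], rule bij_betwI[where g = "\<lambda>a. x - 1 - a"])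
    have N: "p ! i \<ge> x - (x - 1 - j) \<longleftrightarrow> p ! i > j" if "j < x" for i j using that by auto
    have N': "p ! i > x - 1 - a \<longleftrightarrow> p ! i \<ge> x - a" if "a < x" for i a using that by auto
    show "(\<lambda>j. x - 1 - j) \<in> {j. j < x \<and> (x - j) + card {i. i < length p \<and> p ! i > j} = h} \<rightarrow> ?A"
      using N by auto
    show "(\<lambda>a. x - 1 - a) \<in> ?A \<rightarrow> {j. j < x \<and> (x - j) + card {i. i < length p \<and> p ! i > j} = h}"
      using N' by (auto simp: Suc_diff_Suc)
  qed auto
  also have "\<dots> = (\<Sum>a<h. if a < x \<and> ?N a = h - 1 - a then 1 else 0)"
    by (subst sum.inter_filter[symmetric]) (auto intro!: arg_cong[where f = card])
  finally show ?case
    using Cons by (simp add: count_hook_numbers_Cons new sum.distrib del: mset.simps)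
qed

section \<open>Counting odd partitions by removing parts\<close>

declare of_nat_sum_mset [simp del]

text \<open>The weight is an integer so that removing a part larger than the weight leads to an
  empty set instead of a truncated difference; the recurrences then need no case distinction on the
  size of \<open>n\<close>.\<close>

definition odd_msets :: "int \<Rightarrow> nat multiset set" where
  "odd_msets n = {M. (\<forall>x\<in>#M. odd x) \<and> int (sum_mset M) = n}"

lemma bij_betw_mset_odd_partitions: "bij_betw mset (odd_partitions n) (odd_msets (int n))"
proof (rule bij_betwI[where g = "\<lambda>M. rev (sorted_list_of_multiset M)"])
  show "mset \<in> odd_partitions n \<rightarrow> odd_msets (int n)"
    by (auto simp: odd_partitions_def partitions_of_def odd_msets_def sum_mset_sum_list)
  show "(\<lambda>M. rev (sorted_list_of_multiset M)) \<in> odd_msets (int n) \<rightarrow> odd_partitions n"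
  proof
    fix M assume "M \<in> odd_msets (int n)"
    moreover have "sum_list (sorted_list_of_multiset M) = sum_mset M"
      by (metis mset_sorted_list_of_multiset sum_mset_sum_list)
    ultimately show "rev (sorted_list_of_multiset M) \<in> odd_partitions n"
      by (auto simp: odd_partitions_def partitions_of_def odd_msets_def sorted_wrt_rev intro: odd_pos)
  qed
  show "rev (sorted_list_of_multiset (mset p)) = p" if "p \<in> odd_partitions n" for p
  proof -
    have "sorted (rev p)" using that by (simp add: odd_partitions_def partitions_of_def sorted_wrt_rev)
    then have "sort p = rev p" by (intro properties_for_sort) auto
    then show ?thesis by simp
  qed
qed auto

lemma finite_odd_msets: "finite (odd_msets n)"
proof (cases "n \<ge> 0")
  case True
  then show ?thesis
    using bij_betw_finite[OF bij_betw_mset_odd_partitions[of "nat n"]] finite_odd_partitions[of "nat n"]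
    by simp
next
  case False
  then have "odd_msets n = {}" by (auto simp: odd_msets_def)
  then show ?thesis by simp
qed

definition odd_count :: "int \<Rightarrow> int" where
  "odd_count n = int (card (odd_msets n))"

lemma odd_count_neg: "n < 0 \<Longrightarrow> odd_count n = 0"
  by (auto simp: odd_count_def odd_msets_def)

lemma part_le_odd_msets: "M \<in> odd_msets n \<Longrightarrow> k \<in># M \<Longrightarrow> int k \<le> n"
  by (auto simp: odd_msets_def dest!: multi_member_split)

text \<open>\<open>add_mset s\<close> is the inverse map. The condition is put on the remainder so
  that any property can be carried along; this is the source of every shift in the
  recurrences.\<close>

lemma card_remove_part:
  assumes "odd s"
  shows "card {M \<in> odd_msets n. s \<in># M \<and> P (M - {#s#})} = card {M \<in> odd_msets (n - int s). P M}"
proof (rule bij_betw_same_card[of "\<lambda>M. M - {#s#}"], rule bij_betwI[where g = "add_mset s"])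
  show "(\<lambda>M. M - {#s#}) \<in> {M \<in> odd_msets n. s \<in># M \<and> P (M - {#s#})} \<rightarrow> {M \<in> odd_msets (n - int s). P M}"
  proof
    fix M assume M: "M \<in> {M \<in> odd_msets n. s \<in># M \<and> P (M - {#s#})}"
    then obtain A where "M = add_mset s A" by (auto dest: multi_member_split)
    with M show "M - {#s#} \<in> {M \<in> odd_msets (n - int s). P M}" by (auto simp: odd_msets_def)
  qed
qed (use assms in \<open>auto simp: odd_msets_def\<close>)

definition window_count :: "nat set \<Rightarrow> nat \<Rightarrow> int \<Rightarrow> int" where
  "window_count S l n = int (card {M \<in> odd_msets n. window_size S M \<le> l})"

lemma window_count_empty: "window_count {} l n = odd_count n"
  by (simp add: window_count_def odd_count_def window_size_def)

lemma card_filter_split: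
  assumes "finite A"
  shows "int (card {x \<in> A. P x}) = int (card {x \<in> A. P x \<and> Q x}) + int (card {x \<in> A. P x \<and> \<not> Q x})"
proof -
  have "{x \<in> A. P x} = {x \<in> A. P x \<and> Q x} \<union> {x \<in> A. P x \<and> \<not> Q x}" by auto
  then show ?thesis using assms
    by (simp add: card_Un_disjoint[symmetric] disjoint_iff flip: of_nat_add)
qed

text \<open>Split by whether \<open>s\<close> occurs. Without \<open>s\<close> both windows impose
  the same condition, so these multisets cancel. With \<open>s\<close>, removing one copy leaves the
  count for \<open>S\<close> unchanged and lowers the count for \<open>insert s S\<close> by one,
  hence the bound \<open>l - 1\<close>.\<close>

lemma window_count_insert:
  assumes "odd s" "s \<notin> S"
  shows "window_count (insert s S) l n = window_count S l n - window_count S l (n - int s)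
    + (if l = 0 then 0 else window_count (insert s S) (l - 1) (n - int s))"
proof -
  let ?A = "odd_msets n"
  have size: "window_size (insert s S) M = Suc (window_size (insert s S) (M - {#s#}))"
    and size': "window_size S M = window_size S (M - {#s#})" if "s \<in># M" for M
    using that assms by (auto simp: window_size_add dest!: multi_member_split)
  have 1: "card {M \<in> ?A. window_size (insert s S) M \<le> l \<and> s \<in># M} =
      (if l = 0 then 0 else card {M \<in> odd_msets (n - int s). window_size (insert s S) M \<le> l - 1})"
  proof (cases "l = 0")
    case True
    then have "{M \<in> ?A. window_size (insert s S) M \<le> l \<and> s \<in># M} = {}" using size by auto
    then show ?thesis using True by (metis card.empty)
  next
    case False
    then have "{M \<in> ?A. window_size (insert s S) M \<le> l \<and> s \<in># M} =
        {M \<in> ?A. s \<in># M \<and> window_size (insert s S) (M - {#s#}) \<le> l - 1}"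
      using size by auto
    then show ?thesis using False card_remove_part[OF assms(1)] by simp
  qed
  have "{M \<in> ?A. window_size S M \<le> l \<and> s \<in># M} = {M \<in> ?A. s \<in># M \<and> window_size S (M - {#s#}) \<le> l}"
    using size' by auto
  then have 2: "card {M \<in> ?A. window_size S M \<le> l \<and> s \<in># M} =
      card {M \<in> odd_msets (n - int s). window_size S M \<le> l}"
    using card_remove_part[OF assms(1)] by simp
  have 3: "{M \<in> ?A. window_size (insert s S) M \<le> l \<and> s \<notin># M} = {M \<in> ?A. window_size S M \<le> l \<and> s \<notin># M}"
    using assms(2) by (auto simp: window_size_insert not_in_iff)
  show ?thesis
    unfolding window_count_def
    using card_filter_split[OF finite_odd_msets, of n "\<lambda>M. window_size (insert s S) M \<le> l" "\<lambda>M. s \<in># M"]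
      card_filter_split[OF finite_odd_msets, of n "\<lambda>M. window_size S M \<le> l" "\<lambda>M. s \<in># M"] 1 2 3
    by simp
qed

definition slot_count :: "nat set \<Rightarrow> nat \<Rightarrow> nat \<Rightarrow> int \<Rightarrow> int" where
  "slot_count S l k n = int (card {M \<in> odd_msets n. window_size S M \<le> l \<and> l < window_size S M + count M k})"

text \<open>The slot condition says that the window \<open>S\<close> holds at most \<open>l\<close>
  parts but \<open>insert k S\<close> does not. In the difference of the two counts the recurrence
  cancels the unshifted term, so every remaining argument contains \<open>- int k\<close>. This is
  why all coefficients \<open>c\<close> end up at least 1.\<close>

lemma slot_count_eq:
  assumes "odd k" "k \<notin> S"
  shows "slot_count S l k n = window_count S l (n - int k)
    - (if l = 0 then 0 else window_count (insert k S) (l - 1) (n - int k))"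
proof -
  have "{M \<in> odd_msets n. window_size S M \<le> l \<and> window_size (insert k S) M \<le> l} =
      {M \<in> odd_msets n. window_size (insert k S) M \<le> l}"
    using assms by (auto simp: window_size_insert)
  then have "window_count S l n = window_count (insert k S) l n + slot_count S l k n"
    using card_filter_split[OF finite_odd_msets, of n "\<lambda>M. window_size S M \<le> l" "\<lambda>M. window_size (insert k S) M \<le> l"] assms
    unfolding window_count_def slot_count_def by (simp add: window_size_insert not_le)
  then show ?thesis using window_count_insert[OF assms, of l n] by simp
qed

text \<open>With an empty window the condition is that \<open>k\<close> occurs more than
  \<open>l\<close> times, and \<open>l + 1\<close> copies can be removed. It settles the case of arm
  0 without cancellation.\<close>

lemma slot_count_empty:
  assumes "odd k"
  shows "slot_count {} l k n = odd_count (n - int (Suc l) * int k)"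
proof (induction l arbitrary: n)
  case 0
  show ?case using slot_count_eq[OF assms, of "{}" 0 n] by (simp add: window_count_empty)
next
  case (Suc l)
  have "{M \<in> odd_msets n. Suc l < count M k} = {M \<in> odd_msets n. k \<in># M \<and> l < count (M - {#k#}) k}"
    by (auto simp flip: count_greater_zero_iff)
  then have "slot_count {} (Suc l) k n = slot_count {} l k (n - int k)"
    using card_remove_part[OF assms, of n "\<lambda>M. l < count M k"] by (simp add: slot_count_def window_size_def)
  then show ?case by (simp add: Suc algebra_simps)
qed

text \<open>
  Only odd parts matter, so the window \<open>{k - a..<k}\<close> may be replaced by the \<open>a div 2\<close> odd numbers
  \<open>k - 2, k - 4, \<dots>\<close> (for odd \<open>k\<close>).
\<close>

definition odd_window :: "nat \<Rightarrow> nat \<Rightarrow> nat set" where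
  "odd_window k b = (\<lambda>i. k - 2 * Suc i) ` {..<b}"

lemma odd_window_Suc: "odd_window k (Suc b) = insert (k - 2 * Suc b) (odd_window k b)"
  by (auto simp: odd_window_def lessThan_Suc)

lemma window_size_odd_window:
  assumes "odd k" "a < k" "\<forall>x\<in>#M. odd x"
  shows "window_size {k - a..<k} M = window_size (odd_window k (a div 2)) M"
proof -
  have "x \<in> {k - a..<k} \<longleftrightarrow> x \<in> odd_window k (a div 2)" if "odd x" for x
  proof
    assume x: "x \<in> {k - a..<k}"
    define i where "i = (k - x) div 2"
    have i: "k = x + 2 * i" using x that assms(1) by (simp add: i_def)
    with x have "i > 0" "i - 1 < a div 2" by auto
    moreover have "x = k - 2 * Suc (i - 1)" using i \<open>i > 0\<close> by auto
    ultimately show "x \<in> odd_window k (a div 2)" unfolding odd_window_def by blast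
  qed (use assms(2) in \<open>auto simp: odd_window_def\<close>)
  with assms(3) show ?thesis unfolding window_size_def
    by (intro arg_cong[where f = size] filter_mset_cong) auto
qed

lemma odd_hook_count_eq_sum:
  "int (odd_hook_count h n) =
    (\<Sum>a<h. \<Sum>k | odd k \<and> a < k \<and> k \<le> n. slot_count (odd_window k (a div 2)) (h - 1 - a) k (int n))"
proof -
  let ?K = "\<lambda>a. {k. odd k \<and> a < k \<and> k \<le> n}"
  let ?P = "\<lambda>a k M. window_size (odd_window k (a div 2)) M \<le> h - 1 - a \<and>
      h - 1 - a < window_size (odd_window k (a div 2)) M + count M k"
  have "odd_hook_count h n = (\<Sum>p\<in>odd_partitions n. \<Sum>a<h. card (hook_slots a (h - 1 - a) (mset p)))"
    unfolding odd_hook_count_def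
    by (rule sum.cong[OF refl], rule count_hook_numbers_eq_sum) (simp add: odd_partitions_def partitions_of_def)
  also have "\<dots> = (\<Sum>M\<in>odd_msets (int n). \<Sum>a<h. card (hook_slots a (h - 1 - a) M))"
    by (rule sum.reindex_bij_betw[OF bij_betw_mset_odd_partitions])
  also have "\<dots> = (\<Sum>M\<in>odd_msets (int n). \<Sum>a<h. \<Sum>k\<in>?K a. if ?P a k M then 1 else 0)"
  proof (intro sum.cong refl)
    fix M a assume M: "M \<in> odd_msets (int n)"
    have "hook_slots a (h - 1 - a) M = {k \<in> ?K a. ?P a k M}"
    proof (intro set_eqI)
      fix k
      show "k \<in> hook_slots a (h - 1 - a) M \<longleftrightarrow> k \<in> {k \<in> ?K a. ?P a k M}"
      proof (cases "k \<in># M \<and> a < k")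
        case True
        then have "odd k" "k \<le> n" using M part_le_odd_msets[OF M, of k] by (auto simp: odd_msets_def)
        moreover have "window_size {k - a..<k} M = window_size (odd_window k (a div 2)) M"
          using M True \<open>odd k\<close> by (intro window_size_odd_window) (auto simp: odd_msets_def)
        ultimately show ?thesis using True by (simp add: hook_slots_def)
      next
        case False
        then show ?thesis by (auto simp: hook_slots_def not_in_iff)
      qed
    qed
    then show "card (hook_slots a (h - 1 - a) M) = (\<Sum>k\<in>?K a. if ?P a k M then 1 else 0)"
      by (simp flip: sum.inter_filter)
  qed
  also have "\<dots> = (\<Sum>a<h. \<Sum>k\<in>?K a. \<Sum>M\<in>odd_msets (int n). if ?P a k M then 1 else 0)"
    by (subst sum.swap, rule sum.cong[OF refl], rule sum.swap)
  also have "\<dots> = (\<Sum>a<h. \<Sum>k\<in>?K a. card {M \<in> odd_msets (int n). ?P a k M})"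
    by (simp add: finite_odd_msets flip: sum.inter_filter)
  finally show ?thesis by (simp only: slot_count_def of_nat_sum)
qed

section \<open>Signed sums of shifted partition counts\<close>

definition shift_sum :: "(int \<times> nat \<times> int) list \<Rightarrow> nat \<Rightarrow> int \<Rightarrow> int" where
  "shift_sum ts k n = (\<Sum>(e, c, d)\<leftarrow>ts. e * odd_count (n - int c * int k + d))"

text \<open>One list serves all \<open>k\<close> and \<open>n\<close>. The bound \<open>K\<close>
  keeps the window elements below \<open>k\<close> positive, so that natural subtraction is exact.
  The bound \<open>c0\<close> tracks the coefficient of \<open>k\<close>: once
  \<open>c \<ge> 1\<close>, only finitely many \<open>k\<close> contribute for each
  \<open>n\<close>.\<close>

definition is_shift_sum :: "nat \<Rightarrow> nat \<Rightarrow> (nat \<Rightarrow> int \<Rightarrow> int) \<Rightarrow> bool" where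
  "is_shift_sum K c0 F \<longleftrightarrow>
    (\<exists>ts. (\<forall>(e, c, d)\<in>set ts. c \<ge> c0) \<and> (\<forall>k>K. odd k \<longrightarrow> (\<forall>n. F k n = shift_sum ts k n)))"

lemma is_shift_sum_cong:
  assumes "\<And>k n. k > K \<Longrightarrow> odd k \<Longrightarrow> F k n = G k n" "is_shift_sum K c0 G"
  shows "is_shift_sum K c0 F"
proof -
  obtain ts where "\<forall>(e, c, d)\<in>set ts. c \<ge> c0" "\<forall>k>K. odd k \<longrightarrow> (\<forall>n. G k n = shift_sum ts k n)"
    using assms(2) unfolding is_shift_sum_def by blast
  with assms(1) show ?thesis unfolding is_shift_sum_def by (intro exI[of _ ts]) simp
qed

lemma is_shift_sum_odd_count: "is_shift_sum K 0 (\<lambda>k n. odd_count n)"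
  unfolding is_shift_sum_def by (rule exI[of _ "[(1, 0, 0)]"]) (simp add: shift_sum_def)

lemma is_shift_sum_zero: "is_shift_sum K c0 (\<lambda>k n. 0)"
  unfolding is_shift_sum_def by (rule exI[of _ "[]"]) (simp add: shift_sum_def)

lemma is_shift_sum_add:
  assumes "is_shift_sum K c0 F" "is_shift_sum K c0 G"
  shows "is_shift_sum K c0 (\<lambda>k n. F k n + G k n)"
proof -
  obtain ts us where "\<forall>(e, c, d)\<in>set ts. c \<ge> c0" "\<forall>k>K. odd k \<longrightarrow> (\<forall>n. F k n = shift_sum ts k n)"
      "\<forall>(e, c, d)\<in>set us. c \<ge> c0" "\<forall>k>K. odd k \<longrightarrow> (\<forall>n. G k n = shift_sum us k n)"
    using assms unfolding is_shift_sum_def by blast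
  then show ?thesis unfolding is_shift_sum_def
    by (intro exI[of _ "ts @ us"]) (auto simp: shift_sum_def)
qed

lemma is_shift_sum_uminus:
  assumes "is_shift_sum K c0 F"
  shows "is_shift_sum K c0 (\<lambda>k n. - F k n)"
proof -
  obtain ts where "\<forall>(e, c, d)\<in>set ts. c \<ge> c0" "\<forall>k>K. odd k \<longrightarrow> (\<forall>n. F k n = shift_sum ts k n)"
    using assms unfolding is_shift_sum_def by blast
  moreover have "shift_sum (map (\<lambda>(e, c, d). (- e, c, d)) ts) k n = - shift_sum ts k n" for k n
    by (induction ts) (auto simp: shift_sum_def)
  ultimately show ?thesis unfolding is_shift_sum_def
    by (intro exI[of _ "map (\<lambda>(e, c, d). (- e, c, d)) ts"]) auto
qed

lemma is_shift_sum_diff: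
  "is_shift_sum K c0 F \<Longrightarrow> is_shift_sum K c0 G \<Longrightarrow> is_shift_sum K c0 (\<lambda>k n. F k n - G k n)"
  using is_shift_sum_add[OF _ is_shift_sum_uminus, of K c0 F G] by simp

text \<open>Substituting \<open>n - k + d\<close> raises every coefficient \<open>c\<close> by one;
  this is the only operation that raises the lower bound.\<close>

lemma is_shift_sum_shift:
  assumes "is_shift_sum K c0 F"
  shows "is_shift_sum K (Suc c0) (\<lambda>k n. F k (n - int k + d))"
proof -
  obtain ts where "\<forall>(e, c, d)\<in>set ts. c \<ge> c0" "\<forall>k>K. odd k \<longrightarrow> (\<forall>n. F k n = shift_sum ts k n)"
    using assms unfolding is_shift_sum_def by blast
  moreover have "shift_sum (map (\<lambda>(e, c, d'). (e, Suc c, d' + d)) ts) k n = shift_sum ts k (n - int k + d)" for k n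
    by (induction ts) (auto simp: shift_sum_def algebra_simps)
  ultimately show ?thesis unfolding is_shift_sum_def
    by (intro exI[of _ "map (\<lambda>(e, c, d'). (e, Suc c, d' + d)) ts"]) auto
qed

lemma is_shift_sum_mono:
  assumes "is_shift_sum K c0 F" "c1 \<le> c0"
  shows "is_shift_sum K c1 F"
proof -
  obtain ts where ts: "\<forall>(e, c, d)\<in>set ts. c \<ge> c0" "\<forall>k>K. odd k \<longrightarrow> (\<forall>n. F k n = shift_sum ts k n)"
    using assms(1) unfolding is_shift_sum_def by blast
  have "\<forall>(e, c, d)\<in>set ts. c \<ge> c1" using ts(1) assms(2) by auto
  with ts(2) show ?thesis unfolding is_shift_sum_def by blast
qed

lemma is_shift_sum_window_count_insert:
  assumes "\<And>l. is_shift_sum K 0 (\<lambda>k n. window_count (S k) l n)"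
    and "\<And>k. k > K \<Longrightarrow> odd k \<Longrightarrow> e < k \<and> k - e \<notin> S k" "even e"
  shows "is_shift_sum K 0 (\<lambda>k n. window_count (insert (k - e) (S k)) l n)"
proof -
  have shifted: "is_shift_sum K 0 (\<lambda>k n. F k (n - int k + int e))" if "is_shift_sum K 0 F" for F
    using is_shift_sum_mono[OF is_shift_sum_shift[OF that]] by blast
  show ?thesis
  proof (induction l)
    case 0
    have "is_shift_sum K 0 (\<lambda>k n. window_count (S k) 0 n - window_count (S k) 0 (n - int k + int e))"
      by (rule is_shift_sum_diff[OF assms(1) shifted[OF assms(1)]])
    then show ?case
    proof (rule is_shift_sum_cong[rotated])
      fix k n assume k: "K < k" "odd k"
      then have "odd (k - e)" "k - e \<notin> S k" and eq: "n - int (k - e) = n - int k + int e"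
        using assms(2)[OF k] assms(3) by auto
      then show "window_count (insert (k - e) (S k)) 0 n = window_count (S k) 0 n - window_count (S k) 0 (n - int k + int e)"
        using window_count_insert[of "k - e" "S k" _ n] unfolding eq by simp
    qed
  next
    case (Suc l)
    have "is_shift_sum K 0 (\<lambda>k n. window_count (S k) (Suc l) n - window_count (S k) (Suc l) (n - int k + int e)
        + window_count (insert (k - e) (S k)) l (n - int k + int e))"
      by (rule is_shift_sum_add[OF is_shift_sum_diff[OF assms(1) shifted[OF assms(1)]] shifted[OF Suc.IH]])
    then show ?case
    proof (rule is_shift_sum_cong[rotated])
      fix k n assume k: "K < k" "odd k"
      then have "odd (k - e)" "k - e \<notin> S k" and eq: "n - int (k - e) = n - int k + int e"
        using assms(2)[OF k] assms(3) by auto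
      then show "window_count (insert (k - e) (S k)) (Suc l) n =
          window_count (S k) (Suc l) n - window_count (S k) (Suc l) (n - int k + int e)
        + window_count (insert (k - e) (S k)) l (n - int k + int e)"
        using window_count_insert[of "k - e" "S k" _ n] unfolding eq by simp
    qed
  qed
qed

lemma is_shift_sum_window_count:
  assumes "2 * b \<le> K"
  shows "is_shift_sum K 0 (\<lambda>k n. window_count (odd_window k b) l n)"
  using assms
proof (induction b arbitrary: l)
  case 0
  then show ?case by (simp add: odd_window_def window_count_empty is_shift_sum_odd_count)
next
  case (Suc b)
  show ?case unfolding odd_window_Suc
  proof (rule is_shift_sum_window_count_insert[where S = "\<lambda>k. odd_window k b" and e = "2 * Suc b"])
    show "2 * Suc b < k \<and> k - 2 * Suc b \<notin> odd_window k b" if "k > K" for k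
      using that Suc.prems by (auto simp: odd_window_def)
  qed (use Suc in auto)
qed

text \<open>Both window counts in \<open>slot_count_eq\<close> are evaluated at
  \<open>n - k\<close>, so a final shift lifts the bound on the coefficients from 0 to 1.\<close>

lemma is_shift_sum_slot_count:
  "is_shift_sum a 1 (\<lambda>k n. slot_count (odd_window k (a div 2)) l k n)"
proof -
  have notin: "k \<notin> odd_window k (a div 2)" if "k > a" for k
  proof
    assume "k \<in> odd_window k (a div 2)"
    then obtain i where "k = k - 2 * Suc i" unfolding odd_window_def by blast
    moreover have "k - 2 * Suc i < k" using that by simp
    ultimately show False by simp
  qed
  have w: "is_shift_sum a 0 (\<lambda>k n. window_count (odd_window k (a div 2)) l n)" for l
    by (rule is_shift_sum_window_count) simp
  have wi: "is_shift_sum a 0 (\<lambda>k n. window_count (insert k (odd_window k (a div 2))) l n)" for l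
    using is_shift_sum_window_count_insert[where S = "\<lambda>k. odd_window k (a div 2)" and e = 0 and K = a and l = l] w notin
    by simp
  have "is_shift_sum a 0 (\<lambda>k n. if l = 0 then 0 else window_count (insert k (odd_window k (a div 2))) (l - 1) n)"
    using wi is_shift_sum_zero by (cases "l = 0") simp_all
  from is_shift_sum_shift[OF is_shift_sum_diff[OF w this], of l 0]
  have "is_shift_sum a 1 (\<lambda>k n. window_count (odd_window k (a div 2)) l (n - int k) -
      (if l = 0 then 0 else window_count (insert k (odd_window k (a div 2))) (l - 1) (n - int k)))"
    by (simp only: add_0_right One_nat_def)
  then show ?thesis
    by (rule is_shift_sum_cong[rotated]) (simp add: slot_count_eq notin)
qed

section \<open>Euler's theorem on partitions into odd parts\<close>

definition odd_msets_within :: "nat set \<Rightarrow> nat \<Rightarrow> nat multiset set" where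
  "odd_msets_within A n = {M \<in> odd_msets (int n). set_mset M \<subseteq> A}"

lemma card_odd_msets_within_insert:
  assumes "odd s" "s \<notin> A"
  shows "card (odd_msets_within (insert s A) n) = card (odd_msets_within A n) +
    (if s \<le> n then card (odd_msets_within (insert s A) (n - s)) else 0)"
proof -
  let ?I = "odd_msets_within (insert s A) n"
  have "finite ?I" by (simp add: odd_msets_within_def finite_odd_msets)
  then have "card ?I = card {M \<in> ?I. s \<notin># M} + card {M \<in> ?I. s \<in># M}"
    using card_filter_split[of ?I "\<lambda>M. True" "\<lambda>M. s \<in># M"] by simp
  moreover have "{M \<in> ?I. s \<notin># M} = odd_msets_within A n"
    using assms by (auto simp: odd_msets_within_def)
  moreover have "card {M \<in> ?I. s \<in># M} = (if s \<le> n then card (odd_msets_within (insert s A) (n - s)) else 0)"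
  proof -
    have *: "set_mset M \<subseteq> insert s A \<longleftrightarrow> set_mset (M - {#s#}) \<subseteq> insert s A" if "s \<in># M" for M
    proof -
      from that obtain B where "M = add_mset s B" by (auto dest: multi_member_split)
      then show ?thesis by auto
    qed
    have "{M \<in> ?I. s \<in># M} = {M \<in> odd_msets (int n). s \<in># M \<and> set_mset (M - {#s#}) \<subseteq> insert s A}"
      unfolding odd_msets_within_def using * by blast
    then have "card {M \<in> ?I. s \<in># M} = card {M \<in> odd_msets (int n - int s). set_mset M \<subseteq> insert s A}"
      using card_remove_part[OF assms(1), of n "\<lambda>M. set_mset M \<subseteq> insert s A"] by (simp only:)
    moreover have "odd_msets (int n - int s) = {}" if "\<not> s \<le> n"
    proof -
      have "card (odd_msets (int n - int s)) = 0"
        using odd_count_neg[of "int n - int s"] that by (simp add: odd_count_def)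
      then show ?thesis by (simp add: finite_odd_msets)
    qed
    ultimately show ?thesis by (auto simp: odd_msets_within_def of_nat_diff)
  qed
  ultimately show ?thesis by simp
qed

definition odd_mset_fps :: "nat set \<Rightarrow> int fps" where
  "odd_mset_fps A = Abs_fps (\<lambda>n. int (card (odd_msets_within A n)))"

text \<open>A multiset over \<open>insert s A\<close> either avoids \<open>s\<close> or can lose one
  copy of it; in generating functions this is the geometric factor belonging to
  \<open>s\<close>.\<close>

lemma odd_mset_fps_insert:
  assumes "odd s" "s \<notin> A"
  shows "odd_mset_fps (insert s A) * (1 - fps_X ^ s) = odd_mset_fps A"
proof (rule fps_ext)
  fix n
  show "(odd_mset_fps (insert s A) * (1 - fps_X ^ s)) $ n = odd_mset_fps A $ n"
    using card_odd_msets_within_insert[OF assms, of n]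
    by (auto simp: odd_mset_fps_def right_diff_distrib fps_X_power_mult_right_nth not_le)
qed

lemma odd_mset_fps_mult_prod:
  assumes "finite A" "\<forall>s\<in>A. odd s"
  shows "odd_mset_fps A * (\<Prod>s\<in>A. 1 - fps_X ^ s) = 1"
  using assms
proof (induction A rule: finite_induct)
  case empty
  have "odd_msets_within {} n = (if n = 0 then {{#}} else {})" for n
    by (auto simp: odd_msets_within_def odd_msets_def)
  then have "odd_mset_fps {} = 1" by (intro fps_ext) (simp add: odd_mset_fps_def)
  then show ?case by simp
next
  case (insert s A)
  have "odd_mset_fps (insert s A) * (\<Prod>s\<in>insert s A. 1 - fps_X ^ s) =
      (odd_mset_fps (insert s A) * (1 - fps_X ^ s)) * (\<Prod>s\<in>A. 1 - fps_X ^ s)"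
    using insert by (simp add: mult.assoc)
  then show ?case using insert odd_mset_fps_insert[of s A] by simp
qed

lemma fps_nth_mult_high_order:
  fixes f g :: "int fps"
  assumes "\<And>j. j \<le> n \<Longrightarrow> g $ j = (if j = 0 then 1 else 0)"
  shows "(f * g) $ n = f $ n"
proof -
  have "(f * g) $ n = (\<Sum>i=0..n. if i = n then f $ i else 0)"
    unfolding fps_mult_nth by (rule sum.cong) (auto simp: assms)
  then show ?thesis by simp
qed

lemma fps_nth_prod_high_order:
  assumes "finite A" "\<forall>s\<in>A. s > n" "j \<le> n"
  shows "(\<Prod>s\<in>A. 1 - fps_X ^ s :: int fps) $ j = (if j = 0 then 1 else 0)"
  using assms
proof (induction A rule: finite_induct)
  case (insert s A)
  then show ?case by (auto simp: left_diff_distrib fps_X_power_mult_nth)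
qed (auto simp: fps_one_nth)

text \<open>
  Euler's theorem, truncated: \<open>\<Prod>(1 + x^k) \<Prod>(1 - x^k) = \<Prod>(1 - x^(2k))\<close>, and the even
  factors with exponent at most \<open>n\<close> cancel.
\<close>

lemma odd_count_eq_fps_nth:
  "odd_count (int n) = (\<Prod>k\<in>{1..n}. 1 + fps_X ^ k :: int fps) $ n"
proof -
  let ?P = "\<Prod>k\<in>{1..n}. 1 + fps_X ^ k :: int fps"
  let ?m = "\<lambda>A. \<Prod>k\<in>A. 1 - fps_X ^ k :: int fps"
  let ?O = "{k \<in> {1..n}. odd k}" and ?E = "{k \<in> {1..n}. even k}" and ?H = "{k \<in> {n<..2*n}. even k}"
  have "?P * ?m {1..n} = (\<Prod>k\<in>{1..n}. 1 - fps_X ^ (2 * k))"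
  proof -
    have "(1 + fps_X ^ k) * (1 - fps_X ^ k) = (1 - fps_X ^ (2 * k) :: int fps)" for k
      unfolding mult_2 power_add by (simp add: algebra_simps)
    then show ?thesis unfolding prod.distrib[symmetric] by (intro prod.cong refl)
  qed
  also have "\<dots> = ?m ((\<lambda>k. 2 * k) ` {1..n})"
    by (subst prod.reindex) (auto simp: inj_on_def)
  also have "(\<lambda>k. 2 * k) ` {1..n} = ?E \<union> ?H"
    by (auto simp: image_iff elim!: evenE)
  also have "?m (?E \<union> ?H) = ?m ?E * ?m ?H"
    by (rule prod.union_disjoint) auto
  finally have 1: "?P * ?m {1..n} = ?m ?E * ?m ?H" .
  have "?m (?O \<union> ?E) = ?m ?O * ?m ?E"
    by (rule prod.union_disjoint) auto
  moreover have "?O \<union> ?E = {1..n}" by auto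
  ultimately have 2: "?m {1..n} = ?m ?O * ?m ?E" by (simp only:)
  \<comment> \<open>Constant term 1 makes the even product nonzero, so it can be cancelled in the
    integral domain of integer power series.\<close>
  have "?m ?E $ 0 = 1"
    by (subst fps_nth_prod_high_order[of _ 0]) auto
  then have "?m ?E \<noteq> 0" by (metis fps_zero_nth zero_neq_one)
  with 1 2 have PO: "?P * ?m ?O = ?m ?H" by (simp add: mult.assoc[symmetric])
  have F: "odd_mset_fps ?O * ?m ?O = 1" by (rule odd_mset_fps_mult_prod) auto
  have "?P = ?P * (odd_mset_fps ?O * ?m ?O)" by (simp only: F mult_1_right)
  also have "\<dots> = odd_mset_fps ?O * ?m ?H" unfolding PO[symmetric] by (simp only: mult.assoc mult.left_commute)
  \<comment> \<open>All exponents in \<open>?H\<close> exceed \<open>n\<close>, so up to order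
    \<open>n\<close> its product looks like 1.\<close>
  finally have "?P $ n = odd_mset_fps ?O $ n"
    by (simp only:) (rule fps_nth_mult_high_order, rule fps_nth_prod_high_order, auto)
  moreover have "odd_msets_within ?O n = odd_msets (int n)"
    using part_le_odd_msets[of _ "int n"] by (force simp: odd_msets_within_def odd_msets_def Suc_le_eq odd_pos)
  ultimately show ?thesis by (simp add: odd_count_def odd_mset_fps_def)
qed

text \<open>The polynomial form can be evaluated on a circle, as Fourier inversion requires.\<close>

lemma odd_count_eq_coeff: "odd_count (int n) = coeff (\<Prod>k\<in>{1..n}. 1 + monom 1 k) n"
proof -
  have "fps_of_poly (\<Prod>k\<in>{1..n}. 1 + monom 1 k :: int poly) = (\<Prod>k\<in>{1..n}. 1 + fps_X ^ k)"
    by (simp add: fps_of_poly_prod fps_of_poly_add fps_of_poly_monom)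
  then show ?thesis unfolding odd_count_eq_fps_nth by (metis fps_of_poly_nth)
qed

section \<open>Sums at the saddle point\<close>

text \<open>This is \<open>- Li_2 (- x)\<close>, the antiderivative of \<open>ln (1 + x) / x\<close>
  that vanishes at 0.\<close>

definition dilog_neg :: "real \<Rightarrow> real" where
  "dilog_neg x = (\<Sum>m. (- 1) ^ m / (real m + 1)\<^sup>2 * x ^ Suc m)"

lemma summable_inverse_squares: "summable (\<lambda>m. 1 / (real m + 1)\<^sup>2)"
  using inverse_squares_sums by (simp add: sums_iff add.commute)

lemma abs_dilog_neg_term_le:
  assumes "0 \<le> x" "x \<le> 1"
  shows "\<bar>(- 1) ^ m / (real m + 1)\<^sup>2 * x ^ Suc m\<bar> \<le> x * (1 / (real m + 1)\<^sup>2)"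
  using assms by (auto simp: abs_mult power_abs power_le_one intro!: divide_right_mono mult_left_le)

lemma abs_dilog_neg_le:
  assumes "0 \<le> x" "x \<le> 1"
  shows "\<bar>dilog_neg x\<bar> \<le> x * (pi\<^sup>2 / 6)"
proof -
  have s: "summable (\<lambda>m. x * (1 / (real m + 1)\<^sup>2))"
    by (intro summable_mult summable_inverse_squares)
  have "norm (dilog_neg x) \<le> (\<Sum>m. x * (1 / (real m + 1)\<^sup>2))"
    unfolding dilog_neg_def using abs_dilog_neg_term_le[OF assms]
    by (intro norm_suminf_le[OF _ s]) simp
  also have "\<dots> = x * (pi\<^sup>2 / 6)"
    using inverse_squares_sums by (subst suminf_mult[OF summable_inverse_squares]) (simp add: sums_iff add.commute)
  finally show ?thesis by simp
qed

lemma continuous_on_dilog_neg: "continuous_on {0..1} dilog_neg"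
proof -
  have "uniform_limit {0..1} (\<lambda>n x. \<Sum>m<n. (- 1) ^ m / (real m + 1)\<^sup>2 * x ^ Suc m) dilog_neg sequentially"
    unfolding dilog_neg_def
  proof (rule Weierstrass_m_test[OF _ summable_inverse_squares])
    fix m and x :: real assume "x \<in> {0..1}"
    then show "norm ((- 1) ^ m / (real m + 1)\<^sup>2 * x ^ Suc m) \<le> 1 / (real m + 1)\<^sup>2"
      using abs_dilog_neg_term_le[of x m] mult_right_mono[of x 1 "1 / (real m + 1)\<^sup>2"] by simp
  qed
  then show ?thesis
    by (rule uniform_limit_theorem[rotated]) (auto intro!: always_eventually continuous_intros)
qed

lemma DERIV_dilog_neg:
  assumes "0 < x" "x < 1"
  shows "(dilog_neg has_real_derivative ln (1 + x) / x) (at x)"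
proof -
  let ?f = "\<lambda>m. (- 1) ^ m / (real m + 1)\<^sup>2"
  have eq: "?f m * real (Suc m) * y ^ m = (- 1) ^ m / real (Suc m) * y ^ m" for m and y :: real
    by (simp add: power2_eq_square add.commute)
  have summ: "summable (\<lambda>m. ?f m * real (Suc m) * y ^ m)" if "y \<in> {-1<..<1}" for y :: real
  proof (rule summable_comparison_test')
    show "summable (\<lambda>m. \<bar>y\<bar> ^ m)" using that by (intro summable_geometric) auto
    show "norm (?f m * real (Suc m) * y ^ m) \<le> \<bar>y\<bar> ^ m" for m
      unfolding eq by (simp add: abs_mult power_abs field_simps)
  qed
  have "DERIV (\<lambda>x. \<Sum>m. ?f m * x ^ Suc m) x :> (\<Sum>m. ?f m * real (Suc m) * x ^ m)"
    by (rule DERIV_power_series'[where R = 1, OF summ]) (use assms in auto)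
  moreover have "(\<Sum>m. ?f m * real (Suc m) * x ^ m) = ln (1 + x) / x"
  proof -
    have "ln (1 + x) = (\<Sum>m. (- 1) ^ m * (1 / real (m + 1)) * x ^ Suc m)"
      using ln_series[of "1 + x"] assms by simp
    also have "\<dots> = (\<Sum>m. x * (?f m * real (Suc m) * x ^ m))"
      unfolding eq by (simp add: mult_ac)
    also have "\<dots> = x * (\<Sum>m. ?f m * real (Suc m) * x ^ m)"
      using assms by (intro suminf_mult summ) auto
    finally show ?thesis using assms by simp
  qed
  ultimately show ?thesis unfolding dilog_neg_def by simp
qed

text \<open>The alternating sum of inverse squares is \<open>zeta(2)\<close> minus twice the sum
  over even bases (odd \<open>m\<close>), and the latter is \<open>zeta(2) / 4\<close>.\<close>

lemma dilog_neg_1: "dilog_neg 1 = pi\<^sup>2 / 12"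
proof -
  let ?g = "\<lambda>m. 1 / (real m + 1)\<^sup>2"
  have "(\<lambda>m. ?g (2 * m + 1)) = (\<lambda>m. ?g m / 4)"
    by (simp add: field_simps power2_eq_square)
  then have odd: "(\<lambda>m. ?g (2 * m + 1)) sums (pi\<^sup>2 / 6 / 4)"
    using sums_divide[OF inverse_squares_sums, of 4] by (simp add: add.commute)
  have "(\<lambda>m. if odd m then 2 * ?g m else 0) sums (2 * (pi\<^sup>2 / 6 / 4))"
  proof -
    have "(\<lambda>m. if odd m then ?g m else 0) sums (pi\<^sup>2 / 6 / 4)"
    proof (subst sums_mono_reindex[of "\<lambda>m. 2 * m + 1", symmetric])
      show "strict_mono (\<lambda>m::nat. 2 * m + 1)" by (auto simp: strict_mono_def)
      show "(if odd n then ?g n else 0) = 0" if "n \<notin> range (\<lambda>m::nat. 2 * m + 1)" for n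
      proof -
        have "\<not> odd n"
        proof
          assume "odd n"
          then obtain k where "n = 2 * k + 1" by (rule oddE)
          with that show False by blast
        qed
        then show ?thesis by simp
      qed
    qed (use odd in simp)
    from sums_mult[OF this, of 2] show ?thesis by (simp add: if_distrib cong: if_cong)
  qed
  from sums_diff[OF inverse_squares_sums this]
  have "(\<lambda>m. ?g m - (if odd m then 2 * ?g m else 0)) sums (pi\<^sup>2 / 12)" by (simp add: add.commute)
  moreover have "(\<lambda>m. ?g m - (if odd m then 2 * ?g m else 0)) = (\<lambda>m. (- 1) ^ m / (real m + 1)\<^sup>2 * 1 ^ Suc m)"
    by auto
  ultimately show ?thesis unfolding dilog_neg_def by (simp add: sums_iff)
qed

text \<open>In closed form, the integral of \<open>ln (1 + exp (- v))\<close> over \<open>v\<close>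
  from \<open>u\<close> to infinity.\<close>

definition log_tail :: "real \<Rightarrow> real" where
  "log_tail u = dilog_neg (exp (- u))"

lemma log_tail_0: "log_tail 0 = pi\<^sup>2 / 12"
  by (simp add: log_tail_def dilog_neg_1)

lemma abs_log_tail_le: "u \<ge> 0 \<Longrightarrow> \<bar>log_tail u\<bar> \<le> exp (- u) * (pi\<^sup>2 / 6)"
  unfolding log_tail_def by (intro abs_dilog_neg_le) auto

lemma continuous_on_log_tail: "continuous_on {0..} log_tail"
proof -
  have "continuous_on {0..} (dilog_neg \<circ> (\<lambda>u. exp (- u)))"
    by (intro continuous_on_compose continuous_intros continuous_on_subset[OF continuous_on_dilog_neg]) auto
  then show ?thesis by (simp add: log_tail_def[abs_def] comp_def)
qed

lemma DERIV_log_tail: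
  assumes "u > 0"
  shows "(log_tail has_real_derivative - ln (1 + exp (- u))) (at u)"
proof -
  have "((\<lambda>u. dilog_neg (exp (- u))) has_real_derivative ln (1 + exp (- u)) / exp (- u) * (- exp (- u))) (at u)"
    by (rule DERIV_chain2[of dilog_neg]) (use assms in \<open>auto intro!: DERIV_dilog_neg derivative_eq_intros\<close>)
  then show ?thesis by (simp add: log_tail_def[abs_def])
qed

section \<open>Comparing sums with integrals\<close>

lemma trapezoid_convex:
  fixes F f g :: "real \<Rightarrow> real"
  assumes ab: "a < b" and contF: "continuous_on {a..b} F"
    and dF: "\<And>x. a < x \<Longrightarrow> x < b \<Longrightarrow> (F has_real_derivative f x) (at x)"
    and df: "\<And>x. a \<le> x \<Longrightarrow> x \<le> b \<Longrightarrow> (f has_real_derivative g x) (at x)"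
    and mono: "\<And>x y. a \<le> x \<Longrightarrow> x \<le> y \<Longrightarrow> y \<le> b \<Longrightarrow> g x \<le> g y"
  shows "\<bar>(b - a) * (f a + f b) / 2 - (F b - F a)\<bar> \<le> (b - a)\<^sup>2 * (g b - g a)"
proof -
  \<comment> \<open>\<open>?P\<close> is the trapezoid error on \<open>[a, x]\<close> and
    \<open>?Q\<close> its derivative. The mean value theorem for \<open>f\<close> turns
    \<open>?Q z\<close> into \<open>(z - a) / 2\<close> times a difference of values of
    \<open>g\<close>. Monotonicity bounds that by an increment of \<open>g\<close>, which telescopes
    over adjacent intervals.\<close>
  let ?P = "\<lambda>x. (x - a) * (f a + f x) / 2 - (F x - F a)"
  let ?Q = "\<lambda>x. ((x - a) * g x + f a + f x) / 2 - f x"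
  have contf: "continuous_on {a..b} f"
    using df by (intro DERIV_continuous_on) (auto intro: has_field_derivative_at_within)
  have contP: "continuous_on {a..b} ?P" by (intro continuous_intros contF contf) simp
  have dP: "(?P has_real_derivative ?Q x) (at x)" if "a < x" "x < b" for x
    using that by (auto intro!: derivative_eq_intros dF df simp: field_simps)
  have "?P differentiable at x" if "a < x" "x < b" for x
    using dP[OF that] real_differentiable_def by blast
  from MVT[OF ab contP this] obtain l z
    where lz: "a < z" "z < b" "DERIV ?P z :> l" "?P b - ?P a = (b - a) * l" by blast
  from DERIV_unique[OF lz(3) dP[OF lz(1,2)]] have z: "a < z" "z < b" "?P b - ?P a = (b - a) * ?Q z"
    using lz by (simp_all only:)
  obtain w where w: "a < w" "w < z" "f z - f a = (z - a) * g w"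
    using MVT2[of a z f g] z df by auto
  have Q: "?Q z = (z - a) * (g z - g w) / 2"
    using w(3) by (simp add: field_simps)
  have g: "0 \<le> g z - g w" "g z - g w \<le> g b - g a"
    using mono[of w z] mono[of z b] mono[of a w] z w by auto
  have "(z - a) * (g z - g w) \<le> (b - a) * (g b - g a)"
    using z g by (intro mult_mono) auto
  moreover have "0 \<le> (z - a) * (g z - g w)" using z g by simp
  ultimately have "\<bar>?Q z\<bar> \<le> (b - a) * (g b - g a)" unfolding Q by linarith
  moreover have "\<bar>(b - a) * q\<bar> \<le> (b - a) * R" if "\<bar>q\<bar> \<le> R" for q R
    using that ab by (simp add: abs_mult)
  ultimately have "\<bar>(b - a) * ?Q z\<bar> \<le> (b - a) * ((b - a) * (g b - g a))" by blast
  then have "\<bar>?P b - ?P a\<bar> \<le> (b - a) * ((b - a) * (g b - g a))" unfolding z(3) .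
  then show ?thesis by (simp add: power2_eq_square mult.assoc)
qed

text \<open>\<open>H\<close> majorises the variation of \<open>f\<close>; expressing the error
  through increments of \<open>H\<close> makes the bounds of adjacent steps telescope.\<close>

lemma riemann_step:
  fixes F f H :: "real \<Rightarrow> real"
  assumes ab: "a < b" and contF: "continuous_on {a..b} F"
    and dF: "\<And>x. a < x \<Longrightarrow> x < b \<Longrightarrow> (F has_real_derivative f x) (at x)"
    and var: "\<And>x y. a \<le> x \<Longrightarrow> x \<le> y \<Longrightarrow> y \<le> b \<Longrightarrow> \<bar>f y - f x\<bar> \<le> H y - H x"
  shows "\<bar>(b - a) * f b - (F b - F a)\<bar> \<le> (b - a) * (H b - H a)"
proof -
  obtain z where z: "a < z" "z < b" "F b - F a = (b - a) * f z"
    using MVT[OF ab contF] dF by (metis DERIV_unique real_differentiable_def)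
  have "\<bar>f b - f z\<bar> \<le> H b - H a"
    using var[of z b] var[of a z] z abs_ge_zero[of "f z - f a"] by linarith
  then have "(b - a) * \<bar>f b - f z\<bar> \<le> (b - a) * (H b - H a)"
    using ab by (intro mult_left_mono) auto
  moreover have "(b - a) * f b - (F b - F a) = (b - a) * (f b - f z)"
    using z(3) by (simp add: algebra_simps)
  ultimately show ?thesis using ab by (simp add: abs_mult)
qed

lemma riemann_sum:
  fixes F f H :: "real \<Rightarrow> real"
  assumes t: "t > 0" and contF: "continuous_on {0..} F"
    and dF: "\<And>x. x > 0 \<Longrightarrow> (F has_real_derivative f x) (at x)"
    and var: "\<And>x y. 0 \<le> x \<Longrightarrow> x \<le> y \<Longrightarrow> \<bar>f y - f x\<bar> \<le> H y - H x"
  shows "\<bar>t * (\<Sum>k=1..N. f (real k * t)) - (F (real N * t) - F 0)\<bar> \<le> t * (H (real N * t) - H 0)"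
proof (induction N)
  case (Suc N)
  have "\<bar>(real (Suc N) * t - real N * t) * f (real (Suc N) * t) - (F (real (Suc N) * t) - F (real N * t))\<bar>
      \<le> (real (Suc N) * t - real N * t) * (H (real (Suc N) * t) - H (real N * t))"
  proof (rule riemann_step)
    have N: "real N * t \<ge> 0" using t by simp
    show "continuous_on {real N * t..real (Suc N) * t} F"
      by (rule continuous_on_subset[OF contF]) (use N in auto)
    show "(F has_real_derivative f x) (at x)" if "real N * t < x" for x using that N by (intro dF) linarith
    show "\<bar>f y - f x\<bar> \<le> H y - H x" if "real N * t \<le> x" "x \<le> y" for x y
      using that N by (intro var) linarith+
  qed (use t in simp)
  moreover have "real (Suc N) * t - real N * t = t" by (simp add: algebra_simps)
  ultimately have "\<bar>t * f (real (Suc N) * t) - (F (real (Suc N) * t) - F (real N * t))\<bar>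
      \<le> t * H (real (Suc N) * t) - t * H (real N * t)"
    by (simp only: right_diff_distrib)
  then show ?case using Suc.IH by (simp add: distrib_left right_diff_distrib)
qed simp

text \<open>The term \<open>t * (f 0 - f (real N * t)) / 2\<close> converts the right-endpoint sum
  into the trapezoid sum. At the saddle point it is the origin of the correction
  \<open>ln 2 / 2\<close>.\<close>

lemma trapezoid_sum:
  fixes F f g :: "real \<Rightarrow> real"
  assumes t: "t > 0" and contF: "continuous_on {0..} F"
    and dF: "\<And>x. x > 0 \<Longrightarrow> (F has_real_derivative f x) (at x)"
    and df: "\<And>x. (f has_real_derivative g x) (at x)"
    and mono: "\<And>x y. x \<le> y \<Longrightarrow> g x \<le> g y"
  shows "\<bar>t * (\<Sum>k=1..N. f (real k * t)) + t * (f 0 - f (real N * t)) / 2 - (F (real N * t) - F 0)\<bar>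
    \<le> t\<^sup>2 * (g (real N * t) - g 0)"
proof (induction N)
  case (Suc N)
  have d: "real (Suc N) * t - real N * t = t" by (simp add: algebra_simps)
  have "\<bar>(real (Suc N) * t - real N * t) * (f (real N * t) + f (real (Suc N) * t)) / 2 -
        (F (real (Suc N) * t) - F (real N * t))\<bar>
      \<le> (real (Suc N) * t - real N * t)\<^sup>2 * (g (real (Suc N) * t) - g (real N * t))"
  proof (rule trapezoid_convex)
    have N: "real N * t \<ge> 0" using t by simp
    show "continuous_on {real N * t..real (Suc N) * t} F"
      by (rule continuous_on_subset[OF contF]) (use N in auto)
    show "(F has_real_derivative f x) (at x)" if "real N * t < x" for x using that N by (intro dF) linarith
  qed (use t df mono in simp_all)
  then have "\<bar>t * (f (real N * t) + f (real (Suc N) * t)) / 2 - (F (real (Suc N) * t) - F (real N * t))\<bar>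
      \<le> t\<^sup>2 * g (real (Suc N) * t) - t\<^sup>2 * g (real N * t)"
    unfolding d by (simp only: right_diff_distrib)
  then show ?case using Suc.IH by (simp add: distrib_left right_diff_distrib add_divide_distrib diff_divide_distrib)
qed simp

text \<open>The Fermi-Dirac weight \<open>1 / (exp u + 1)\<close>: with \<open>u = k t\<close> it is
  the probability that the part \<open>k\<close> is present after tilting by
  \<open>exp (- t)\<close>.\<close>

definition fermi :: "real \<Rightarrow> real" where
  "fermi u = exp (- u) / (1 + exp (- u))"

lemma one_plus_exp_pos [simp]: "1 + exp x > (0::real)" "1 + exp x \<noteq> (0::real)"
  using exp_gt_zero[of x] by linarith+

lemma fermi_pos: "fermi u > 0" and fermi_less_1: "fermi u < 1"
  by (simp_all add: fermi_def field_simps)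

lemma fermi_le_exp: "fermi u \<le> exp (- u)"
  by (simp add: fermi_def field_simps)

lemma DERIV_fermi [derivative_intros]:
  assumes "(f has_real_derivative d) (at x within S)"
  shows "((\<lambda>x. fermi (f x)) has_real_derivative - (fermi (f x) * (1 - fermi (f x))) * d) (at x within S)"
proof -
  have "(fermi has_real_derivative - (fermi u * (1 - fermi u))) (at u)" for u
    unfolding fermi_def[abs_def]
    by (auto intro!: derivative_eq_intros simp: divide_simps power2_eq_square) (simp add: algebra_simps)
  from DERIV_chain2[OF this assms] show ?thesis by simp
qed

lemma fermi_antimono: "x \<le> y \<Longrightarrow> fermi y \<le> fermi x"
  by (simp add: fermi_def divide_simps distrib_left mult.commute)

lemma exp_div4_le_fermi:
  assumes "u \<ge> 0"
  shows "exp (- u) / 4 \<le> fermi u * (1 - fermi u)"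
proof -
  have "(1 + exp (- u))\<^sup>2 \<le> 2\<^sup>2" using assms by (intro power_mono) auto
  then have "exp (- u) / 4 \<le> exp (- u) / (1 + exp (- u))\<^sup>2"
    by (intro divide_left_mono) auto
  also have "\<dots> = fermi u * (1 - fermi u)"
    by (simp add: fermi_def field_simps power2_eq_square)
  finally show ?thesis .
qed

lemma DERIV_ln_one_plus_exp:
  "((\<lambda>u. ln (1 + exp (- u))) has_real_derivative - fermi u) (at u)"
  by (auto intro!: derivative_eq_intros simp: fermi_def)

lemma ln_one_plus_exp_le: "0 \<le> ln (1 + exp (- u)) \<and> ln (1 + exp (- u)) \<le> exp (- u :: real)"
  by (auto intro: ln_add_one_self_le_self)

text \<open>The derivative bound makes both \<open>H - f\<close> and \<open>H + f\<close>
  nondecreasing.\<close>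

lemma lipschitz_by_derivative:
  fixes f f' H h :: "real \<Rightarrow> real"
  assumes "\<And>x. x \<ge> 0 \<Longrightarrow> (f has_real_derivative f' x) (at x)"
    and "\<And>x. x \<ge> 0 \<Longrightarrow> (H has_real_derivative h x) (at x)"
    and "\<And>x. x \<ge> 0 \<Longrightarrow> \<bar>f' x\<bar> \<le> h x" and "0 \<le> x" "x \<le> y"
  shows "\<bar>f y - f x\<bar> \<le> H y - H x"
proof -
  have "(\<lambda>x. H x - f x) x \<le> (\<lambda>x. H x - f x) y"
  proof (rule DERIV_nonneg_imp_nondecreasing[OF assms(5)])
    fix z assume "x \<le> z"
    then have "((\<lambda>x. H x - f x) has_real_derivative h z - f' z) (at z)" "h z - f' z \<ge> 0"
      using assms(1)[of z] assms(2)[of z] assms(3)[of z] assms(4) by (auto intro!: derivative_intros)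
    then show "\<exists>d. ((\<lambda>x. H x - f x) has_real_derivative d) (at z) \<and> 0 \<le> d" by blast
  qed
  moreover have "(\<lambda>x. H x + f x) x \<le> (\<lambda>x. H x + f x) y"
  proof (rule DERIV_nonneg_imp_nondecreasing[OF assms(5)])
    fix z assume "x \<le> z"
    then have "((\<lambda>x. H x + f x) has_real_derivative h z + f' z) (at z)" "h z + f' z \<ge> 0"
      using assms(1)[of z] assms(2)[of z] assms(3)[of z] assms(4) by (auto intro!: derivative_intros)
    then show "\<exists>d. ((\<lambda>x. H x + f x) has_real_derivative d) (at z) \<and> 0 \<le> d" by blast
  qed
  ultimately show ?thesis by linarith
qed

text \<open>Half of the exponential absorbs the polynomial. The right sides are the derivatives of
  \<open>- 4 * exp (- u / 2)\<close> and \<open>- 16 * exp (- u / 2)\<close>, the majorants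
  \<open>?H\<close> used for the mean and the variance.\<close>

lemma poly_exp_bounds:
  assumes "u \<ge> (0::real)"
  shows "(1 + u) * exp (- u) \<le> 2 * exp (- u / 2)" "(2 * u + u\<^sup>2) * exp (- u) \<le> 8 * exp (- u / 2)"
proof -
  have e: "exp (- u) = exp (- u / 2) * exp (- u / 2)" by (simp flip: exp_add)
  have l: "1 + u / 2 + u\<^sup>2 / 8 \<le> exp (u / 2)"
    using exp_lower_Taylor_quadratic[of "u / 2"] assms by (simp add: power_divide)
  have "q * exp (- u) \<le> c * exp (- u / 2)" if "q \<le> c * exp (u / 2)" for q c
  proof -
    have "q * exp (- u / 2) \<le> c * exp (u / 2) * exp (- u / 2)" using that by (intro mult_right_mono) auto
    also have "\<dots> = c" by (simp add: mult.assoc flip: exp_add)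
    finally have "q * exp (- u / 2) * exp (- u / 2) \<le> c * exp (- u / 2)" by (intro mult_right_mono) auto
    then show ?thesis by (simp only: e mult.assoc)
  qed
  moreover have "1 + u \<le> 2 * exp (u / 2)" "2 * u + u\<^sup>2 \<le> 8 * exp (u / 2)"
    using l assms zero_le_power2[of u] by linarith+
  ultimately show "(1 + u) * exp (- u) \<le> 2 * exp (- u / 2)" "(2 * u + u\<^sup>2) * exp (- u) \<le> 8 * exp (- u / 2)"
    by blast+
qed

text \<open>This sum is exponentiated, so its error must tend to 0 after division by
  \<open>t\<close>. The plain Riemann bound would lose a constant; the trapezoid rule is needed here
  and only here.\<close>

lemma sum_ln_bound:
  assumes "t > 0"
  shows "\<bar>(\<Sum>k=1..N. ln (1 + exp (- (real k * t)))) - (pi\<^sup>2 / (12 * t) - ln 2 / 2)\<bar>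
    \<le> t + exp (- (real N * t)) * (1 + (pi\<^sup>2 / 6) / t)"
proof -
  let ?f = "\<lambda>u::real. ln (1 + exp (- u))" and ?u = "real N * t"
  have "\<bar>t * (\<Sum>k=1..N. ?f (real k * t)) + t * (?f 0 - ?f ?u) / 2 - (- log_tail ?u - - log_tail 0)\<bar>
      \<le> t\<^sup>2 * (- fermi ?u - - fermi 0)"
    using fermi_antimono
    by (intro trapezoid_sum assms) (auto intro!: continuous_intros continuous_on_log_tail derivative_eq_intros DERIV_log_tail DERIV_ln_one_plus_exp)
  also have "\<dots> \<le> t\<^sup>2 * 1" using fermi_pos[of ?u] fermi_less_1[of 0] by (intro mult_left_mono) auto
  finally have 1: "\<bar>t * (\<Sum>k=1..N. ?f (real k * t)) + t * (ln 2 - ?f ?u) / 2 + log_tail ?u - pi\<^sup>2 / 12\<bar> \<le> t * t"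
    by (simp add: log_tail_0 power2_eq_square algebra_simps)
  have "t * \<bar>(\<Sum>k=1..N. ?f (real k * t)) - (pi\<^sup>2 / (12 * t) - ln 2 / 2)\<bar> =
      \<bar>t * ((\<Sum>k=1..N. ?f (real k * t)) - (pi\<^sup>2 / (12 * t) - ln 2 / 2))\<bar>"
    using assms by (simp add: abs_mult)
  also have "\<dots> = \<bar>(t * (\<Sum>k=1..N. ?f (real k * t)) + t * (ln 2 - ?f ?u) / 2 + log_tail ?u - pi\<^sup>2 / 12)
      + (t * ?f ?u / 2 - log_tail ?u)\<bar>"
    using assms by (intro arg_cong[where f = abs]) (simp add: field_simps)
  also have "\<dots> \<le> t * t + (t * exp (- ?u) + exp (- ?u) * (pi\<^sup>2 / 6))"
  proof -
    have "t * ?f ?u \<ge> 0" "t * ?f ?u \<le> t * exp (- ?u)" using ln_one_plus_exp_le[of ?u] assms by auto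
    moreover have "\<bar>log_tail ?u\<bar> \<le> exp (- ?u) * (pi\<^sup>2 / 6)" using assms by (intro abs_log_tail_le) simp
    ultimately show ?thesis using 1 by linarith
  qed
  also have "\<dots> = t * (t + exp (- ?u) * (1 + (pi\<^sup>2 / 6) / t))" using assms by (simp add: field_simps)
  finally show ?thesis using assms by simp
qed

text \<open>An error of order \<open>t\<close> suffices, since the mean is only needed up to
  \<open>o(t^(-3/2))\<close>. Integration by parts gives the antiderivative \<open>?F\<close> of
  \<open>u * fermi u\<close>.\<close>

lemma sum_mean_bound:
  assumes "t > 0"
  shows "\<bar>t\<^sup>2 * (\<Sum>k=1..N. real k * fermi (real k * t)) - pi\<^sup>2 / 12\<bar>
    \<le> 4 * t + exp (- (real N * t)) * (real N * t + pi\<^sup>2 / 6)"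
proof -
  let ?f = "\<lambda>u. u * fermi u" and ?F = "\<lambda>u. - (u * ln (1 + exp (- u))) - log_tail u" and ?u = "real N * t"
  let ?H = "\<lambda>u::real. - 4 * exp (- u / 2)"
  have "\<bar>t * (\<Sum>k=1..N. ?f (real k * t)) - (?F ?u - ?F 0)\<bar> \<le> t * (?H ?u - ?H 0)"
  proof (rule riemann_sum[OF assms])
    show "continuous_on {0..} ?F" by (intro continuous_intros continuous_on_log_tail) auto
    show "(?F has_real_derivative ?f x) (at x)" if "x > 0" for x
      using that by (auto intro!: derivative_eq_intros DERIV_log_tail simp: fermi_def)
    show "\<bar>?f y - ?f x\<bar> \<le> ?H y - ?H x" if "0 \<le> x" "x \<le> y" for x y
    proof (rule lipschitz_by_derivative[OF _ _ _ that])
      fix x :: real assume x: "x \<ge> 0"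
      show "(?f has_real_derivative fermi x - x * (fermi x * (1 - fermi x))) (at x)"
        by (auto intro!: derivative_eq_intros)
      show "(?H has_real_derivative 2 * exp (- x / 2)) (at x)" by (auto intro!: derivative_eq_intros)
      have "fermi x * (1 - fermi x) \<le> exp (- x)"
        using fermi_pos[of x] fermi_less_1[of x] fermi_le_exp[of x] mult_left_le[of "1 - fermi x" "fermi x"] by linarith
      then have "x * (fermi x * (1 - fermi x)) \<le> x * exp (- x)" using x by (intro mult_left_mono) auto
      moreover have "x * (fermi x * (1 - fermi x)) \<ge> 0"
        using x fermi_pos[of x] fermi_less_1[of x] by (intro mult_nonneg_nonneg) auto
      ultimately have "\<bar>fermi x - x * (fermi x * (1 - fermi x))\<bar> \<le> (1 + x) * exp (- x)"
        using fermi_pos[of x] fermi_le_exp[of x] by (simp add: distrib_right)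
      then show "\<bar>fermi x - x * (fermi x * (1 - fermi x))\<bar> \<le> 2 * exp (- x / 2)"
        using poly_exp_bounds(1)[OF x] by linarith
    qed
  qed
  also have "\<dots> \<le> t * 4" using assms by (intro mult_left_mono) auto
  finally have 1: "\<bar>t * (\<Sum>k=1..N. ?f (real k * t)) - (?F ?u + pi\<^sup>2 / 12)\<bar> \<le> 4 * t"
    by (simp add: log_tail_0 mult.commute)
  have 2: "t * (\<Sum>k=1..N. ?f (real k * t)) = t\<^sup>2 * (\<Sum>k=1..N. real k * fermi (real k * t))"
    by (simp add: sum_distrib_left power2_eq_square mult_ac)
  have "?u \<ge> 0" using assms by simp
  then have "\<bar>log_tail ?u\<bar> \<le> exp (- ?u) * (pi\<^sup>2 / 6)" by (rule abs_log_tail_le)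
  moreover have "0 \<le> ?u * ln (1 + exp (- ?u)) \<and> ?u * ln (1 + exp (- ?u)) \<le> ?u * exp (- ?u)"
    using ln_one_plus_exp_le[of ?u] \<open>?u \<ge> 0\<close> by (auto intro!: mult_left_mono mult_nonneg_nonneg)
  moreover have "exp (- ?u) * (?u + pi\<^sup>2 / 6) = ?u * exp (- ?u) + exp (- ?u) * (pi\<^sup>2 / 6)"
    by (simp add: algebra_simps)
  ultimately show ?thesis using 1 unfolding 2 by linarith
qed

text \<open>As \<open>u^2 * fermi u * (1 - fermi u)\<close> is \<open>- u^2\<close> times the
  derivative of \<open>fermi\<close>, integration by parts reduces its integral to twice that of
  \<open>u * fermi u\<close>, whence \<open>pi^2 / 6\<close>.\<close>

lemma sum_variance_bound:
  assumes "t > 0"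
  shows "\<bar>t ^ 3 * (\<Sum>k=1..N. (real k)\<^sup>2 * (fermi (real k * t) * (1 - fermi (real k * t)))) - pi\<^sup>2 / 6\<bar>
    \<le> 16 * t + exp (- (real N * t)) * ((real N * t)\<^sup>2 + 2 * (real N * t) + 2 * (pi\<^sup>2 / 6))"
proof -
  let ?v = "\<lambda>u. fermi u * (1 - fermi u)"
  let ?f = "\<lambda>u. u\<^sup>2 * ?v u" and ?u = "real N * t"
  let ?F = "\<lambda>u. - (u\<^sup>2 * fermi u) + 2 * (- (u * ln (1 + exp (- u))) - log_tail u)"
  let ?H = "\<lambda>u::real. - 16 * exp (- u / 2)"
  have contfermi: "continuous_on S fermi" for S
    by (rule DERIV_continuous_on[of _ _ "\<lambda>u. - (fermi u * (1 - fermi u))"]) (auto intro!: derivative_eq_intros)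
  have "\<bar>t * (\<Sum>k=1..N. ?f (real k * t)) - (?F ?u - ?F 0)\<bar> \<le> t * (?H ?u - ?H 0)"
  proof (rule riemann_sum[OF assms])
    show "continuous_on {0..} ?F" by (intro continuous_intros continuous_on_log_tail contfermi) auto
    show "(?F has_real_derivative ?f x) (at x)" if "x > 0" for x
      using that by (auto intro!: derivative_eq_intros DERIV_log_tail simp: algebra_simps) (simp add: fermi_def)
    show "\<bar>?f y - ?f x\<bar> \<le> ?H y - ?H x" if "0 \<le> x" "x \<le> y" for x y
    proof (rule lipschitz_by_derivative[OF _ _ _ that])
      fix x :: real assume x: "x \<ge> 0"
      let ?p = "fermi x"
      show "(?f has_real_derivative 2 * x * ?v x - x\<^sup>2 * (?v x * (1 - 2 * ?p))) (at x)"
        by (auto intro!: derivative_eq_intros simp: algebra_simps power2_eq_square)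
      show "(?H has_real_derivative 8 * exp (- x / 2)) (at x)" by (auto intro!: derivative_eq_intros)
      have p: "0 \<le> ?p" "?p \<le> 1" using fermi_pos[of x] fermi_less_1[of x] by auto
      have v: "0 \<le> ?v x" using p by simp
      have v': "?v x \<le> exp (- x)"
        using p fermi_le_exp[of x] mult_left_le[of "1 - ?p" ?p] by linarith
      have "\<bar>?v x * (1 - 2 * ?p)\<bar> \<le> exp (- x) * 1"
        unfolding abs_mult using p v v' by (intro mult_mono) auto
      then have "\<bar>x\<^sup>2 * (?v x * (1 - 2 * ?p))\<bar> \<le> x\<^sup>2 * exp (- x)"
        by (simp add: abs_mult[of "x\<^sup>2"] mult_left_mono)
      moreover have "\<bar>2 * x * ?v x\<bar> \<le> 2 * x * exp (- x)" using x v v' by (simp add: abs_mult mult_left_mono)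
      ultimately have "\<bar>2 * x * ?v x - x\<^sup>2 * (?v x * (1 - 2 * ?p))\<bar> \<le> 2 * x * exp (- x) + x\<^sup>2 * exp (- x)"
        by linarith
      then show "\<bar>2 * x * ?v x - x\<^sup>2 * (?v x * (1 - 2 * ?p))\<bar> \<le> 8 * exp (- x / 2)"
        using poly_exp_bounds(2)[OF x] by (simp add: distrib_right)
    qed
  qed
  also have "\<dots> \<le> t * 16" using assms by (intro mult_left_mono) auto
  finally have 1: "\<bar>t * (\<Sum>k=1..N. ?f (real k * t)) - (?F ?u + pi\<^sup>2 / 6)\<bar> \<le> 16 * t"
    by (simp add: log_tail_0 mult.commute)
  have 2: "t * (\<Sum>k=1..N. ?f (real k * t)) = t ^ 3 * (\<Sum>k=1..N. (real k)\<^sup>2 * ?v (real k * t))"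
    by (simp add: sum_distrib_left power2_eq_square power3_eq_cube mult_ac)
  have "?u \<ge> 0" using assms by simp
  then have "\<bar>log_tail ?u\<bar> \<le> exp (- ?u) * (pi\<^sup>2 / 6)" by (rule abs_log_tail_le)
  moreover have "0 \<le> ?u * ln (1 + exp (- ?u)) \<and> ?u * ln (1 + exp (- ?u)) \<le> ?u * exp (- ?u)"
    using ln_one_plus_exp_le[of ?u] \<open>?u \<ge> 0\<close> by (auto intro!: mult_left_mono mult_nonneg_nonneg)
  moreover have "0 \<le> ?u\<^sup>2 * fermi ?u \<and> ?u\<^sup>2 * fermi ?u \<le> ?u\<^sup>2 * exp (- ?u)"
    using fermi_le_exp[of ?u] fermi_pos[of ?u] by (auto intro!: mult_left_mono mult_nonneg_nonneg)
  moreover have "exp (- ?u) * (?u\<^sup>2 + 2 * ?u + 2 * (pi\<^sup>2 / 6)) =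
      ?u\<^sup>2 * exp (- ?u) + 2 * (?u * exp (- ?u)) + 2 * (exp (- ?u) * (pi\<^sup>2 / 6))"
    by (simp add: algebra_simps)
  moreover have "\<bar>X - P\<bar> \<le> E + Z"
    if "\<bar>l\<bar> \<le> C" "0 \<le> b \<and> b \<le> B" "0 \<le> a \<and> a \<le> A" "Z = A + 2 * B + 2 * C" "\<bar>X - (- a + 2 * (- b - l) + P)\<bar> \<le> E"
    for X P E Z a b l A B C :: real
    using that by (auto simp: abs_le_iff)
  ultimately show ?thesis using 1 unfolding 2 by blast
qed

text \<open>Solves \<open>t^2 * n = pi^2 / 12\<close>, so that the leading term of the mean of the
  tilted sum is \<open>n\<close>.\<close>

definition saddle :: "nat \<Rightarrow> real" where
  "saddle n = pi / (2 * sqrt 3) / sqrt (real n)"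

lemma saddle_pos: "n > 0 \<Longrightarrow> saddle n > 0"
  by (simp add: saddle_def)

lemma saddle_square: "n > 0 \<Longrightarrow> (saddle n)\<^sup>2 * real n = pi\<^sup>2 / 12"
  by (simp add: saddle_def power_divide power_mult_distrib)

text \<open>These are the error bounds of the three sums at \<open>N = n\<close>. Since
  \<open>n * saddle n\<close> is a multiple of \<open>sqrt n\<close>, the exponential beats every
  power of \<open>1 / saddle n\<close>.\<close>

lemma saddle_limits:
  "saddle \<longlonglongrightarrow> 0"
  "(\<lambda>n. sqrt (saddle n)) \<longlonglongrightarrow> 0"
  "(\<lambda>n. saddle n + exp (- (real n * saddle n)) * (1 + (pi\<^sup>2 / 6) / saddle n)) \<longlonglongrightarrow> 0"
  "(\<lambda>n. (4 * saddle n + exp (- (real n * saddle n)) * (real n * saddle n + pi\<^sup>2 / 6)) / sqrt (saddle n)) \<longlonglongrightarrow> 0"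
  "(\<lambda>n. 16 * saddle n + exp (- (real n * saddle n)) * ((real n * saddle n)\<^sup>2 + 2 * (real n * saddle n) + 2 * (pi\<^sup>2 / 6))) \<longlonglongrightarrow> 0"
  "(\<lambda>n. exp (- (real n * saddle n)) / saddle n) \<longlonglongrightarrow> 0"
proof -
  define c where "c = pi / (2 * sqrt 3)"
  have c: "c > 0" by (simp add: c_def)
  show "saddle \<longlonglongrightarrow> 0"
    "(\<lambda>n. sqrt (saddle n)) \<longlonglongrightarrow> 0"
    "(\<lambda>n. saddle n + exp (- (real n * saddle n)) * (1 + (pi\<^sup>2 / 6) / saddle n)) \<longlonglongrightarrow> 0"
    "(\<lambda>n. (4 * saddle n + exp (- (real n * saddle n)) * (real n * saddle n + pi\<^sup>2 / 6)) / sqrt (saddle n)) \<longlonglongrightarrow> 0"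
    "(\<lambda>n. 16 * saddle n + exp (- (real n * saddle n)) * ((real n * saddle n)\<^sup>2 + 2 * (real n * saddle n) + 2 * (pi\<^sup>2 / 6))) \<longlonglongrightarrow> 0"
    "(\<lambda>n. exp (- (real n * saddle n)) / saddle n) \<longlonglongrightarrow> 0"
    unfolding saddle_def[abs_def] c_def[symmetric] using c by real_asymp+
qed

lemma tendsto_sum_ln:
  "(\<lambda>n. (\<Sum>k=1..n. ln (1 + exp (- (real k * saddle n)))) - pi\<^sup>2 / (12 * saddle n)) \<longlonglongrightarrow> - (ln 2 / 2)"
proof -
  have "(\<lambda>n. (\<Sum>k=1..n. ln (1 + exp (- (real k * saddle n)))) - (pi\<^sup>2 / (12 * saddle n) - ln 2 / 2)) \<longlonglongrightarrow> 0"
  proof (rule Lim_null_comparison[OF _ saddle_limits(3)])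
    show "\<forall>\<^sub>F n in sequentially. norm ((\<Sum>k=1..n. ln (1 + exp (- (real k * saddle n)))) - (pi\<^sup>2 / (12 * saddle n) - ln 2 / 2))
      \<le> saddle n + exp (- (real n * saddle n)) * (1 + (pi\<^sup>2 / 6) / saddle n)"
      using eventually_gt_at_top[of 0] by eventually_elim (use sum_ln_bound saddle_pos in auto)
  qed
  from tendsto_diff[OF this tendsto_const[of "ln 2 / 2"]] show ?thesis by (simp add: algebra_simps)
qed

lemma tendsto_sum_mean:
  "(\<lambda>n. sqrt (saddle n) ^ 3 * ((\<Sum>k=1..n. real k * fermi (real k * saddle n)) - real n)) \<longlonglongrightarrow> 0"
proof (rule Lim_null_comparison[OF _ saddle_limits(4)])
  show "\<forall>\<^sub>F n in sequentially. norm (sqrt (saddle n) ^ 3 * ((\<Sum>k=1..n. real k * fermi (real k * saddle n)) - real n))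
      \<le> (4 * saddle n + exp (- (real n * saddle n)) * (real n * saddle n + pi\<^sup>2 / 6)) / sqrt (saddle n)"
    using eventually_gt_at_top[of 0]
  proof eventually_elim
    case (elim n)
    let ?t = "saddle n" and ?S = "\<Sum>k=1..n. real k * fermi (real k * saddle n)"
    have t: "?t > 0" using elim by (rule saddle_pos)
    have "sqrt ?t ^ 3 * sqrt ?t = ?t\<^sup>2"
      using t by (simp add: power3_eq_cube power2_eq_square)
    moreover have "\<bar>sqrt ?t ^ 3 * (?S - real n)\<bar> * sqrt ?t = \<bar>(sqrt ?t ^ 3 * sqrt ?t) * (?S - real n)\<bar>"
      using t by (simp add: abs_mult)
    ultimately have "\<bar>sqrt ?t ^ 3 * (?S - real n)\<bar> * sqrt ?t = \<bar>?t\<^sup>2 * (?S - real n)\<bar>"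
      by (simp only:)
    also have "?t\<^sup>2 * (?S - real n) = ?t\<^sup>2 * ?S - pi\<^sup>2 / 12"
      by (simp only: right_diff_distrib saddle_square[OF elim])
    also have "\<bar>\<dots>\<bar> \<le> 4 * ?t + exp (- (real n * ?t)) * (real n * ?t + pi\<^sup>2 / 6)"
      by (rule sum_mean_bound[OF t])
    finally have "\<bar>sqrt ?t ^ 3 * (?S - real n)\<bar> * sqrt ?t \<le> 4 * ?t + exp (- (real n * ?t)) * (real n * ?t + pi\<^sup>2 / 6)" .
    then show ?case using t by (simp add: pos_le_divide_eq)
  qed
qed

lemma tendsto_sum_variance:
  "(\<lambda>n. saddle n ^ 3 * (\<Sum>k=1..n. (real k)\<^sup>2 * (fermi (real k * saddle n) * (1 - fermi (real k * saddle n)))))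
    \<longlonglongrightarrow> pi\<^sup>2 / 6"
proof (rule LIM_zero_cancel, rule Lim_null_comparison[OF _ saddle_limits(5)])
  show "\<forall>\<^sub>F n in sequentially. norm (saddle n ^ 3 * (\<Sum>k=1..n. (real k)\<^sup>2 * (fermi (real k * saddle n) * (1 - fermi (real k * saddle n)))) - pi\<^sup>2 / 6)
    \<le> 16 * saddle n + exp (- (real n * saddle n)) * ((real n * saddle n)\<^sup>2 + 2 * (real n * saddle n) + 2 * (pi\<^sup>2 / 6))"
    using eventually_gt_at_top[of 0] by eventually_elim (use sum_variance_bound saddle_pos in auto)
qed

section \<open>The local limit theorem\<close>

lemma integral_iexp_int:
  "(\<integral>x. indicator {- pi..pi} x *\<^sub>R exp (\<i> * of_int m * complex_of_real x) \<partial>lborel) = (if m = 0 then 2 * pi else 0)"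
proof (cases "m = 0")
  case True
  then show ?thesis by (simp add: scaleR_conv_of_real)
next
  case False
  let ?F = "\<lambda>x. exp (\<i> * of_int m * complex_of_real x) / (\<i> * of_int m)"
  have "(\<integral>x. indicator {- pi..pi} x *\<^sub>R exp (\<i> * of_int m * complex_of_real x) \<partial>lborel) = ?F pi - ?F (- pi)"
  proof (rule integral_FTC_atLeastAtMost)
    fix x :: real
    have "((\<lambda>z. exp (\<i> * of_int m * z) / (\<i> * of_int m)) has_field_derivative exp (\<i> * of_int m * of_real x)) (at (of_real x))"
      using False by (auto intro!: derivative_eq_intros)
    from has_vector_derivative_real_field[OF this]
    show "(?F has_vector_derivative exp (\<i> * of_int m * complex_of_real x)) (at x within {- pi..pi})"
      by (simp add: o_def has_vector_derivative_at_within)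
  qed (auto intro!: continuous_intros)
  also have "exp (\<i> * of_int m * complex_of_real pi) = exp (\<i> * of_int m * complex_of_real (- pi))"
  proof -
    have "exp (\<i> * of_int m * complex_of_real pi) = exp (\<i> * of_int m * complex_of_real (- pi) + 2 * of_int m * of_real pi * \<i>)"
      by (simp add: algebra_simps)
    also have "\<dots> = exp (\<i> * of_int m * complex_of_real (- pi))"
      by (subst exp_eq) (auto intro!: exI[of _ m])
    finally show ?thesis .
  qed
  finally show ?thesis using False by simp
qed

lemma fourier_coeff:
  fixes P :: "complex poly"
  shows "(\<integral>x. indicator {- pi..pi} x *\<^sub>R (poly P (exp (- complex_of_real t + \<i> * complex_of_real x)) * exp (- \<i> * of_nat n * complex_of_real x)) \<partial>lborel)
    = 2 * pi * exp (- (complex_of_real t * of_nat n)) * coeff P n"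
proof -
  let ?g = "\<lambda>m x. indicator {- pi..pi} x *\<^sub>R exp (\<i> * of_int (int m - int n) * complex_of_real x)"
  let ?c = "\<lambda>m. coeff P m * exp (- (complex_of_real t * of_nat m))"
  have "indicator {- pi..pi} x *\<^sub>R (poly P (exp (- complex_of_real t + \<i> * complex_of_real x)) * exp (- \<i> * of_nat n * complex_of_real x))
      = (\<Sum>m\<le>degree P. ?c m * ?g m x)" for x :: real
  proof -
    have *: "coeff P m * exp (- complex_of_real t + \<i> * complex_of_real x) ^ m * exp (- \<i> * of_nat n * complex_of_real x)
        = ?c m * exp (\<i> * of_int (int m - int n) * complex_of_real x)" for m
      by (simp add: exp_of_nat_mult[symmetric] mult.assoc exp_add[symmetric]) (simp add: algebra_simps)
    show ?thesis
      by (simp only: poly_altdef sum_distrib_right * scaleR_sum_right mult_scaleR_right)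
  qed
  then have "(\<integral>x. indicator {- pi..pi} x *\<^sub>R (poly P (exp (- complex_of_real t + \<i> * complex_of_real x)) * exp (- \<i> * of_nat n * complex_of_real x)) \<partial>lborel)
    = (\<integral>x. (\<Sum>m\<le>degree P. ?c m * ?g m x) \<partial>lborel)" by (simp only:)
  also have "\<dots> = (\<Sum>m\<le>degree P. \<integral>x. ?c m * ?g m x \<partial>lborel)"
    by (rule Bochner_Integration.integral_sum)
      (intro integrable_mult_right borel_integrable_compact continuous_intros compact_Icc)
  also have "\<dots> = (\<Sum>m\<le>degree P. ?c m * (if int m - int n = 0 then 2 * pi else 0))"
    by (subst integral_iexp_int[symmetric]) (intro sum.cong refl integral_mult_right_zero)
  also have "\<dots> = (\<Sum>m\<le>degree P. if m = n then 2 * pi * ?c m else 0)"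
    by (rule sum.cong) auto
  also have "\<dots> = 2 * pi * ?c n" by (auto simp: coeff_eq_0)
  finally show ?thesis by (simp add: mult_ac)
qed

text \<open>The characteristic function at \<open>x\<close> of the sum of independent variables that
  take the value \<open>k\<close> with probability \<open>fermi (k t)\<close> and 0
  otherwise.\<close>

definition dist_char :: "nat \<Rightarrow> real \<Rightarrow> real \<Rightarrow> complex" where
  "dist_char n t x = (\<Prod>k=1..n. 1 - of_real (fermi (real k * t)) + of_real (fermi (real k * t)) * iexp (real k * x))"

text \<open>Dividing the factor \<open>1 + z^k\<close> at \<open>z = exp (- t + i x)\<close> by its
  value at \<open>x = 0\<close> leaves the characteristic function of one Bernoulli
  multiple.\<close>

lemma poly_prod_eq_dist_char:
  "poly (\<Prod>k=1..n. 1 + monom 1 k) (exp (- complex_of_real t + \<i> * complex_of_real x)) =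
    of_real (\<Prod>k=1..n. 1 + exp (- (real k * t))) * dist_char n t x"
proof -
  have "1 + exp (- complex_of_real t + \<i> * complex_of_real x) ^ k = of_real (1 + exp (- (real k * t))) *
    (1 - of_real (fermi (real k * t)) + of_real (fermi (real k * t)) * iexp (real k * x))" for k
  proof -
    let ?e = "exp (- (real k * t))"
    have "exp (- complex_of_real t + \<i> * complex_of_real x) ^ k = of_real ?e * iexp (real k * x)"
      by (simp add: exp_of_nat_mult[symmetric] exp_of_real[symmetric] exp_add[symmetric] algebra_simps)
    moreover have "(1 + ?e) * fermi (real k * t) = ?e" by (simp add: fermi_def)
    then have "complex_of_real (1 + ?e) * of_real (fermi (real k * t)) = of_real ?e"
      by (simp only: of_real_mult[symmetric])
    then have "complex_of_real (1 + ?e) * (1 - of_real (fermi (real k * t)) + of_real (fermi (real k * t)) * iexp (real k * x))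
        = of_real (1 + ?e) - of_real ?e + of_real ?e * iexp (real k * x)"
      by (simp only: distrib_left right_diff_distrib mult.assoc[symmetric] mult_1_right)
    ultimately show ?thesis by simp
  qed
  then show ?thesis
    unfolding dist_char_def poly_prod of_real_prod prod.distrib[symmetric]
    by (simp add: poly_monom del: of_real_add)
qed

lemma coeff_prod_one_plus_monom_of_int:
  assumes "finite A"
  shows "coeff (\<Prod>k\<in>A. 1 + monom 1 k :: complex poly) m = of_int (coeff (\<Prod>k\<in>A. 1 + monom 1 k) m)"
  using assms
proof (induction A arbitrary: m rule: finite_induct)
  case empty
  show ?case by (simp add: coeff_1)
next
  case (insert k A)
  then show ?case by (simp add: distrib_right coeff_monom_mult)
qed

lemma odd_count_fourier:
  "complex_of_real (real_of_int (odd_count (int n))) =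
    of_real (exp (t * real n) * (\<Prod>k=1..n. 1 + exp (- (real k * t))) / (2 * pi)) *
    (\<integral>x. indicator {- pi..pi} x *\<^sub>R (dist_char n t x * iexp (- (real n * x))) \<partial>lborel)"
proof -
  let ?P = "\<Prod>k=1..n. 1 + monom 1 k :: complex poly" and ?A = "\<Prod>k=1..n. 1 + exp (- (real k * t))"
  let ?I = "\<integral>x. indicator {- pi..pi} x *\<^sub>R (dist_char n t x * iexp (- (real n * x))) \<partial>lborel"
  have c: "coeff ?P n = of_int (odd_count (int n))"
    unfolding odd_count_eq_coeff by (rule coeff_prod_one_plus_monom_of_int) simp
  have eq: "of_real ?A * (indicator {- pi..pi} x *\<^sub>R (dist_char n t x * iexp (- (real n * x)))) =
      indicator {- pi..pi} x *\<^sub>R (poly ?P (exp (- complex_of_real t + \<i> * complex_of_real x)) * exp (- \<i> * of_nat n * complex_of_real x))" for x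
    unfolding poly_prod_eq_dist_char by (simp add: mult.assoc del: of_real_prod)
  have "of_real ?A * ?I = 2 * pi * exp (- (complex_of_real t * of_nat n)) * coeff ?P n"
    by (subst integral_mult_right_zero[symmetric]) (simp only: eq fourier_coeff)
  moreover have "exp (- (complex_of_real t * of_nat n)) * of_real (exp (t * real n)) = 1"
    by (simp add: exp_of_real[symmetric] exp_add[symmetric])
  ultimately show ?thesis
    unfolding c by (simp add: field_simps)
qed

section \<open>Uniform decay of the characteristic function\<close>

lemma power_div_fact_le_exp:
  assumes "0 \<le> (x::real)"
  shows "x ^ n / fact n \<le> exp x"
proof -
  have "(\<Sum>k\<in>{n}. x ^ k /\<^sub>R fact k) \<le> (\<Sum>k. x ^ k /\<^sub>R fact k)"
    using assms exp_converges[of x] by (intro sum_le_suminf sums_summable[of _ "exp x"]) auto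
  then show ?thesis by (simp add: exp_def field_simps)
qed

lemma sin_ge_third:
  assumes "0 \<le> x" "x \<le> pi / 2"
  shows "x / 3 \<le> sin x"
proof -
  have small: "5 / 6 * y \<le> sin y" if "0 \<le> y" "y \<le> 1" for y :: real
  proof -
    have "\<bar>sin y - (\<Sum>m<3. sin_coeff m * y ^ m)\<bar> \<le> inverse (fact 3) * \<bar>y\<bar> ^ 3" by (rule Maclaurin_sin_bound)
    moreover have "(\<Sum>m<3. sin_coeff m * y ^ m) = y"
      by (simp add: eval_nat_numeral sin_coeff_def)
    moreover have "y ^ 3 \<le> y" using that power_decreasing[of 1 3 y] by simp
    moreover have "inverse (fact 3 :: real) * \<bar>y\<bar> ^ 3 = y ^ 3 / 6"
      using that by (simp add: fact_numeral)
    ultimately show ?thesis by linarith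
  qed
  show ?thesis
  proof (cases "x \<le> 1")
    case True
    then show ?thesis using small[of x] assms by simp
  next
    case False
    then have "sin 1 \<le> sin x" using assms by (intro sin_monotone_2pi_le) auto
    moreover have "x \<le> 2" using assms pi_less_4 by linarith
    ultimately show ?thesis using small[of 1] by simp
  qed
qed

lemma one_minus_cos_ge:
  assumes "\<bar>x\<bar> \<le> pi"
  shows "x\<^sup>2 / 18 \<le> 1 - cos x"
proof -
  have "\<bar>x\<bar> / 2 / 3 \<le> sin (\<bar>x\<bar> / 2)" using assms by (intro sin_ge_third) auto
  then have "(\<bar>x\<bar> / 2 / 3)\<^sup>2 \<le> (sin (\<bar>x\<bar> / 2))\<^sup>2" by (intro power_mono) auto
  moreover have "cos x = 1 - 2 * (sin (\<bar>x\<bar> / 2))\<^sup>2"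
    using cos_double_sin[of "x / 2"] by (cases "x \<ge> 0") simp_all
  ultimately show ?thesis by (simp add: power_divide)
qed

text \<open>The squared norm is exactly \<open>1 - 2 p (1 - p) (1 - cos x)\<close>, to which
  \<open>1 + y <= exp y\<close> applies.\<close>

lemma norm_bernoulli_char_le:
  assumes "0 \<le> p" "p \<le> 1"
  shows "norm (1 - of_real p + of_real p * iexp x) \<le> exp (- (p * (1 - p) * (1 - cos x)))"
proof -
  let ?z = "1 - of_real p + of_real p * iexp x"
  have "(norm ?z)\<^sup>2 = (1 - p + p * cos x)\<^sup>2 + (p * sin x)\<^sup>2"
    by (simp add: cmod_power2 cis_conv_exp[symmetric])
  also have "\<dots> = 1 + - 2 * (p * (1 - p) * (1 - cos x)) - p\<^sup>2 * (1 - ((sin x)\<^sup>2 + (cos x)\<^sup>2))"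
  proof -
    have "(1 - p + p * c)\<^sup>2 + (p * s)\<^sup>2 = 1 + - 2 * (p * (1 - p) * (1 - c)) - p\<^sup>2 * (1 - (s\<^sup>2 + c\<^sup>2))" for c s
      by (simp add: power2_eq_square algebra_simps)
    then show ?thesis .
  qed
  also have "\<dots> = 1 + - 2 * (p * (1 - p) * (1 - cos x))" by simp
  also have "\<dots> \<le> exp (- 2 * (p * (1 - p) * (1 - cos x)))" by (rule exp_ge_add_one_self)
  also have "\<dots> = (exp (- (p * (1 - p) * (1 - cos x))))\<^sup>2" by (simp add: exp_double[symmetric])
  finally show ?thesis by (rule power2_le_imp_le) simp
qed

text \<open>Replacing each variance by \<open>exp (- k t) / 4\<close> gives geometric weights, for
  which the sum over \<open>k\<close> has a closed form.\<close>

lemma norm_dist_char_le: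
  assumes "t \<ge> 0"
  shows "norm (dist_char n t x) \<le> exp (- (\<Sum>k=1..n. exp (- t) ^ k * (1 - cos (real k * x))) / 4)"
proof -
  have "norm (dist_char n t x) \<le> (\<Prod>k=1..n. exp (- (exp (- t) ^ k * (1 - cos (real k * x))) / 4))"
    unfolding dist_char_def prod_norm[symmetric]
  proof (rule prod_mono, safe)
    fix k
    let ?p = "fermi (real k * t)"
    have "norm (1 - of_real ?p + of_real ?p * iexp (real k * x)) \<le> exp (- (?p * (1 - ?p) * (1 - cos (real k * x))))"
      using fermi_pos[of "real k * t"] fermi_less_1[of "real k * t"] by (intro norm_bernoulli_char_le) auto
    also have "\<dots> \<le> exp (- (exp (- t) ^ k / 4 * (1 - cos (real k * x))))"
    proof -
      have "exp (- t) ^ k / 4 \<le> ?p * (1 - ?p)"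
        using exp_div4_le_fermi[of "real k * t"] assms by (simp flip: exp_of_nat_mult)
      then have "exp (- t) ^ k / 4 * (1 - cos (real k * x)) \<le> ?p * (1 - ?p) * (1 - cos (real k * x))"
        by (intro mult_right_mono) auto
      then show ?thesis by simp
    qed
    finally show "norm (1 - of_real ?p + of_real ?p * iexp (real k * x)) \<le> exp (- (exp (- t) ^ k * (1 - cos (real k * x))) / 4)"
      by simp
  qed simp
  also have "\<dots> = exp (- (\<Sum>k=1..n. exp (- t) ^ k * (1 - cos (real k * x))) / 4)"
    by (simp add: exp_sum[symmetric] sum_negf sum_divide_distrib)
  finally show ?thesis .
qed

text \<open>The sum is the real part of a difference of two geometric series, with ratios
  \<open>q\<close> and \<open>q * iexp x\<close>.\<close>

lemma cos_geometric_sums: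
  assumes "0 < q" "q < 1"
  shows "(\<lambda>k. q ^ k * (1 - cos (real k * x))) sums
    (q * (1 + q) * (1 - cos x) / ((1 - q) * ((1 - q)\<^sup>2 + 2 * q * (1 - cos x))))"
proof -
  let ?z = "of_real q * iexp x" and ?r = "1 - q" and ?y = "1 - cos x"
  have "norm ?z < 1" using assms by (simp add: norm_mult)
  then have "(\<lambda>k. ?z ^ k) sums (1 / (1 - ?z))" by (rule geometric_sums)
  then have "(\<lambda>k. Re (?z ^ k)) sums Re (1 / (1 - ?z))" by (rule sums_Re)
  moreover have "Re (?z ^ k) = q ^ k * cos (real k * x)" for k
    by (simp add: power_mult_distrib exp_of_nat_mult[symmetric] Re_exp mult.assoc flip: of_real_power)
  ultimately have "(\<lambda>k. q ^ k * cos (real k * x)) sums Re (1 / (1 - ?z))" by simp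
  with geometric_sums[of q] have s: "(\<lambda>k. q ^ k - q ^ k * cos (real k * x)) sums (1 / ?r - Re (1 / (1 - ?z)))"
    using assms by (intro sums_diff) auto
  have d: "?r\<^sup>2 + 2 * q * ?y > 0" using assms by (intro add_pos_nonneg) auto
  have "(1 - q * c)\<^sup>2 + (q * s)\<^sup>2 = ?r\<^sup>2 + 2 * q * (1 - c) - q\<^sup>2 * (1 - (s\<^sup>2 + c\<^sup>2))" for c s
    by (simp add: power2_eq_square algebra_simps)
  from this[of "cos x" "sin x"] have n: "(1 - q * cos x)\<^sup>2 + (q * sin x)\<^sup>2 = ?r\<^sup>2 + 2 * q * ?y" by simp
  have "Re (1 / (1 - ?z)) = (1 - q * cos x) / ((1 - q * cos x)\<^sup>2 + (q * sin x)\<^sup>2)"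
    by (simp add: Re_divide Re_exp Im_exp)
  also have "\<dots> = (?r + q * ?y) / (?r\<^sup>2 + 2 * q * ?y)" unfolding n by (simp add: algebra_simps)
  finally have Re: "Re (1 / (1 - ?z)) = (?r + q * ?y) / (?r\<^sup>2 + 2 * q * ?y)" .
  have "1 / ?r - (?r + q * ?y) / (?r\<^sup>2 + 2 * q * ?y) = ((?r\<^sup>2 + 2 * q * ?y) - ?r * (?r + q * ?y)) / (?r * (?r\<^sup>2 + 2 * q * ?y))"
    using d assms by (simp add: diff_frac_eq)
  also have "(?r\<^sup>2 + 2 * q * ?y) - ?r * (?r + q * ?y) = q * (1 + q) * ?y"
    by (simp add: power2_eq_square algebra_simps)
  finally have "1 / ?r - Re (1 / (1 - ?z)) = q * (1 + q) * ?y / (?r * (?r\<^sup>2 + 2 * q * ?y))" unfolding Re .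
  with s show ?thesis by (simp add: right_diff_distrib)
qed

text \<open>In the closed form with \<open>q = exp (- t)\<close>, use \<open>1 - q <= t\<close>,
  \<open>q >= 1/3\<close>, and that \<open>y / (t^2 + 2 y)\<close> increases in
  \<open>y = 1 - cos x >= x^2 / 18\<close>. The terms beyond \<open>n\<close> are bounded by a
  geometric tail and subtracted.\<close>

lemma cos_geometric_ge:
  assumes t: "0 < t" "t \<le> 1" and x: "\<bar>x\<bar> \<le> pi"
  shows "(\<Sum>k=1..n. exp (- t) ^ k * (1 - cos (real k * x))) \<ge>
    x\<^sup>2 / 54 / (t * (t\<^sup>2 + x\<^sup>2 / 9)) - 2 * exp (- (real n * t)) / t"
proof -
  let ?q = "exp (- t)" and ?y = "1 - cos x" and ?a = "\<lambda>k. exp (- t) ^ k * (1 - cos (real k * x))"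
  let ?r = "1 - ?q"
  have q: "0 < ?q" "?q < 1" using t by auto
  have rt: "?r \<le> t" using exp_ge_add_one_self[of "- t"] by simp
  have q3: "1 / 3 \<le> ?q"
  proof -
    have "exp t \<le> exp 1" using t by simp
    then have "exp t \<le> 3" using exp_le by linarith
    then show ?thesis by (simp add: exp_minus field_simps)
  qed
  note S = cos_geometric_sums[OF q, of x]
  have "(\<Sum>k<Suc n. ?a k) = (\<Sum>k=1..n. ?a k)"
    unfolding lessThan_Suc_atMost atMost_atLeast0 by (subst sum.atLeast_Suc_atMost) auto
  then have split: "suminf ?a = (\<Sum>k=1..n. ?a k) + (\<Sum>k. ?a (k + Suc n))"
    using suminf_split_initial_segment[OF sums_summable[OF S], of "Suc n"] by simp
  have "(\<Sum>k. ?a (k + Suc n)) \<le> (\<Sum>k. 2 * ?q ^ Suc n * ?q ^ k)"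
  proof (rule suminf_le)
    show "?a (k + Suc n) \<le> 2 * ?q ^ Suc n * ?q ^ k" for k
    proof -
      have "?a (k + Suc n) \<le> ?q ^ (k + Suc n) * 2" using cos_ge_minus_one[of "real (k + Suc n) * x"]
        by (intro mult_left_mono) (linarith, simp)
      then show ?thesis by (simp add: power_add mult_ac)
    qed
    show "summable (\<lambda>k. ?a (k + Suc n))" using sums_summable[OF S] by (subst summable_iff_shift)
    show "summable (\<lambda>k. 2 * ?q ^ Suc n * ?q ^ k)" using q by (intro summable_mult summable_geometric) auto
  qed
  also have "\<dots> = 2 * ?q ^ Suc n * (1 / ?r)"
    using q by (subst suminf_mult) (auto simp: suminf_geometric intro: summable_geometric)
  also have "\<dots> = 2 * exp (- (real n * t)) * (?q / ?r)"
    by (simp flip: exp_of_nat_mult)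
  also have "\<dots> \<le> 2 * exp (- (real n * t)) * (1 / t)"
  proof -
    have "?q / ?r = 1 / (exp t - 1)" using t by (simp add: exp_minus field_simps)
    also have "\<dots> \<le> 1 / t"
    proof -
      have "t \<le> exp t - 1" using exp_ge_add_one_self[of t] by linarith
      then show ?thesis using t by (intro divide_left_mono mult_pos_pos) linarith+
    qed
    finally show ?thesis by (intro mult_left_mono) auto
  qed
  finally have tail: "(\<Sum>k. ?a (k + Suc n)) \<le> 2 * exp (- (real n * t)) / t" by simp
  have y: "x\<^sup>2 / 18 \<le> ?y" by (rule one_minus_cos_ge[OF x])
  have "x\<^sup>2 / 54 / (t * (t\<^sup>2 + x\<^sup>2 / 9)) \<le> (1 / 3) * (?y / (t * (t\<^sup>2 + 2 * ?y)))"
  proof -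
    have "(x\<^sup>2 / 18) / (t\<^sup>2 + 2 * (x\<^sup>2 / 18)) \<le> ?y / (t\<^sup>2 + 2 * ?y)"
    proof (subst frac_le_eq)
      have "x\<^sup>2 / 18 * t\<^sup>2 \<le> ?y * t\<^sup>2" using y by (intro mult_right_mono) auto
      moreover have "a * (T + 2 * y) - y * (T + 2 * a) \<le> 0" if "a * T \<le> y * T" for a y T :: real
        using that by (simp add: algebra_simps)
      ultimately have "x\<^sup>2 / 18 * (t\<^sup>2 + 2 * ?y) - ?y * (t\<^sup>2 + 2 * (x\<^sup>2 / 18)) \<le> 0" by blast
      moreover have "t\<^sup>2 > 0" using t by simp
      ultimately show "(x\<^sup>2 / 18 * (t\<^sup>2 + 2 * ?y) - ?y * (t\<^sup>2 + 2 * (x\<^sup>2 / 18))) / ((t\<^sup>2 + 2 * (x\<^sup>2 / 18)) * (t\<^sup>2 + 2 * ?y)) \<le> 0"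
        by (intro divide_nonpos_pos mult_pos_pos add_pos_nonneg) auto
    next
      have "t\<^sup>2 > 0" using t by simp
      then have "t\<^sup>2 + 2 * (x\<^sup>2 / 18) > 0" "t\<^sup>2 + 2 * ?y > 0" by (auto intro!: add_pos_nonneg)
      then show "t\<^sup>2 + 2 * (x\<^sup>2 / 18) \<noteq> 0" "t\<^sup>2 + 2 * ?y \<noteq> 0" by (simp_all only: order_less_imp_not_eq2 not_False_eq_True)
    qed
    then have "1 / (3 * t) * ((x\<^sup>2 / 18) / (t\<^sup>2 + 2 * (x\<^sup>2 / 18))) \<le> 1 / (3 * t) * (?y / (t\<^sup>2 + 2 * ?y))"
      using t by (intro mult_left_mono) auto
    moreover have "1 / (3 * t) * (A / 18 / B) = A / 54 / (t * B)" "1 / (3 * t) * (A / B) = 1 / 3 * (A / (t * B))" for A B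
      by simp_all
    moreover have "t\<^sup>2 + 2 * (x\<^sup>2 / 18) = t\<^sup>2 + x\<^sup>2 / 9" by simp
    ultimately show ?thesis by (simp only:)
  qed
  also have "\<dots> \<le> ?q * (1 + ?q) * (?y / (t * (t\<^sup>2 + 2 * ?y)))"
  proof (rule mult_right_mono)
    have "1 / 3 * 1 \<le> ?q * (1 + ?q)" using q3 q by (intro mult_mono) auto
    then show "1 / 3 \<le> ?q * (1 + ?q)" by simp
  qed (use t in \<open>auto intro!: divide_nonneg_nonneg mult_nonneg_nonneg add_nonneg_nonneg\<close>)
  also have "\<dots> \<le> ?q * (1 + ?q) * (?y / (?r * (?r\<^sup>2 + 2 * ?q * ?y)))"
  proof (intro mult_left_mono divide_left_mono)
    have A: "2 * ?q * ?y \<le> 2 * ?y" by (intro mult_right_mono) (use q in auto)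
    have B: "?r\<^sup>2 \<le> t\<^sup>2" using rt q by (intro power_mono) auto
    have C: "0 \<le> ?r\<^sup>2 + 2 * ?q * ?y" by (intro add_nonneg_nonneg) auto
    show "?r * (?r\<^sup>2 + 2 * ?q * ?y) \<le> t * (t\<^sup>2 + 2 * ?y)"
      by (rule mult_mono[OF rt add_mono[OF B A] _ C]) (use t in simp)
    show "0 < t * (t\<^sup>2 + 2 * ?y) * (?r * (?r\<^sup>2 + 2 * ?q * ?y))"
      using t q by (intro mult_pos_pos add_pos_nonneg) auto
  qed (use q in auto)
  also have "\<dots> = suminf ?a" using sums_unique[OF S] by simp
  finally show ?thesis using split tail by linarith
qed

text \<open>The hypothesis forces \<open>t\<close> to be at most of order \<open>|w|^(-2/3)\<close>,
  so for large \<open>w\<close> the exponent grows at least like \<open>|w|^(2/3)\<close> and its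
  cube like \<open>w^2\<close>. In the constant, \<open>8 * 54^3\<close> comes from that cube,
  \<open>384 = 4^3 * 3!\<close> from \<open>y^3 / 3! <= exp y\<close> at a quarter of the exponent,
  and 2 from \<open>1 + w^2 <= 2 w^2\<close>.\<close>

lemma exp_le_lorentzian:
  assumes t: "0 < t" and w: "t ^ 3 * w\<^sup>2 \<le> pi\<^sup>2"
  shows "exp (- (w\<^sup>2 / 54 / (1 + t * w\<^sup>2 / 9)) / 4) \<le> (16 * 384 * 54 ^ 3) / (1 + w\<^sup>2)"
proof -
  let ?X = "w\<^sup>2 / 54 / (1 + t * w\<^sup>2 / 9)" and ?a = "t * w\<^sup>2 / 9"
  have a: "?a \<ge> 0" using t by simp
  have X: "?X \<ge> 0" using a by (intro divide_nonneg_nonneg) auto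
  have "1 + w\<^sup>2 \<le> (16 * 384 * 54 ^ 3) * exp (?X / 4)"
  proof (cases "w\<^sup>2 \<le> 1")
    case True
    have "1 \<le> exp (?X / 4)" by (subst one_le_exp_iff) (rule divide_nonneg_nonneg[OF X], simp)
    moreover have "1 + w\<^sup>2 \<le> 16 * 384 * 54 ^ 3 * e" if "1 \<le> e" for e :: real
      using that True by simp
    ultimately show ?thesis by blast
  next
    case False
    have "pi\<^sup>2 \<le> 4\<^sup>2" using pi_less_4 by (intro power_mono) auto
    then have "(t ^ 3 * w\<^sup>2) * (w\<^sup>2 * w\<^sup>2) \<le> 16 * (w\<^sup>2 * w\<^sup>2)" using w by (intro mult_right_mono) auto
    moreover have "?a ^ 3 = (t ^ 3 * w\<^sup>2) * (w\<^sup>2 * w\<^sup>2) / 729" by (simp add: power_divide power_mult_distrib power3_eq_cube)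
    moreover have "w\<^sup>2 * w\<^sup>2 \<ge> 0" by simp
    ultimately have a3: "?a ^ 3 \<le> w\<^sup>2 * w\<^sup>2" by linarith
    have "(1 + ?a) ^ 3 \<le> 4 * (1 + ?a ^ 3)"
    proof -
      have "4 * (1 + a ^ 3) - (1 + a) ^ 3 = 3 * (1 + a) * (1 - a)\<^sup>2" for a :: real
        by (simp add: power2_eq_square power3_eq_cube algebra_simps)
      from this[of ?a] have "4 * (1 + ?a ^ 3) - (1 + ?a) ^ 3 = 3 * (1 + ?a) * (1 - ?a)\<^sup>2" .
      moreover have "3 * (1 + ?a) * (1 - ?a)\<^sup>2 \<ge> 0" using a by simp
      ultimately show ?thesis by linarith
    qed
    also have "\<dots> \<le> 4 * (2 * (w\<^sup>2 * w\<^sup>2))"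
      using a3 False mult_mono[of 1 "w\<^sup>2" 1 "w\<^sup>2"] by simp
    finally have "(1 + ?a) ^ 3 \<le> 8 * (w\<^sup>2 * w\<^sup>2)" by simp
    then have "(w\<^sup>2 / 54) ^ 3 / (8 * (w\<^sup>2 * w\<^sup>2)) \<le> (w\<^sup>2 / 54) ^ 3 / (1 + ?a) ^ 3"
    proof (rule divide_left_mono)
      have w: "w\<^sup>2 > 0" and a1: "1 + ?a > 0" using False a by linarith+
      show "0 < 8 * (w\<^sup>2 * w\<^sup>2) * (1 + ?a) ^ 3"
        by (rule mult_pos_pos[OF mult_pos_pos[OF zero_less_numeral mult_pos_pos[OF w w]] zero_less_power[OF a1]])
    qed simp_all
    also have "(w\<^sup>2 / 54) ^ 3 / (1 + ?a) ^ 3 = ?X ^ 3" by (simp only: power_divide)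
    finally have X3: "(w\<^sup>2 / 54) ^ 3 / (8 * (w\<^sup>2 * w\<^sup>2)) \<le> ?X ^ 3" .
    have "(u / 54) ^ 3 / (8 * (u * u)) = u / (8 * 54 ^ 3)" if "u > 0" for u :: real
      using that by (simp add: power3_eq_cube)
    moreover have "w\<^sup>2 > 0" using False by linarith
    ultimately have "w\<^sup>2 / (8 * 54 ^ 3) \<le> ?X ^ 3" using X3 by (simp only:)
    moreover have "(?X / 4) ^ 3 / fact 3 \<le> exp (?X / 4)"
      by (rule power_div_fact_le_exp[OF divide_nonneg_nonneg[OF X]]) simp
    moreover have "a \<le> 384 * e" if "a \<le> X ^ 3" "(X / 4) ^ 3 / fact 3 \<le> e" for a X e :: real
      using that by (simp add: power_divide fact_numeral)
    ultimately have "w\<^sup>2 / (8 * 54 ^ 3) \<le> 384 * exp (?X / 4)" by blast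
    moreover have "1 + w\<^sup>2 \<le> 16 * 384 * 54 ^ 3 * e" if "w\<^sup>2 / (8 * 54 ^ 3) \<le> 384 * e" for e :: real
      using that False by simp
    ultimately show ?thesis by blast
  qed
  moreover have "1 + w\<^sup>2 > 0" by (rule add_pos_nonneg) auto
  ultimately show ?thesis by (simp add: exp_minus field_simps)
qed

lemma norm_dist_char_rescaled_le:
  assumes t: "0 < t" "t \<le> 1" and w: "\<bar>sqrt t ^ 3 * w\<bar> \<le> pi"
  shows "norm (dist_char n t (sqrt t ^ 3 * w)) \<le>
    (16 * 384 * 54 ^ 3) * exp (exp (- (real n * t)) / t) / (1 + w\<^sup>2)"
proof -
  let ?x = "sqrt t ^ 3 * w" and ?X = "w\<^sup>2 / 54 / (1 + t * w\<^sup>2 / 9)"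
  have "(sqrt t ^ 3)\<^sup>2 = (sqrt t * sqrt t) ^ 3" by (simp only: power2_eq_square power3_eq_cube mult_ac)
  then have x2: "?x\<^sup>2 = t ^ 3 * w\<^sup>2" using t by (simp add: power_mult_distrib)
  have "?x\<^sup>2 / 54 / (t * (t\<^sup>2 + ?x\<^sup>2 / 9)) = ?X"
  proof -
    have "t * (t\<^sup>2 + t ^ 3 * w\<^sup>2 / 9) = t ^ 3 * (1 + t * w\<^sup>2 / 9)"
      by (simp add: power2_eq_square power3_eq_cube algebra_simps)
    then show ?thesis unfolding x2 using t by simp
  qed
  then have h: "(\<Sum>k=1..n. exp (- t) ^ k * (1 - cos (real k * ?x))) \<ge> ?X - 2 * exp (- (real n * t)) / t"
    using cos_geometric_ge[OF t w, of n] by (simp only:)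
  have "- (\<Sum>k=1..n. exp (- t) ^ k * (1 - cos (real k * ?x))) / 4 \<le> - ?X / 4 + exp (- (real n * t)) / t"
  proof -
    have "2 * exp (- (real n * t)) / t = 2 * (exp (- (real n * t)) / t)" "exp (- (real n * t)) / t \<ge> 0"
      using t by auto
    moreover have "- S / 4 \<le> - X / 4 + E" if "X - 2 * E \<le> S" "E \<ge> 0" for S X E :: real
      using that by simp
    ultimately show ?thesis using h by (simp only:)
  qed
  then have "norm (dist_char n t ?x) \<le> exp (- ?X / 4 + exp (- (real n * t)) / t)"
    using norm_dist_char_le[of t n ?x] t by (meson exp_le_cancel_iff less_imp_le order_trans)
  also have "\<dots> = exp (- ?X / 4) * exp (exp (- (real n * t)) / t)" by (rule exp_add)
  also have "\<dots> \<le> (16 * 384 * 54 ^ 3) / (1 + w\<^sup>2) * exp (exp (- (real n * t)) / t)"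
  proof (intro mult_right_mono exp_le_lorentzian t)
    have "\<bar>?x\<bar>\<^sup>2 \<le> pi\<^sup>2" using w by (intro power_mono) auto
    then show "t ^ 3 * w\<^sup>2 \<le> pi\<^sup>2" by (simp add: x2)
  qed simp
  finally show ?thesis by simp
qed

section \<open>Gaussian approximation of the characteristic function\<close>

lemma bernoulli_char_approx:
  assumes p: "0 \<le> p" "p \<le> 1"
  shows "norm ((1 - of_real p + of_real p * iexp x) - iexp (p * x) * of_real (exp (- (p * (1 - p) * x\<^sup>2 / 2))))
    \<le> p * (\<bar>x\<bar> ^ 3 + x ^ 6)"
proof -
  let ?v = "p * (1 - p) * x\<^sup>2 / 2" and ?y = "\<bar>x\<bar>"
  \<comment> \<open>These are Taylor remainders: second order for the two oscillating exponentials,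
    first order in \<open>?v\<close> for the Gaussian factor. Each bound below retains a factor
    \<open>p\<close>, so that the errors remain summable against the Fermi weights.\<close>
  define Q where "Q = iexp (p * x) - (1 + \<i> * of_real (p * x) - of_real ((p * x)\<^sup>2 / 2))"
  define R where "R = exp (- ?v) - (1 - ?v)"
  define S where "S = iexp x - (1 + \<i> * of_real x - of_real (x\<^sup>2 / 2))"
  have s2: "(\<Sum>k\<le>2. (\<i> * of_real u) ^ k / fact k) = 1 + \<i> * of_real u - of_real (u\<^sup>2 / 2)" for u :: real
    by (simp add: eval_nat_numeral power2_eq_square algebra_simps)
  have Q: "norm Q \<le> p * (?y ^ 3 / 6)"
  proof -
    have "norm Q \<le> \<bar>p * x\<bar> ^ 3 / 6"
      using iexp_approx1[of "p * x" 2] unfolding Q_def s2 by (simp add: fact_numeral)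
    also have "\<dots> = p ^ 3 * (?y ^ 3 / 6)" using p by (simp add: abs_mult power_mult_distrib)
    also have "\<dots> \<le> p * (?y ^ 3 / 6)" using p power_decreasing[of 1 3 p] by (intro mult_right_mono) auto
    finally show ?thesis .
  qed
  have S: "norm S \<le> ?y ^ 3 / 6"
    using iexp_approx1[of x 2] unfolding S_def s2 by (simp add: fact_numeral)
  have v: "0 \<le> ?v" "?v \<le> p * (x\<^sup>2 / 2)"
  proof -
    show "0 \<le> ?v" using p by simp
    have "p * (1 - p) * (x\<^sup>2 / 2) \<le> p * (x\<^sup>2 / 2)" using p by (intro mult_right_mono mult_left_le) auto
    then show "?v \<le> p * (x\<^sup>2 / 2)" by simp
  qed
  have R: "\<bar>R\<bar> \<le> ?v\<^sup>2 / 2"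
  proof -
    have "0 \<le> R" unfolding R_def using exp_ge_add_one_self[of "- ?v"] by linarith
    moreover have "R \<le> ?v\<^sup>2 / 2"
    proof -
      have "(\<lambda>u. u\<^sup>2 / 2 - exp (- u) + (1 - u)) 0 \<le> (\<lambda>u. u\<^sup>2 / 2 - exp (- u) + (1 - u)) ?v"
      proof (rule DERIV_nonneg_imp_nondecreasing[OF v(1)])
        fix u :: real
        have "((\<lambda>u. u\<^sup>2 / 2 - exp (- u) + (1 - u)) has_real_derivative u + exp (- u) - 1) (at u)"
          by (auto intro!: derivative_eq_intros)
        moreover have "u + exp (- u) - 1 \<ge> 0" using exp_ge_add_one_self[of "- u"] by linarith
        ultimately show "\<exists>d. ((\<lambda>u. u\<^sup>2 / 2 - exp (- u) + (1 - u)) has_real_derivative d) (at u) \<and> 0 \<le> d" by blast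
      qed
      then show ?thesis unfolding R_def by simp
    qed
    ultimately show ?thesis by simp
  qed
  have E: "norm (iexp (p * x) - 1) \<le> p * ?y"
    using iexp_approx1[of "p * x" 0] p by (simp add: abs_mult)
  \<comment> \<open>Mean and variance agree, so the Taylor parts cancel through second order in
    \<open>x\<close>. Apart from the remainders there survives only \<open>?v\<close> times
    \<open>iexp (p * x) - 1\<close>, which is of third order.\<close>
  have "(1 - of_real p + of_real p * iexp x) - iexp (p * x) * of_real (exp (- ?v)) =
      of_real p * S - iexp (p * x) * of_real R - Q + of_real ?v * (iexp (p * x) - 1)"
  proof -
    have "(1 - P + P * (S + (1 + \<i> * X - X\<^sup>2 / 2))) - (Q + (1 + \<i> * (P * X) - (P * X)\<^sup>2 / 2)) * (R + (1 - P * (1 - P) * X\<^sup>2 / 2)) =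
      P * S - (Q + (1 + \<i> * (P * X) - (P * X)\<^sup>2 / 2)) * R - Q + P * (1 - P) * X\<^sup>2 / 2 * ((Q + (1 + \<i> * (P * X) - (P * X)\<^sup>2 / 2)) - 1)"
      for P Q R S X :: complex
      by (simp add: field_simps power2_eq_square)
    from this[of "of_real p" S "of_real x" Q "of_real R"] show ?thesis
      by (simp add: S_def Q_def R_def)
  qed
  also have "norm \<dots> \<le> p * (?y ^ 3 / 6) + ?v\<^sup>2 / 2 + p * (?y ^ 3 / 6) + ?v * (p * ?y)"
  proof (intro order_trans[OF norm_triangle_ineq] order_trans[OF norm_triangle_ineq4] add_mono)
    show "norm (of_real p * S) \<le> p * (?y ^ 3 / 6)" using mult_left_mono[OF S p(1)] p(1) by (simp only: norm_mult norm_of_real abs_of_nonneg)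
    show "norm (iexp (p * x) * of_real R) \<le> ?v\<^sup>2 / 2" using R by (simp add: norm_mult)
    show "norm Q \<le> p * (?y ^ 3 / 6)" by (rule Q)
    show "norm (of_real ?v * (iexp (p * x) - 1)) \<le> ?v * (p * ?y)"
      using mult_left_mono[OF E v(1)] v(1) by (simp only: norm_mult norm_of_real abs_of_nonneg)
  qed
  also have "\<dots> \<le> p * (?y ^ 3 / 6) + p * (?y ^ 4 / 8) + p * (?y ^ 3 / 6) + p * (?y ^ 3 / 2)"
  proof (intro add_mono order_refl)
    have "?v\<^sup>2 \<le> (p * (x\<^sup>2 / 2))\<^sup>2" using v by (intro power_mono) auto
    also have "\<dots> = p\<^sup>2 * (x ^ 4 / 4)" by (simp add: power_mult_distrib power_divide flip: power_mult)
    also have "\<dots> \<le> p * (x ^ 4 / 4)"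
      using p by (intro mult_right_mono) (auto simp: power2_eq_square mult_left_le)
    finally show "?v\<^sup>2 / 2 \<le> p * (?y ^ 4 / 8)" by simp
    have "?v * (p * ?y) \<le> (p * (x\<^sup>2 / 2)) * (1 * ?y)" using v p by (intro mult_mono) auto
    also have "\<dots> = p * (?y ^ 3 / 2)"
    proof -
      have "x\<^sup>2 = ?y * ?y" by (simp add: power2_eq_square)
      then show ?thesis
        by (simp only: power3_eq_cube mult_1 times_divide_eq_right times_divide_eq_left mult.assoc)
    qed
    finally show "?v * (p * ?y) \<le> p * (?y ^ 3 / 2)" .
  qed
  also have "\<dots> = p * (?y ^ 3 / 6 + ?y ^ 4 / 8 + ?y ^ 3 / 6 + ?y ^ 3 / 2)" by (simp add: algebra_simps)
  also have "\<dots> \<le> p * (?y ^ 3 + ?y ^ 6)"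
  proof (rule mult_left_mono[OF _ p(1)])
    have "?y ^ 4 \<le> ?y ^ 3 + ?y ^ 6"
    proof (cases "?y \<le> 1")
      case True
      then have "?y ^ 4 \<le> ?y ^ 3" by (intro power_decreasing) auto
      then show ?thesis by (simp add: add_increasing2)
    next
      case False
      then have "?y ^ 4 \<le> ?y ^ 6" by (intro power_increasing) auto
      then show ?thesis by (simp add: add_increasing)
    qed
    moreover have "?y ^ 3 \<ge> 0" "?y ^ 4 \<ge> 0" "?y ^ 6 \<ge> 0" by auto
    ultimately show "?y ^ 3 / 6 + ?y ^ 4 / 8 + ?y ^ 3 / 6 + ?y ^ 3 / 2 \<le> ?y ^ 3 + ?y ^ 6" by linarith
  qed
  finally show ?thesis by simp
qed

text \<open>Bounding \<open>u^j\<close> by \<open>j! * 2^j * exp (u / 2)\<close> leaves a geometric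
  series of ratio \<open>exp (- t / 2)\<close>, whose sum is at most \<open>2 / t\<close>.\<close>

lemma sum_fermi_power_le:
  assumes t: "t > 0"
  shows "(\<Sum>k=1..n. fermi (real k * t) * real k ^ j) \<le> 2 * fact j * 2 ^ j / t ^ Suc j"
proof -
  let ?q = "exp (- t / 2)"
  have step: "fermi (real k * t) * real k ^ j \<le> fact j * 2 ^ j / t ^ j * ?q ^ k" for k
  proof -
    let ?u = "real k * t"
    have u: "?u \<ge> 0" using t by simp
    have "(?u / 2) ^ j / fact j \<le> exp (?u / 2)" using u by (intro power_div_fact_le_exp) auto
    then have "?u ^ j \<le> fact j * 2 ^ j * exp (?u / 2)" by (simp add: power_divide field_simps)
    then have "fermi ?u * ?u ^ j \<le> exp (- ?u) * (fact j * 2 ^ j * exp (?u / 2))"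
      using fermi_le_exp[of ?u] fermi_pos[of ?u] u by (intro mult_mono) auto
    also have "\<dots> = fact j * 2 ^ j * (exp (- ?u) * exp (?u / 2))" by simp
    also have "exp (- ?u) * exp (?u / 2) = ?q ^ k" by (simp flip: exp_add exp_of_nat_mult)
    finally have "fermi ?u * real k ^ j * t ^ j \<le> fact j * 2 ^ j * ?q ^ k"
      by (simp add: power_mult_distrib mult.assoc)
    then show ?thesis using t by (simp add: field_simps)
  qed
  have "(\<Sum>k=1..n. ?q ^ k) \<le> 2 / t"
  proof -
    have q: "0 < ?q" "?q < 1" using t by auto
    have "(\<Sum>k=1..n. ?q ^ k) = ?q * (\<Sum>k<n. ?q ^ k)"
      by (simp add: sum_distrib_left sum.atLeast1_atMost_eq)
    also have "\<dots> \<le> ?q * (1 / (1 - ?q))"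
      using q by (intro mult_left_mono) (auto simp: sum_gp_strict intro!: divide_right_mono)
    also have "\<dots> = 1 / (exp (t / 2) - 1)" using q t by (simp add: exp_minus field_simps)
    also have "\<dots> \<le> 1 / (t / 2)"
    proof -
      have "t / 2 \<le> exp (t / 2) - 1" using exp_ge_add_one_self[of "t / 2"] by linarith
      then show ?thesis using t by (intro divide_left_mono mult_pos_pos) linarith+
    qed
    finally show ?thesis by simp
  qed
  then have "fact j * 2 ^ j / t ^ j * (\<Sum>k=1..n. ?q ^ k) \<le> fact j * 2 ^ j / t ^ j * (2 / t)"
    using t by (intro mult_left_mono) auto
  moreover have "(\<Sum>k=1..n. fermi (real k * t) * real k ^ j) \<le> (\<Sum>k=1..n. fact j * 2 ^ j / t ^ j * ?q ^ k)"
    by (intro sum_mono step)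
  ultimately show ?thesis by (simp add: sum_distrib_left mult_ac)
qed

text \<open>All factors have norm at most 1, so the products differ by at most the sum of the
  differences of the factors. The coefficients are \<open>2 * 3! * 2^3\<close> and
  \<open>2 * 6! * 2^6\<close>; the powers of \<open>t\<close> are \<open>s^3 / t^4\<close> and
  \<open>s^6 / t^7\<close>.\<close>

lemma dist_char_gaussian_approx:
  assumes t: "t > 0"
  defines "s \<equiv> sqrt t ^ 3"
  shows "norm (dist_char n t (s * w) -
      iexp (s * w * (\<Sum>k=1..n. real k * fermi (real k * t))) *
      of_real (exp (- (w\<^sup>2 / 2 * (t ^ 3 * (\<Sum>k=1..n. (real k)\<^sup>2 * (fermi (real k * t) * (1 - fermi (real k * t)))))))))
    \<le> 96 * \<bar>w\<bar> ^ 3 * sqrt t + 92160 * w ^ 6 * t\<^sup>2"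
proof -
  let ?p = "\<lambda>k. fermi (real k * t)" and ?x = "\<lambda>k. real k * (s * w)"
  let ?a = "\<lambda>k. 1 - of_real (?p k) + of_real (?p k) * iexp (?x k)"
  let ?b = "\<lambda>k. iexp (?p k * ?x k) * of_real (exp (- (?p k * (1 - ?p k) * (?x k)\<^sup>2 / 2)))"
  have p: "0 \<le> ?p k" "?p k \<le> 1" for k using fermi_pos fermi_less_1 by (simp_all add: less_imp_le)
  have s: "s \<ge> 0" using t by (simp add: s_def)
  have s2: "s\<^sup>2 = t ^ 3"
  proof -
    have "(sqrt t ^ 3)\<^sup>2 = (sqrt t * sqrt t) ^ 3" by (simp only: power2_eq_square power3_eq_cube mult_ac)
    then show ?thesis using t by (simp add: s_def)
  qed
  have prodb: "(\<Prod>k=1..n. ?b k) = iexp (s * w * (\<Sum>k=1..n. real k * ?p k)) *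
      of_real (exp (- (w\<^sup>2 / 2 * (t ^ 3 * (\<Sum>k=1..n. (real k)\<^sup>2 * (?p k * (1 - ?p k)))))))"
  proof -
    have "(\<Prod>k=1..n. iexp (?p k * ?x k)) = exp (\<Sum>k=1..n. \<i> * of_real (?p k * ?x k))"
      by (simp add: exp_sum)
    also have "(\<Sum>k=1..n. \<i> * complex_of_real (?p k * ?x k)) = \<i> * of_real (s * w * (\<Sum>k=1..n. real k * ?p k))"
      by (simp add: sum_distrib_left mult_ac)
    finally have 1: "(\<Prod>k=1..n. iexp (?p k * ?x k)) = iexp (s * w * (\<Sum>k=1..n. real k * ?p k))" .
    have "(\<Prod>k=1..n. exp (- (?p k * (1 - ?p k) * (?x k)\<^sup>2 / 2))) = exp (\<Sum>k=1..n. - (?p k * (1 - ?p k) * (?x k)\<^sup>2 / 2))"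
      by (simp add: exp_sum)
    also have "(\<Sum>k=1..n. - (?p k * (1 - ?p k) * (?x k)\<^sup>2 / 2)) = - (w\<^sup>2 / 2 * (t ^ 3 * (\<Sum>k=1..n. (real k)\<^sup>2 * (?p k * (1 - ?p k)))))"
      by (simp add: sum_distrib_left sum_negf[symmetric] power_mult_distrib s2 mult_ac)
    finally have 2: "(\<Prod>k=1..n. exp (- (?p k * (1 - ?p k) * (?x k)\<^sup>2 / 2))) =
        exp (- (w\<^sup>2 / 2 * (t ^ 3 * (\<Sum>k=1..n. (real k)\<^sup>2 * (?p k * (1 - ?p k))))))" .
    show ?thesis unfolding prod.distrib 1 of_real_prod[symmetric] 2 ..
  qed
  have "norm ((\<Prod>k=1..n. ?a k) - (\<Prod>k=1..n. ?b k)) \<le> (\<Sum>k=1..n. norm (?a k - ?b k))"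
  proof (rule norm_prod_diff)
    fix k
    have "norm (?a k) \<le> exp (- (?p k * (1 - ?p k) * (1 - cos (?x k))))" using p by (intro norm_bernoulli_char_le)
    also have "\<dots> \<le> 1" using p[of k] by simp
    finally show "norm (?a k) \<le> 1" .
    show "norm (?b k) \<le> 1" using p[of k] by (simp add: norm_mult)
  qed
  also have "\<dots> \<le> (\<Sum>k=1..n. ?p k * (\<bar>?x k\<bar> ^ 3 + ?x k ^ 6))"
    using p by (intro sum_mono bernoulli_char_approx)
  also have "\<dots> = (s * \<bar>w\<bar>) ^ 3 * (\<Sum>k=1..n. ?p k * real k ^ 3) + (s * w) ^ 6 * (\<Sum>k=1..n. ?p k * real k ^ 6)"
    using s by (simp add: sum_distrib_left sum.distrib[symmetric] abs_mult power_mult_distrib algebra_simps)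
  also have "\<dots> \<le> (s * \<bar>w\<bar>) ^ 3 * (2 * fact 3 * 2 ^ 3 / t ^ Suc 3) + (s * w) ^ 6 * (2 * fact 6 * 2 ^ 6 / t ^ Suc 6)"
    using s by (intro add_mono mult_left_mono sum_fermi_power_le t) auto
  also have "(s * \<bar>w\<bar>) ^ 3 * (2 * fact 3 * 2 ^ 3 / t ^ Suc 3) = 96 * \<bar>w\<bar> ^ 3 * sqrt t"
  proof -
    have "s ^ 3 = s\<^sup>2 * s" by (simp add: power2_eq_square power3_eq_cube)
    also have "\<dots> = t ^ 3 * (sqrt t * sqrt t * sqrt t)" unfolding s2 by (simp add: s_def power3_eq_cube)
    also have "\<dots> = t ^ Suc 3 * sqrt t" using t by (simp only: real_sqrt_mult_self abs_of_pos power_Suc mult_ac)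
    finally have "s ^ 3 = t ^ Suc 3 * sqrt t" .
    then show ?thesis using t by (simp add: power_mult_distrib fact_numeral)
  qed
  also have "(s * w) ^ 6 * (2 * fact 6 * 2 ^ 6 / t ^ Suc 6) = 92160 * w ^ 6 * t\<^sup>2"
  proof -
    have "s ^ 6 = (s\<^sup>2) ^ 3" by (simp flip: power_mult)
    also have "\<dots> = t ^ Suc 6 * t\<^sup>2" unfolding s2 by (simp flip: power_mult power_add)
    finally have s6: "s ^ 6 = t ^ Suc 6 * t\<^sup>2" .
    have "T * U * W * (2 * fact 6 * 2 ^ 6 / T) = 92160 * W * U" if "T \<noteq> 0" for T U W :: real
      using that by (simp add: fact_numeral)
    from this[of "t ^ Suc 6" "t\<^sup>2" "w ^ 6"] t show ?thesis
      by (simp only: power_mult_distrib s6) simp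
  qed
  finally show ?thesis unfolding prodb dist_char_def .
qed

section \<open>Passage to the limit under the Fourier integral\<close>

definition rescaled_char :: "nat \<Rightarrow> real \<Rightarrow> complex" where
  "rescaled_char n w = (let x = sqrt (saddle n) ^ 3 * w in
    indicator {- pi..pi} x *\<^sub>R (dist_char n (saddle n) x * iexp (- (real n * x))))"

text \<open>The phase of the Gaussian approximation combines with the inversion factor to
  \<open>w * s n * (M n - n)\<close>, which tends to 0 by the choice of the saddle point; the
  variance supplies the limit.\<close>

lemma rescaled_char_tendsto:
  "(\<lambda>n. rescaled_char n w) \<longlonglongrightarrow> complex_of_real (exp (- (w\<^sup>2 / 2 * (pi\<^sup>2 / 6))))"
proof -
  define s where "s = (\<lambda>n. sqrt (saddle n) ^ 3)"
  define M where "M = (\<lambda>n. \<Sum>k=1..n. real k * fermi (real k * saddle n))"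
  define V where "V = (\<lambda>n. saddle n ^ 3 * (\<Sum>k=1..n. (real k)\<^sup>2 * (fermi (real k * saddle n) * (1 - fermi (real k * saddle n)))))"
  define B where "B = (\<lambda>n. iexp (s n * w * M n) * complex_of_real (exp (- (w\<^sup>2 / 2 * V n))))"
  have s0: "s \<longlonglongrightarrow> 0"
    unfolding s_def using tendsto_power[OF saddle_limits(2), of 3] by simp
  have "(\<lambda>n. 96 * \<bar>w\<bar> ^ 3 * sqrt (saddle n) + 92160 * w ^ 6 * (saddle n)\<^sup>2) \<longlonglongrightarrow> 96 * \<bar>w\<bar> ^ 3 * 0 + 92160 * w ^ 6 * 0\<^sup>2"
    by (intro tendsto_intros saddle_limits)
  then have e0: "(\<lambda>n. 96 * \<bar>w\<bar> ^ 3 * sqrt (saddle n) + 92160 * w ^ 6 * (saddle n)\<^sup>2) \<longlonglongrightarrow> 0" by simp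
  have "(\<lambda>n. (dist_char n (saddle n) (s n * w) - B n) * iexp (- (real n * (s n * w)))) \<longlonglongrightarrow> 0"
  proof (rule Lim_null_comparison[OF _ e0])
    show "\<forall>\<^sub>F n in sequentially. norm ((dist_char n (saddle n) (s n * w) - B n) * iexp (- (real n * (s n * w))))
        \<le> 96 * \<bar>w\<bar> ^ 3 * sqrt (saddle n) + 92160 * w ^ 6 * (saddle n)\<^sup>2"
      using eventually_gt_at_top[of 0]
    proof eventually_elim
      case (elim n)
      show ?case
        using dist_char_gaussian_approx[OF saddle_pos[OF elim], of n w]
        unfolding B_def s_def M_def V_def norm_mult norm_exp_i_times mult_1_right .
    qed
  qed
  moreover have "(\<lambda>n. B n * iexp (- (real n * (s n * w)))) \<longlonglongrightarrow> iexp (w * 0) * complex_of_real (exp (- (w\<^sup>2 / 2 * (pi\<^sup>2 / 6))))"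
  proof -
    have "B n * iexp (- (real n * (s n * w))) = iexp (w * (s n * (M n - real n))) * complex_of_real (exp (- (w\<^sup>2 / 2 * V n)))" for n
      by (simp add: B_def exp_add[symmetric] algebra_simps)
    moreover have "(\<lambda>n. iexp (w * (s n * (M n - real n))) * complex_of_real (exp (- (w\<^sup>2 / 2 * V n))))
        \<longlonglongrightarrow> iexp (w * 0) * complex_of_real (exp (- (w\<^sup>2 / 2 * (pi\<^sup>2 / 6))))"
      using tendsto_sum_mean tendsto_sum_variance unfolding s_def M_def V_def by (intro tendsto_intros)
    ultimately show ?thesis by (simp only:)
  qed
  ultimately have "(\<lambda>n. (dist_char n (saddle n) (s n * w) - B n) * iexp (- (real n * (s n * w))) + B n * iexp (- (real n * (s n * w))))
      \<longlonglongrightarrow> 0 + iexp (w * 0) * complex_of_real (exp (- (w\<^sup>2 / 2 * (pi\<^sup>2 / 6))))"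
    by (rule tendsto_add)
  then have lim: "(\<lambda>n. dist_char n (saddle n) (s n * w) * iexp (- (real n * (s n * w)))) \<longlonglongrightarrow> complex_of_real (exp (- (w\<^sup>2 / 2 * (pi\<^sup>2 / 6))))"
    by (simp add: left_diff_distrib)
  \<comment> \<open>For fixed \<open>w\<close> the argument shrinks to 0, so the indicator in
    \<open>rescaled_char\<close> is eventually 1.\<close>
  have "(\<lambda>n. \<bar>s n * w\<bar>) \<longlonglongrightarrow> \<bar>0 * w\<bar>" by (intro tendsto_intros s0)
  then have "\<forall>\<^sub>F n in sequentially. \<bar>s n * w\<bar> < pi" by (rule order_tendstoD) simp
  then have "\<forall>\<^sub>F n in sequentially. rescaled_char n w = dist_char n (saddle n) (s n * w) * iexp (- (real n * (s n * w)))"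
    by eventually_elim (auto simp: rescaled_char_def s_def Let_def indicator_def abs_less_iff)
  with lim show ?thesis by (simp add: tendsto_cong)
qed

lemma continuous_dist_char: "continuous_on S (dist_char n t)"
  unfolding dist_char_def[abs_def] by (intro continuous_intros)

lemma borel_measurable_dist_char [measurable]: "dist_char n t \<in> borel_measurable borel"
  by (rule borel_measurable_continuous_onI[OF continuous_dist_char])

lemma borel_measurable_rescaled_char [measurable]: "rescaled_char n \<in> borel_measurable borel"
  unfolding rescaled_char_def[abs_def] Let_def by measurable

lemma integrable_lorentzian: "integrable lborel (\<lambda>w::real. C / (1 + w\<^sup>2))"
proof -
  have "integrable lborel (\<lambda>w::real. inverse (1 + w\<^sup>2))"
    using integrable_inverse_1_plus_square by (simp add: set_integrable_def)
  then have "integrable lborel (\<lambda>w::real. C * inverse (1 + w\<^sup>2))" by (rule integrable_mult_right)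
  then show ?thesis by (simp add: divide_inverse)
qed

lemma integral_gaussian:
  "(\<integral>w. exp (- (w\<^sup>2 / 2 * (pi\<^sup>2 / 6))) \<partial>lborel) = sqrt (12 / pi)"
proof -
  \<comment> \<open>The standard deviation with \<open>1 / \<sigma>^2 = pi^2 / 6\<close>, to match
    the limiting exponent.\<close>
  let ?\<sigma> = "sqrt 6 / pi"
  have "2 * pi * ?\<sigma>\<^sup>2 = 12 / pi" by (simp add: power_divide power2_eq_square)
  then have "normal_density 0 ?\<sigma> w = 1 / sqrt (12 / pi) * exp (- (w\<^sup>2 / 2 * (pi\<^sup>2 / 6)))" for w
    by (simp add: normal_density_def power_divide)
  then have "(\<integral>w. 1 / sqrt (12 / pi) * exp (- (w\<^sup>2 / 2 * (pi\<^sup>2 / 6))) \<partial>lborel) = (\<integral>w. normal_density 0 ?\<sigma> w \<partial>lborel)"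
    by (simp only:)
  also have "\<dots> = 1" by (rule integral_normal_density) simp
  finally have "1 / sqrt (12 / pi) * (\<integral>w. exp (- (w\<^sup>2 / 2 * (pi\<^sup>2 / 6))) \<partial>lborel) = 1"
    by (subst (asm) integral_mult_right_zero)
  then show ?thesis by (simp add: field_simps)
qed

lemma integral_rescaled_char_tendsto:
  "(\<lambda>n. \<integral>w. rescaled_char n w \<partial>lborel) \<longlonglongrightarrow> complex_of_real (sqrt (12 / pi))"
proof -
  \<comment> \<open>From \<open>N\<close> on the uniform decay bound applies and its factor
    \<open>exp (exp (- n t) / t)\<close> is at most \<open>exp 1\<close>, which makes the majorant
    independent of \<open>n\<close>. The limit is therefore taken along
    \<open>n + N\<close>.\<close>
  have "\<forall>\<^sub>F n in sequentially. saddle n < 1 \<and> exp (- (real n * saddle n)) / saddle n < 1 \<and> n > 0"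
    by (intro eventually_conj order_tendstoD(2)[OF saddle_limits(1)] order_tendstoD(2)[OF saddle_limits(6)]
      eventually_gt_at_top zero_less_one)
  then obtain N where N: "\<And>n. n \<ge> N \<Longrightarrow> saddle n < 1 \<and> exp (- (real n * saddle n)) / saddle n < 1 \<and> n > 0"
    unfolding eventually_sequentially by blast
  let ?C = "16 * 384 * 54 ^ 3 * exp 1 :: real"
  have bound: "norm (rescaled_char n w) \<le> ?C / (1 + w\<^sup>2)" if "n \<ge> N" for n w
  proof (cases "\<bar>sqrt (saddle n) ^ 3 * w\<bar> \<le> pi")
    case True
    have "norm (rescaled_char n w) \<le> norm (dist_char n (saddle n) (sqrt (saddle n) ^ 3 * w))"
      by (auto simp: rescaled_char_def Let_def norm_mult indicator_def)
    also have "\<dots> \<le> (16 * 384 * 54 ^ 3) * exp (exp (- (real n * saddle n)) / saddle n) / (1 + w\<^sup>2)"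
      using N[OF that] by (intro norm_dist_char_rescaled_le True saddle_pos) auto
    also have "\<dots> \<le> ?C / (1 + w\<^sup>2)"
      using N[OF that] by (intro divide_right_mono mult_left_mono) auto
    finally show ?thesis .
  next
    case False
    then have "rescaled_char n w = 0" by (auto simp: rescaled_char_def Let_def indicator_def abs_le_iff)
    then show ?thesis by simp
  qed
  have "(\<lambda>n. \<integral>w. rescaled_char (n + N) w \<partial>lborel) \<longlonglongrightarrow> (\<integral>w. complex_of_real (exp (- (w\<^sup>2 / 2 * (pi\<^sup>2 / 6)))) \<partial>lborel)"
  proof (rule integral_dominated_convergence)
    show "integrable lborel (\<lambda>w::real. ?C / (1 + w\<^sup>2))" by (rule integrable_lorentzian)
    show "AE w in lborel. (\<lambda>n. rescaled_char (n + N) w) \<longlonglongrightarrow> complex_of_real (exp (- (w\<^sup>2 / 2 * (pi\<^sup>2 / 6))))"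
      by (intro AE_I2 LIMSEQ_ignore_initial_segment rescaled_char_tendsto)
    show "AE w in lborel. norm (rescaled_char (n + N) w) \<le> ?C / (1 + w\<^sup>2)" for n
      by (intro AE_I2 bound) simp
  qed measurable
  then have "(\<lambda>n. \<integral>w. rescaled_char (n + N) w \<partial>lborel) \<longlonglongrightarrow> complex_of_real (sqrt (12 / pi))"
    by (simp only: integral_complex_of_real integral_gaussian)
  then show ?thesis by (rule LIMSEQ_offset)
qed

lemma odd_count_eq_rescaled:
  assumes "n > 0"
  shows "complex_of_real (real_of_int (odd_count (int n))) =
    of_real (exp (saddle n * real n) * (\<Prod>k=1..n. 1 + exp (- (real k * saddle n))) / (2 * pi) * sqrt (saddle n) ^ 3) *
    (\<integral>w. rescaled_char n w \<partial>lborel)"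
proof -
  let ?s = "sqrt (saddle n) ^ 3"
  have s: "?s > 0" using saddle_pos[OF assms] by simp
  have "(\<integral>x. indicator {- pi..pi} x *\<^sub>R (dist_char n (saddle n) x * iexp (- (real n * x))) \<partial>lborel) =
      \<bar>?s\<bar> *\<^sub>R (\<integral>w. indicator {- pi..pi} (0 + ?s * w) *\<^sub>R (dist_char n (saddle n) (0 + ?s * w) * iexp (- (real n * (0 + ?s * w)))) \<partial>lborel)"
    using s by (intro lborel_integral_real_affine) simp
  also have "\<dots> = of_real ?s * (\<integral>w. rescaled_char n w \<partial>lborel)"
    using s by (simp add: rescaled_char_def Let_def scaleR_conv_of_real)
  finally show ?thesis
    unfolding odd_count_fourier[of n "saddle n"] by (simp only: of_real_mult mult.assoc)
qed

text \<open>Of the limit, \<open>exp (- (ln 2 / 2))\<close> is the trapezoid correction,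
  \<open>sqrt c ^ 3\<close> together with \<open>n powr (- 3/4)\<close> the Jacobian
  \<open>t^(3/2)\<close>, and \<open>sqrt (12 / pi)\<close> the Gaussian integral.\<close>

lemma odd_count_asymptotic:
  "(\<lambda>n. real_of_int (odd_count (int n)) / (real n powr (- 3/4) * exp (pi * sqrt (real n / 3))))
    \<longlonglongrightarrow> 1 / (4 * sqrt (sqrt 3))"
proof -
  define c where "c = pi / (2 * sqrt 3)"
  have c: "c > 0" by (simp add: c_def)
  define D where "D = (\<lambda>n. (\<Sum>k=1..n. ln (1 + exp (- (real k * saddle n)))) - pi\<^sup>2 / (12 * saddle n))"
  define J where "J = (\<lambda>n. Re (\<integral>w. rescaled_char n w \<partial>lborel))"
  have J: "J \<longlonglongrightarrow> sqrt (12 / pi)"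
    unfolding J_def using tendsto_Re[OF integral_rescaled_char_tendsto] by simp
  have D: "D \<longlonglongrightarrow> - (ln 2 / 2)" unfolding D_def by (rule tendsto_sum_ln)
  have main: "real_of_int (odd_count (int n)) / (real n powr (- 3/4) * exp (pi * sqrt (real n / 3))) =
      exp (D n) / (2 * pi) * sqrt c ^ 3 * J n" if "n > 0" for n
  proof -
    let ?t = "saddle n"
    have t: "?t > 0" using that by (rule saddle_pos)
    have "real_of_int (odd_count (int n)) = Re (complex_of_real (real_of_int (odd_count (int n))))" by simp
    also have "\<dots> = exp (?t * real n) * (\<Prod>k=1..n. 1 + exp (- (real k * ?t))) / (2 * pi) * sqrt ?t ^ 3 * J n"
      unfolding odd_count_eq_rescaled[OF that] J_def by (simp only: Re_complex_of_real times_complex.sel Im_complex_of_real mult_zero_left diff_zero)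
    also have "exp (?t * real n) * (\<Prod>k=1..n. 1 + exp (- (real k * ?t))) = exp (D n) * exp (pi * sqrt (real n / 3))"
    proof -
      have "(\<Prod>k=1..n. 1 + exp (- (real k * ?t))) = exp (\<Sum>k=1..n. ln (1 + exp (- (real k * ?t))))"
        by (simp add: exp_sum)
      \<comment> \<open>At the saddle point the two summands are equal, each half of the
        exponent.\<close>
      moreover have "?t * real n + pi\<^sup>2 / (12 * ?t) = pi * sqrt (real n / 3)"
      proof -
        have sq: "sqrt 3 * sqrt 3 = (3::real)" "sqrt (real n) * sqrt (real n) = real n" by simp_all
        have "?t * real n = pi * sqrt (real n) / (2 * sqrt 3)"
          using that sq by (simp add: saddle_def field_simps)
        moreover have "pi\<^sup>2 / (12 * ?t) = pi * sqrt (real n) / (2 * sqrt 3)"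
          using that sq by (simp add: saddle_def field_simps power2_eq_square)
        ultimately show ?thesis by (simp add: real_sqrt_divide)
      qed
      ultimately show ?thesis by (simp add: D_def exp_add[symmetric] algebra_simps)
    qed
    also have "sqrt ?t ^ 3 = sqrt c ^ 3 * real n powr (- 3/4)"
    proof -
      have "real n powr (- 3/4) = (real n powr (- 1/4)) ^ 3"
        using that by (simp add: powr_power)
      also have "real n powr (- 1/4) = inverse (sqrt (sqrt (real n)))"
        using that by (simp add: powr_half_sqrt[symmetric] powr_powr powr_minus[symmetric])
      finally have "real n powr (- 3/4) = inverse (sqrt (sqrt (real n))) ^ 3" .
      moreover have "?t = c / sqrt (real n)" by (simp add: saddle_def c_def)
      then have "sqrt ?t = sqrt c * inverse (sqrt (sqrt (real n)))"
        by (simp only: divide_inverse real_sqrt_mult real_sqrt_inverse)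
      ultimately show ?thesis by (simp only: power_mult_distrib)
    qed
    finally show ?thesis using that by (simp add: field_simps)
  qed
  have ev: "\<forall>\<^sub>F n in sequentially. exp (D n) / (2 * pi) * sqrt c ^ 3 * J n =
      real_of_int (odd_count (int n)) / (real n powr (- 3/4) * exp (pi * sqrt (real n / 3)))"
    using eventually_gt_at_top[of 0] by eventually_elim (simp only: main)
  have "(\<lambda>n. exp (D n) / (2 * pi) * sqrt c ^ 3 * J n) \<longlonglongrightarrow> exp (- (ln 2 / 2)) / (2 * pi) * sqrt c ^ 3 * sqrt (12 / pi)"
    by (intro tendsto_intros D J) simp
  also have "exp (- (ln 2 / 2)) / (2 * pi) * sqrt c ^ 3 * sqrt (12 / pi) = 1 / (4 * sqrt (sqrt 3))"
  \<comment> \<open>Squaring removes the nested roots; both sides are nonnegative.\<close>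
  proof (rule power2_eq_imp_eq)
    have "(exp (- (ln 2 / 2)))\<^sup>2 = exp (- ln 2 :: real)" by (simp add: power2_eq_square flip: exp_add)
    also have "\<dots> = 1 / 2" by (simp add: exp_minus)
    finally have e: "(exp (- (ln 2 / 2)))\<^sup>2 = (1 / 2 :: real)" .
    have "(sqrt c ^ 3)\<^sup>2 = (sqrt c * sqrt c) ^ 3" by (simp only: power2_eq_square power3_eq_cube mult_ac)
    then have c3: "(sqrt c ^ 3)\<^sup>2 = c ^ 3" using c by simp
    have "sqrt 3 ^ 3 = 3 * sqrt (3::real)" by (simp add: power3_eq_cube)
    then have c': "c ^ 3 = pi ^ 3 / (24 * sqrt 3)" by (simp add: c_def power_divide power_mult_distrib)
    have "(A / (2 * pi) * B * S)\<^sup>2 = A\<^sup>2 / (4 * pi\<^sup>2) * B\<^sup>2 * S\<^sup>2" for A B S :: real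
      by (simp add: power_mult_distrib power_divide)
    then have "(exp (- (ln 2 / 2)) / (2 * pi) * sqrt c ^ 3 * sqrt (12 / pi))\<^sup>2 =
        1 / 2 / (4 * pi\<^sup>2) * (pi ^ 3 / (24 * sqrt 3)) * (sqrt (12 / pi))\<^sup>2"
      by (simp only: e c3 c')
    also have "\<dots> = (1 / (4 * sqrt (sqrt 3)))\<^sup>2"
      by (simp add: power_divide power_mult_distrib power2_eq_square power3_eq_cube)
    finally show "(exp (- (ln 2 / 2)) / (2 * pi) * sqrt c ^ 3 * sqrt (12 / pi))\<^sup>2 = (1 / (4 * sqrt (sqrt 3)))\<^sup>2" .
  qed (use c in auto)
  finally show ?thesis using tendsto_cong[OF ev] by simp
qed

section \<open>Sums along arithmetic progressions\<close>

text \<open>Stolz-Cesaro with increments over \<open>q\<close> indices, treating all residue classes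
  modulo \<open>q\<close> at once.\<close>

lemma stolz_cesaro_step:
  fixes U g :: "nat \<Rightarrow> real"
  assumes q: "q > 0"
    and inc: "\<forall>\<^sub>F n in sequentially. g n < g (n + q)"
    and lim: "(\<lambda>n. (U (n + q) - U n) / (g (n + q) - g n)) \<longlonglongrightarrow> L"
    and inf: "filterlim g at_top sequentially"
  shows "(\<lambda>n. U n / g n) \<longlonglongrightarrow> L"
proof (rule tendstoI)
  fix \<epsilon> :: real assume \<epsilon>: "\<epsilon> > 0"
  have "\<forall>\<^sub>F n in sequentially. dist ((U (n + q) - U n) / (g (n + q) - g n)) L < \<epsilon> / 2"
    using \<epsilon> by (intro tendstoD[OF lim]) simp
  then have "\<forall>\<^sub>F n in sequentially. g n < g (n + q) \<and> dist ((U (n + q) - U n) / (g (n + q) - g n)) L < \<epsilon> / 2"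
    using inc by eventually_elim simp
  then obtain M where M: "\<And>n. n \<ge> M \<Longrightarrow> g n < g (n + q) \<and> dist ((U (n + q) - U n) / (g (n + q) - g n)) L < \<epsilon> / 2"
    unfolding eventually_sequentially by blast
  \<comment> \<open>The excess of the error over half the tolerance does not increase along steps of
    \<open>q\<close>.\<close>
  define \<Phi> where "\<Phi> = (\<lambda>n. \<bar>U n - L * g n\<bar> - \<epsilon> / 2 * g n)"
  have step: "\<Phi> (n + q) \<le> \<Phi> n" if "n \<ge> M" for n
  proof -
    let ?d = "g (n + q) - g n"
    have d: "?d > 0" using M[OF that] by simp
    have "x - L * d = (x / d - L) * d" if "d > 0" for x d
      using that by (simp add: left_diff_distrib)
    from this[OF d, of "U (n + q) - U n"] have "\<bar>(U (n + q) - U n) - L * ?d\<bar> = \<bar>(U (n + q) - U n) / ?d - L\<bar> * ?d"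
      using d by (simp only: abs_mult abs_of_pos)
    also have "\<dots> \<le> \<epsilon> / 2 * ?d"
      using M[OF that] d by (intro mult_right_mono) (auto simp: dist_real_def)
    finally have "\<bar>(U (n + q) - U n) - L * ?d\<bar> \<le> \<epsilon> / 2 * ?d" .
    moreover have "U (n + q) - L * g (n + q) = (U n - L * g n) + ((U (n + q) - U n) - L * ?d)"
      by (simp add: algebra_simps)
    moreover have "\<epsilon> / 2 * ?d = \<epsilon> / 2 * g (n + q) - \<epsilon> / 2 * g n" by (simp add: algebra_simps)
    ultimately show ?thesis unfolding \<Phi>_def by linarith
  qed
  \<comment> \<open>Every \<open>n \<ge> M\<close> descends by steps of \<open>q\<close> into this
    block of \<open>q\<close> consecutive indices, so its maximum bounds \<open>\<Phi>\<close>
    throughout; it becomes negligible as \<open>g\<close> tends to infinity.\<close>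
  define C where "C = Max (\<Phi> ` {M..<M + q})"
  have C: "\<Phi> n \<le> C" if "n \<ge> M" for n
    using that
  proof (induction n rule: less_induct)
    case (less n)
    show ?case
    proof (cases "n < M + q")
      case True
      then show ?thesis using less.prems unfolding C_def by (intro Max_ge) auto
    next
      case False
      then have "\<Phi> (n - q) \<le> C" using q by (intro less.IH) auto
      moreover have "\<Phi> n \<le> \<Phi> (n - q)" using step[of "n - q"] False by simp
      ultimately show ?thesis by linarith
    qed
  qed
  have "\<forall>\<^sub>F n in sequentially. g n > max 0 (2 * C / \<epsilon>)"
    using inf by (rule filterlim_at_top_dense[THEN iffD1, rule_format])
  then show "\<forall>\<^sub>F n in sequentially. dist (U n / g n) L < \<epsilon>"
    using eventually_ge_at_top[of M]
  proof eventually_elim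
    case (elim n)
    then have g: "g n > 0" and "2 * C / \<epsilon> < g n" by auto
    then have "C < \<epsilon> / 2 * g n" using \<epsilon> by (simp add: field_simps)
    then have "\<bar>U n - L * g n\<bar> < \<epsilon> * g n" using C[OF elim(2)] unfolding \<Phi>_def by linarith
    moreover have "U n / g n - L = (U n - L * g n) / g n" using g by (simp add: field_simps)
    ultimately show ?case using g by (simp add: dist_real_def pos_divide_less_eq)
  qed
qed

definition growth :: "nat \<Rightarrow> real" where
  "growth n = real n powr (- 1/4) * exp (pi * sqrt (real n / 3))"

text \<open>The exponent has derivative \<open>pi / (2 sqrt 3)\<close> times
  \<open>n^(-1/2)\<close>, which turns the power \<open>-1/4\<close> into the \<open>-3/4\<close> of
  \<open>odd_count_asymptotic\<close>. The last limit says that bounded shifts of \<open>n\<close>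
  do not affect the leading order.\<close>

lemma growth_limits:
  fixes q :: nat and D :: int
  assumes "q > 0"
  shows "filterlim growth at_top sequentially"
    and "(\<lambda>n. (growth (n + q) - growth n) / (real (n + q) powr (- 3/4) * exp (pi * sqrt (real (n + q) / 3))))
      \<longlonglongrightarrow> real q * (pi / (2 * sqrt 3))"
    and "\<forall>\<^sub>F n in sequentially. growth n < growth (n + q)"
    and "(\<lambda>n. growth (nat (int n + D)) / growth n) \<longlonglongrightarrow> 1"
proof -
  define b where "b = pi / sqrt 3"
  have b: "b > 0" by (simp add: b_def)
  have sqrt3: "pi * sqrt (x / 3) = b * sqrt x" for x by (simp add: b_def real_sqrt_divide)
  define Q where "Q = real q"
  have Q: "Q > 0" using assms by (simp add: Q_def)
  show "filterlim growth at_top sequentially"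
    unfolding growth_def[abs_def] sqrt3 using b by real_asymp
  have "(\<lambda>n. ((real n + Q) powr (- 1/4) * exp (b * sqrt (real n + Q)) - real n powr (- 1/4) * exp (b * sqrt (real n))) /
      ((real n + Q) powr (- 3/4) * exp (b * sqrt (real n + Q)))) \<longlonglongrightarrow> Q * b / 2"
    using b Q by real_asymp
  moreover have "Q * b / 2 = real q * (pi / (2 * sqrt 3))" by (simp add: Q_def b_def mult.commute)
  ultimately show *: "(\<lambda>n. (growth (n + q) - growth n) / (real (n + q) powr (- 3/4) * exp (pi * sqrt (real (n + q) / 3))))
      \<longlonglongrightarrow> real q * (pi / (2 * sqrt 3))"
    by (simp only: growth_def sqrt3 Q_def of_nat_add)
  have "real q * (pi / (2 * sqrt 3)) > 0" using assms by simp
  from order_tendstoD(1)[OF * this] show "\<forall>\<^sub>F n in sequentially. growth n < growth (n + q)"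
    using eventually_gt_at_top[of 0]
  proof eventually_elim
    case (elim n)
    have pos: "real (n + q) powr (- 3/4) * exp (pi * sqrt (real (n + q) / 3)) > 0"
      using elim by (intro mult_pos_pos) auto
    have "growth n < growth (n + q)" if "0 < (growth (n + q) - growth n) / e" "e > 0" for e
      using that by (simp add: zero_less_divide_iff)
    from this[OF elim(1) pos] show ?case .
  qed
  define E where "E = real_of_int D"
  have "(\<lambda>n. ((real n + E) powr (- 1/4) * exp (b * sqrt (real n + E))) / (real n powr (- 1/4) * exp (b * sqrt (real n)))) \<longlonglongrightarrow> 1"
    using b by real_asymp
  moreover have "\<forall>\<^sub>F n in sequentially. ((real n + E) powr (- 1/4) * exp (b * sqrt (real n + E))) / (real n powr (- 1/4) * exp (b * sqrt (real n))) =
      growth (nat (int n + D)) / growth n"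
    using eventually_ge_at_top[of "nat \<bar>D\<bar>"]
  proof eventually_elim
    case (elim n)
    then have "real (nat (int n + D)) = real n + E" unfolding E_def by (simp add: of_nat_nat)
    then show ?case unfolding growth_def sqrt3 by simp
  qed
  ultimately show "(\<lambda>n. growth (nat (int n + D)) / growth n) \<longlonglongrightarrow> 1" by (rule Lim_transform_eventually)
qed

definition progression_sum :: "nat \<Rightarrow> nat \<Rightarrow> int" where
  "progression_sum q n = (\<Sum>j\<le>n. odd_count (int n - int q * int j))"

text \<open>A longer range only adds negative arguments, where \<open>odd_count\<close> is 0; both
  uses below rely on this freedom.\<close>

lemma progression_sum_eq:
  assumes "q > 0" "n \<le> N"
  shows "(\<Sum>j\<le>N. odd_count (int n - int q * int j)) = progression_sum q n"
  unfolding progression_sum_def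
proof (rule sum.mono_neutral_right)
  show "\<forall>j\<in>{..N} - {..n}. odd_count (int n - int q * int j) = 0"
  proof
    fix j assume "j \<in> {..N} - {..n}"
    then have "int n < int j" by simp
    also have "int j \<le> int q * int j" using mult_right_mono[of 1 "int q" "int j"] assms(1) by simp
    finally show "odd_count (int n - int q * int j) = 0" by (intro odd_count_neg) simp
  qed
qed (use assms in auto)

text \<open>The increment over \<open>q\<close> is a single value of \<open>odd_count\<close>, which
  is what \<open>stolz_cesaro_step\<close> requires.\<close>

lemma progression_sum_add:
  assumes "q > 0"
  shows "progression_sum q (n + q) = odd_count (int (n + q)) + progression_sum q n"
proof -
  have "progression_sum q (n + q) = (\<Sum>j\<le>Suc (n + q - 1). odd_count (int (n + q) - int q * int j))"
    using assms by (simp add: progression_sum_def)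
  also have "\<dots> = odd_count (int (n + q)) + (\<Sum>j\<le>n + q - 1. odd_count (int n - int q * int j))"
    by (subst sum.atMost_Suc_shift) (simp add: algebra_simps)
  also have "(\<Sum>j\<le>n + q - 1. odd_count (int n - int q * int j)) = progression_sum q n"
    using assms by (intro progression_sum_eq) auto
  finally show ?thesis .
qed

definition growth_const :: real where
  "growth_const = 3 powr (1/4) / (2 * pi)"

lemma progression_sum_tendsto:
  assumes q: "q > 0"
  shows "(\<lambda>n. real_of_int (progression_sum q n) / growth n) \<longlonglongrightarrow> growth_const / real q"
proof (rule stolz_cesaro_step[OF q growth_limits(3)[OF q] _ growth_limits(1)[OF q]])
  let ?e = "\<lambda>n. real n powr (- 3/4) * exp (pi * sqrt (real n / 3))"
  let ?o = "\<lambda>n. real_of_int (odd_count (int n))"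
  have "(\<lambda>n. (?o (n + q) / ?e (n + q)) / ((growth (n + q) - growth n) / ?e (n + q)))
      \<longlonglongrightarrow> (1 / (4 * sqrt (sqrt 3))) / (real q * (pi / (2 * sqrt 3)))"
    using q by (intro tendsto_divide growth_limits(2) LIMSEQ_ignore_initial_segment[OF odd_count_asymptotic]) auto
  also have "(1 / (4 * sqrt (sqrt 3))) / (real q * (pi / (2 * sqrt 3))) = growth_const / real q"
  proof -
    have "sqrt (sqrt 3) * sqrt (sqrt 3) = sqrt (3::real)" by simp
    moreover have "3 powr (1/4) = sqrt (sqrt (3::real))"
      by (simp add: powr_half_sqrt[symmetric] powr_powr)
    ultimately show ?thesis using q by (simp add: growth_const_def field_simps)
  qed
  finally show "(\<lambda>n. (real_of_int (progression_sum q (n + q)) - real_of_int (progression_sum q n)) / (growth (n + q) - growth n))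
      \<longlonglongrightarrow> growth_const / real q"
  proof (rule Lim_transform_eventually)
    show "\<forall>\<^sub>F n in sequentially. (?o (n + q) / ?e (n + q)) / ((growth (n + q) - growth n) / ?e (n + q)) =
        (real_of_int (progression_sum q (n + q)) - real_of_int (progression_sum q n)) / (growth (n + q) - growth n)"
    proof (intro always_eventually allI)
      fix n
      have "?e (n + q) \<noteq> 0" using q by simp
      then show "(?o (n + q) / ?e (n + q)) / ((growth (n + q) - growth n) / ?e (n + q)) =
        (real_of_int (progression_sum q (n + q)) - real_of_int (progression_sum q n)) / (growth (n + q) - growth n)"
        unfolding progression_sum_add[OF q] by simp
    qed
  qed
qed

text \<open>
  The odd \<open>k > a\<close> are \<open>k0 + 2 j\<close> with \<open>k0\<close> the least of them. The range of \<open>k\<close> is allowed to be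
  longer than \<open>k \<le> n\<close>, so that no term is cut off when \<open>d > 0\<close>.
\<close>

lemma sum_odd_count_eq_progression_sum:
  fixes d :: int
  assumes c: "c \<ge> 1" and N: "int n + \<bar>d\<bar> \<le> int N"
    and n: "int n \<ge> \<bar>d\<bar> + int c * int (a + 2)"
  defines "k0 \<equiv> (if odd a then a + 2 else a + 1)"
  shows "(\<Sum>k | odd k \<and> a < k \<and> k \<le> N. odd_count (int n - int c * int k + d)) =
    progression_sum (2 * c) (nat (int n + (d - int c * int k0)))"
proof -
  let ?m = "nat (int n + (d - int c * int k0))"
  have k0: "odd k0" "a < k0" "k0 \<le> a + 2" by (auto simp: k0_def)
  have "int c * int k0 \<le> int c * int (a + 2)" using k0 by (intro mult_left_mono) auto
  then have m: "int ?m = int n + (d - int c * int k0)" using n by simp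
  have "(\<Sum>k | odd k \<and> a < k \<and> k \<le> N. odd_count (int n - int c * int k + d)) =
      (\<Sum>k\<in>(\<lambda>j. k0 + 2 * j) ` {..N}. odd_count (int n - int c * int k + d))"
  proof (rule sum.mono_neutral_left)
    show "{k. odd k \<and> a < k \<and> k \<le> N} \<subseteq> (\<lambda>j. k0 + 2 * j) ` {..N}"
    proof
      fix k assume k: "k \<in> {k. odd k \<and> a < k \<and> k \<le> N}"
      then have "k0 \<le> k" "even (k - k0)" using k0 by (auto simp: k0_def) presburger+
      then have "k = k0 + 2 * ((k - k0) div 2)" by simp
      moreover have "(k - k0) div 2 \<le> N"
        by (rule le_trans[OF div_le_dividend le_trans[OF diff_le_self]]) (use k in simp)
      ultimately show "k \<in> (\<lambda>j. k0 + 2 * j) ` {..N}" by blast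
    qed
    show "\<forall>k\<in>(\<lambda>j. k0 + 2 * j) ` {..N} - {k. odd k \<and> a < k \<and> k \<le> N}. odd_count (int n - int c * int k + d) = 0"
    proof
      fix k assume "k \<in> (\<lambda>j. k0 + 2 * j) ` {..N} - {k. odd k \<and> a < k \<and> k \<le> N}"
      then have "k > N" using k0 by auto
      then have "int n + d < int k" using N by linarith
      also have "int k \<le> int c * int k" using mult_right_mono[of 1 "int c" "int k"] c by simp
      finally show "odd_count (int n - int c * int k + d) = 0" by (intro odd_count_neg) simp
    qed
  qed simp
  also have "\<dots> = (\<Sum>j\<le>N. odd_count (int ?m - int (2 * c) * int j))"
    unfolding m by (subst sum.reindex) (auto simp: inj_on_def algebra_simps)
  also have "\<dots> = progression_sum (2 * c) ?m"
  proof (rule progression_sum_eq)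
    have "0 \<le> int c * int k0" by simp
    then show "?m \<le> N" using N m by linarith
  qed (use c in simp)
  finally show ?thesis .
qed

text \<open>Odd \<open>k\<close> advance by 2, so the arguments advance by \<open>2 * c\<close>. The
  shift \<open>d\<close> and the least admissible \<open>k\<close> are merged into \<open>D\<close>,
  which changes \<open>growth\<close> only by a factor tending to 1.\<close>

lemma sum_odd_count_tendsto:
  assumes c: "c \<ge> 1" and B: "\<bar>d\<bar> \<le> int B"
  shows "(\<lambda>n. real_of_int (\<Sum>k | odd k \<and> a < k \<and> k \<le> n + B. odd_count (int n - int c * int k + d)) / growth n)
    \<longlonglongrightarrow> growth_const * (1 / real (2 * c))"
proof -
  define D where "D = d - int c * int (if odd a then a + 2 else a + 1)"
  have q: "2 * c > 0" using c by simp
  have "filterlim (\<lambda>n. nat (int n + D)) at_top sequentially"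
    unfolding filterlim_at_top
  proof
    fix Z
    show "\<forall>\<^sub>F n in sequentially. Z \<le> nat (int n + D)"
      using eventually_ge_at_top[of "Z + nat \<bar>D\<bar>"] by eventually_elim linarith
  qed
  from filterlim_compose[OF progression_sum_tendsto[OF q] this]
  have "(\<lambda>n. real_of_int (progression_sum (2 * c) (nat (int n + D))) / growth (nat (int n + D)) * (growth (nat (int n + D)) / growth n))
      \<longlonglongrightarrow> growth_const / real (2 * c) * 1"
    by (rule tendsto_mult[OF _ growth_limits(4)[OF q]])
  then have "(\<lambda>n. real_of_int (progression_sum (2 * c) (nat (int n + D))) / growth (nat (int n + D)) * (growth (nat (int n + D)) / growth n))
      \<longlonglongrightarrow> growth_const * (1 / real (2 * c))" by simp
  then show ?thesis
  proof (rule Lim_transform_eventually)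
    show "\<forall>\<^sub>F n in sequentially. real_of_int (progression_sum (2 * c) (nat (int n + D))) / growth (nat (int n + D)) * (growth (nat (int n + D)) / growth n) =
        real_of_int (\<Sum>k | odd k \<and> a < k \<and> k \<le> n + B. odd_count (int n - int c * int k + d)) / growth n"
      using eventually_ge_at_top[of "nat (\<bar>d\<bar> + int c * int (a + 2))"] eventually_ge_at_top[of "nat \<bar>D\<bar> + 1"]
    proof eventually_elim
      case (elim n)
      have "(\<Sum>k | odd k \<and> a < k \<and> k \<le> n + B. odd_count (int n - int c * int k + d)) = progression_sum (2 * c) (nat (int n + D))"
        unfolding D_def using elim B by (intro sum_odd_count_eq_progression_sum c) linarith+
      moreover have "nat (int n + D) > 0" using elim by linarith
      then have "growth (nat (int n + D)) \<noteq> 0" by (simp add: growth_def)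
      ultimately show ?case by simp
    qed
  qed
qed

lemma sum_shift_sum_tendsto:
  assumes "\<forall>(e, c, d)\<in>set ts. c \<ge> 1 \<and> \<bar>d\<bar> \<le> int B"
  shows "(\<lambda>n. real_of_int (\<Sum>k | odd k \<and> a < k \<and> k \<le> n + B. shift_sum ts k (int n)) / growth n)
    \<longlonglongrightarrow> growth_const * (\<Sum>(e, c, d)\<leftarrow>ts. real_of_int e * (1 / real (2 * c)))"
  using assms
proof (induction ts)
  case Nil
  show ?case by (simp add: shift_sum_def)
next
  case (Cons x ts)
  obtain e c d where x: "x = (e, c, d)" by (cases x)
  let ?S = "\<lambda>n. \<Sum>k | odd k \<and> a < k \<and> k \<le> n + B. odd_count (int n - int c * int k + d)"
  let ?T = "\<lambda>n. \<Sum>k | odd k \<and> a < k \<and> k \<le> n + B. shift_sum ts k (int n)"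
  have "(\<Sum>k | odd k \<and> a < k \<and> k \<le> n + B. shift_sum (x # ts) k (int n)) = e * ?S n + ?T n" for n
    by (simp add: x shift_sum_def sum.distrib sum_distrib_left)
  then have "real_of_int (\<Sum>k | odd k \<and> a < k \<and> k \<le> n + B. shift_sum (x # ts) k (int n)) / growth n =
      real_of_int e * (real_of_int (?S n) / growth n) + real_of_int (?T n) / growth n" for n
    by (simp add: add_divide_distrib)
  moreover have "(\<lambda>n. real_of_int e * (real_of_int (?S n) / growth n) + real_of_int (?T n) / growth n)
      \<longlonglongrightarrow> real_of_int e * (growth_const * (1 / real (2 * c))) + growth_const * (\<Sum>(e, c, d)\<leftarrow>ts. real_of_int e * (1 / real (2 * c)))"
    using Cons by (intro tendsto_add tendsto_mult tendsto_const sum_odd_count_tendsto) (auto simp: x)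
  ultimately show ?case by (simp only:) (simp add: x algebra_simps)
qed

lemma slot_count_zero:
  assumes "int k > n"
  shows "slot_count S l k n = 0"
proof -
  have "count M k = 0" if "M \<in> odd_msets n" for M
    using part_le_odd_msets[OF that, of k] assms by (auto simp: count_eq_zero_iff)
  then have "{M \<in> odd_msets n. window_size S M \<le> l \<and> l < window_size S M + count M k} = {}" by auto
  then show ?thesis unfolding slot_count_def by (metis card.empty of_nat_0)
qed

lemma sum_slot_count_tendsto_of_shift_sum:
  assumes ts: "\<forall>(e, c, d)\<in>set ts. c \<ge> 1"
    and eq: "\<And>k n. k > a \<Longrightarrow> odd k \<Longrightarrow> slot_count (S k) l k n = shift_sum ts k n"
  shows "(\<lambda>n. real_of_int (\<Sum>k | odd k \<and> a < k \<and> k \<le> n. slot_count (S k) l k (int n)) / growth n)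
    \<longlonglongrightarrow> growth_const * (\<Sum>(e, c, d)\<leftarrow>ts. real_of_int e * (1 / real (2 * c)))"
proof -
  obtain B where B: "\<forall>(e, c, d)\<in>set ts. \<bar>d\<bar> \<le> int B"
  proof
    show "\<forall>(e, c, d)\<in>set ts. \<bar>d\<bar> \<le> int (\<Sum>(e, c, d)\<leftarrow>ts. nat \<bar>d\<bar>)"
    proof clarify
      fix e c d assume "(e, c, d) \<in> set ts"
      then have "nat \<bar>d\<bar> \<le> (\<Sum>(e, c, d)\<leftarrow>ts. nat \<bar>d\<bar>)" by (intro member_le_sum_list) (force, simp)
      then show "\<bar>d\<bar> \<le> int (\<Sum>(e, c, d)\<leftarrow>ts. nat \<bar>d\<bar>)" by linarith
    qed
  qed
  have "(\<Sum>k | odd k \<and> a < k \<and> k \<le> n. slot_count (S k) l k (int n)) =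
      (\<Sum>k | odd k \<and> a < k \<and> k \<le> n + B. shift_sum ts k (int n))" for n
  proof -
    \<comment> \<open>Extending the range is free for the whole slot count, which vanishes for
      \<open>k > n\<close>, though single terms of its shift sum may be nonzero there. Hence it
      happens before the expansion into terms.\<close>
    have "(\<Sum>k | odd k \<and> a < k \<and> k \<le> n. slot_count (S k) l k (int n)) =
        (\<Sum>k | odd k \<and> a < k \<and> k \<le> n + B. slot_count (S k) l k (int n))"
      by (rule sum.mono_neutral_left) (auto intro!: slot_count_zero)
    then show ?thesis using eq by simp
  qed
  moreover have "\<forall>(e, c, d)\<in>set ts. c \<ge> 1 \<and> \<bar>d\<bar> \<le> int B" using ts B by auto
  ultimately show ?thesis using sum_shift_sum_tendsto[of ts B a] by (simp only:)
qed

lemma sum_slot_count_tendsto: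
  "\<exists>\<beta>\<in>\<rat>. \<beta> \<ge> 0 \<and>
    (\<lambda>n. real_of_int (\<Sum>k | odd k \<and> a < k \<and> k \<le> n. slot_count (odd_window k (a div 2)) l k (int n)) / growth n)
      \<longlonglongrightarrow> growth_const * \<beta>"
proof -
  obtain ts where ts: "\<forall>(e, c, d)\<in>set ts. c \<ge> 1"
    "\<forall>k>a. odd k \<longrightarrow> (\<forall>n. slot_count (odd_window k (a div 2)) l k n = shift_sum ts k n)"
    using is_shift_sum_slot_count[of a l] unfolding is_shift_sum_def by blast
  define \<beta> where "\<beta> = (\<Sum>(e, c, d)\<leftarrow>ts. real_of_int e * (1 / real (2 * c)))"
  have rat: "\<beta> \<in> \<rat>" unfolding \<beta>_def
  proof (induction ts)
    case (Cons x ts)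
    then show ?case by (cases x) simp
  qed simp
  have lim: "(\<lambda>n. real_of_int (\<Sum>k | odd k \<and> a < k \<and> k \<le> n. slot_count (odd_window k (a div 2)) l k (int n)) / growth n)
      \<longlonglongrightarrow> growth_const * \<beta>"
    unfolding \<beta>_def using ts by (intro sum_slot_count_tendsto_of_shift_sum) auto
  \<comment> \<open>The signs in \<open>ts\<close> mix, so nonnegativity comes from the limit of
    nonnegative counts.\<close>
  have "growth_const * \<beta> \<ge> 0"
  proof (rule tendsto_lowerbound[OF lim])
    show "\<forall>\<^sub>F n in sequentially. 0 \<le> real_of_int (\<Sum>k | odd k \<and> a < k \<and> k \<le> n. slot_count (odd_window k (a div 2)) l k (int n)) / growth n"
      by (intro always_eventually allI divide_nonneg_nonneg) (auto simp: growth_def slot_count_def intro!: sum_nonneg)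
  qed simp
  moreover have "growth_const > 0" by (simp add: growth_const_def)
  ultimately have "\<beta> \<ge> 0" by (simp add: zero_le_mult_iff)
  with rat lim show ?thesis by blast
qed

lemma sum_slot_count_tendsto_arm_0:
  assumes "h \<ge> 1"
  shows "(\<lambda>n. real_of_int (\<Sum>k | odd k \<and> 0 < k \<and> k \<le> n. slot_count (odd_window k 0) (h - 1) k (int n)) / growth n)
      \<longlonglongrightarrow> growth_const * (1 / real (2 * h))"
proof -
  have "slot_count (odd_window k 0) (h - 1) k n = shift_sum [(1, h, 0)] k n" if "odd k" for k n
    using slot_count_empty[OF that, of "h - 1" n] assms by (simp add: odd_window_def shift_sum_def)
  from sum_slot_count_tendsto_of_shift_sum[of "[(1, h, 0)]" 0 "\<lambda>k. odd_window k 0" "h - 1", OF _ this]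
  show ?thesis using assms by simp
qed

theorem theorem1p4:
  fixes h :: nat
  assumes "h \<ge> 1"
  shows "\<exists>\<alpha>::real. \<alpha> \<in> \<rat> \<and>
    (\<lambda>n. real (odd_hook_count h n)) \<sim>[sequentially]
    (\<lambda>n. \<alpha> * (3 powr (1/4) / (2 * pi * real n powr (1/4))) * exp (pi * sqrt (real n / 3)))"
proof -
  let ?S = "\<lambda>a n. real_of_int (\<Sum>k | odd k \<and> a < k \<and> k \<le> n. slot_count (odd_window k (a div 2)) (h - 1 - a) k (int n)) / growth n"
  have "\<forall>a. \<exists>\<beta>. \<beta> \<in> \<rat> \<and> \<beta> \<ge> 0 \<and> ?S a \<longlonglongrightarrow> growth_const * \<beta>"
    using sum_slot_count_tendsto by blast
  from choice[OF this] obtain \<beta> where "\<forall>a. \<beta> a \<in> \<rat> \<and> \<beta> a \<ge> 0 \<and> ?S a \<longlonglongrightarrow> growth_const * \<beta> a" ..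
  then have \<beta>: "\<beta> a \<in> \<rat>" "\<beta> a \<ge> 0" "?S a \<longlonglongrightarrow> growth_const * \<beta> a" for a by simp_all
  define \<alpha> where "\<alpha> = (\<Sum>a<h. \<beta> a)"
  have pos: "growth_const > 0" by (simp add: growth_const_def)
  have "\<alpha> \<in> \<rat>" unfolding \<alpha>_def using \<beta>(1) by (rule Rats_sum)
  have "?S 0 \<longlonglongrightarrow> growth_const * (1 / real (2 * h))"
    using sum_slot_count_tendsto_arm_0[OF assms] by simp
  \<comment> \<open>\<open>\<beta>\<close> came from a choice, so its value at arm 0 is identified
    through uniqueness of limits.\<close>
  from LIMSEQ_unique[OF \<beta>(3)[of 0] this] have "\<beta> 0 = 1 / real (2 * h)"
    using pos by (simp only: mult_cancel_left) simp
  then have "\<beta> 0 > 0" using assms by simp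
  also have "\<beta> 0 \<le> \<alpha>" unfolding \<alpha>_def using assms \<beta>(2) by (intro member_le_sum) auto
  \<comment> \<open>Positivity is essential: it permits the division by
    \<open>\<alpha> * growth_const\<close> that turns the limit into asymptotic equivalence.\<close>
  finally have "\<alpha> > 0" .
  have "(\<lambda>n. \<Sum>a<h. ?S a n) \<longlonglongrightarrow> (\<Sum>a<h. growth_const * \<beta> a)" by (intro tendsto_sum \<beta>)
  moreover have "(\<Sum>a<h. ?S a n) = real (odd_hook_count h n) / growth n" for n
  proof -
    have "real (odd_hook_count h n) = real_of_int (int (odd_hook_count h n))" by simp
    then show ?thesis unfolding odd_hook_count_eq_sum by (simp add: sum_divide_distrib)
  qed
  ultimately have "(\<lambda>n. real (odd_hook_count h n) / growth n) \<longlonglongrightarrow> \<alpha> * growth_const"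
    by (simp add: \<alpha>_def sum_distrib_left mult.commute)
  then have "(\<lambda>n. real (odd_hook_count h n) / growth n / (\<alpha> * growth_const)) \<longlonglongrightarrow> \<alpha> * growth_const / (\<alpha> * growth_const)"
    using \<open>\<alpha> > 0\<close> pos by (intro tendsto_divide) auto
  then have lim: "(\<lambda>n. real (odd_hook_count h n) / growth n / (\<alpha> * growth_const)) \<longlonglongrightarrow> 1"
    using \<open>\<alpha> > 0\<close> pos by simp
  have eq: "\<alpha> * (3 powr (1/4) / (2 * pi * real n powr (1/4))) * exp (pi * sqrt (real n / 3)) = growth n * (\<alpha> * growth_const)" for n
  proof -
    have "growth n = inverse (real n powr (1/4)) * exp (pi * sqrt (real n / 3))"
      by (simp only: growth_def powr_minus minus_divide_left[symmetric])
    then show ?thesis by (simp only: growth_const_def divide_inverse inverse_mult_distrib mult_ac)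
  qed
  have "(\<lambda>n. real (odd_hook_count h n)) \<sim>[sequentially]
    (\<lambda>n. \<alpha> * (3 powr (1/4) / (2 * pi * real n powr (1/4))) * exp (pi * sqrt (real n / 3)))"
    unfolding eq by (rule asymp_equivI') (use lim in \<open>simp only: divide_divide_eq_left\<close>)
  with \<open>\<alpha> \<in> \<rat>\<close> show ?thesis by blast
qed

end
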